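(* Consider the interconnected system described in the context, with a partition $\{1,\dots,n\}=I_\Sigma\cup I_{\max}$, and assume each subsystem $i$ has an ISS Lyapunov function $V_i$ (in the mixed sense defined in the context) with gains $\gamma_{ij}\in\mathcal{K}_\infty\cup\{0\}$, $\gamma_i\in\mathcal{K}$. Let $\Gamma$ be the gain operator built from $(\gamma_{ij})$. If $\Gamma$ is irreducible and there exists $\alpha\in\mathcal{K}_\infty$ such that $\Gamma\circ D_\alpha(s)\not\ge s$ for all $s\in\mathbb{R}^n_+\setminus\{0\}$, then the whole system $\dot x=f(x,u)$ is ISS and, for an arbitrary $\Omega$-path $\sigma\in\mathcal{K}_\infty^n$ with respect to $D_\alpha\circ\Gamma$, the function $V(x)=\max_{i=1,\dots,n}\sigma_i^{-1}(V_i(x_i))$ is an ISS Lyapunov function for the whole system.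
   Context: The interconnection is $\dot x_i=f_i(x_1,\dots,x_n,u_i)$, $i=1,\dots,n$, $x_i\in\mathbb{R}^{N_i}$, $u_i\in\mathbb{R}^{m_i}$, each $f_i$ continuous and, for every $r$, locally Lipschitz in $x=(x_1^T,\dots,x_n^T)^T$ uniformly in $|u_i|\le r$; written as $\dot x=f(x,u)$. $\mathcal{K}$: continuous strictly increasing functions $\mathbb{R}_+\to\mathbb{R}_+$ vanishing at $0$; $\mathcal{K}_\infty$: unbounded ones. A continuous $\rho:\mathbb{R}_+\to\mathbb{R}_+$ is positive definite if $\rho(r)=0\iff r=0$. $V:\mathbb{R}^N\to\mathbb{R}_+$ is proper and positive definite if $\psi_1(\|x\|)\le V(x)\le\psi_2(\|x\|)$ for some $\psi_1,\psi_2\in\mathcal{K}_\infty$. An ISS Lyapunov function for $\dot x=f(x,u)$ is a continuous $V$, proper, positive definite, locally Lipschitz on $\mathbb{R}^N\setminus\{0\}$, such that for some $\gamma\in\mathcal{K}$ and positive definite $\alpha$, at all points of differentiability, $V(x)\ge\gamma(\|u\|)\Rightarrow\nabla V(x)f(x,u)\le-\alpha(\|x\|)$. $V_i:\mathbb{R}^{N_i}\to\mathbb{R}_+$ is an ISS Lyapunov function for subsystem $i$ if it is continuous, proper, positive definite, locally Lipschitz on $\mathbb{R}^{N_i}\setminus\{0\}$, and there are $\gamma_{ij}\in\mathcal{K}_\infty\cup\{0\}$ ($\gamma_{ii}\equiv0$), $\gamma_i\in\mathcal{K}$ and positive definite $\alpha_i$ such that at all points of differentiability of $V_i$: for $i\in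 I_\Sigma$, $V_i(x_i)\ge\sum_j\gamma_{ij}(V_j(x_j))+\gamma_i(\|u\|)\Rightarrow\nabla V_i(x_i)f_i(x,u)\le-\alpha_i(\|x_i\|)$; for $i\in I_{\max}$, $V_i(x_i)\ge\max\{\max_j\gamma_{ij}(V_j(x_j)),\gamma_i(\|u\|)\}\Rightarrow\nabla V_i(x_i)f_i(x,u)\le-\alpha_i(\|x_i\|)$. $\Gamma(s)=(\Gamma_i(s))_i$ with $\Gamma_i(s)=\sum_j\gamma_{ij}(s_j)$ ($i\in I_\Sigma$), $\Gamma_i(s)=\max_j\gamma_{ij}(s_j)$ ($i\in I_{\max}$); $D_\alpha(s)=(D_i(s_i))_i$ with $D_i=\mathrm{id}+\alpha$ for $i\in I_\Sigma$, $D_i=\mathrm{id}$ for $i\in I_{\max}$. For $x,y\in\mathbb{R}^n$: $x<y$ iff $x_i<y_i$ for all $i$; $x\not\ge y$ iff $x_i<y_i$ for some $i$. $\Gamma$ is irreducible if the directed graph on $\{1,\dots,n\}$ with an edge $(i,j)$ whenever $\gamma_{ij}\ne0$ is strongly connected. A continuous $\sigma=(\sigma_1,\dots,\sigma_n)$ with $\sigma_i\in\mathcal{K}_\infty$ is an $\Omega$-path with respect to a map $M:\mathbb{R}^n_+\to\mathbb{R}^n_+$ if (i) each $\sigma_i^{-1}$ is locally Lipschitz on $(0,\infty)$; (ii) for every compact $P\subset(0,\infty)$ there are constants $0<c\le C$ with $c\le(\sigma_i^{-1})'(r)\le C$ for all $r\in P$ at which $\sigma_i^{-1}$ is differentiable,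 $i=1,\dots,n$; (iii) $M(\sigma(r))<\sigma(r)$ for all $r>0$. *)

theory Defs
  imports "HOL-Analysis.Analysis"
begin

section \<open>Comparison functions\<close>

text \<open>Functions R+ -> R+ are modelled as real => real; only values on {0..} matter.\<close>

definition classK :: "(real \<Rightarrow> real) \<Rightarrow> bool" where
  "classK g \<longleftrightarrow> continuous_on {0..} g \<and> strict_mono_on {0..} g \<and> g 0 = 0"

definition classKinf :: "(real \<Rightarrow> real) \<Rightarrow> bool" where
  "classKinf g \<longleftrightarrow> classK g \<and> filterlim g at_top at_top"

definition zero_gain :: "(real \<Rightarrow> real) \<Rightarrow> bool" where
  "zero_gain g \<longleftrightarrow> (\<forall>s\<ge>0. g s = 0)"

definition posdef :: "(real \<Rightarrow> real) \<Rightarrow> bool" where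
  "posdef \<rho> \<longleftrightarrow> continuous_on {0..} \<rho> \<and> (\<forall>r\<ge>0. \<rho> r \<ge> 0 \<and> (\<rho> r = 0 \<longleftrightarrow> r = 0))"

definition classKL :: "(real \<Rightarrow> real \<Rightarrow> real) \<Rightarrow> bool" where
  "classKL \<beta> \<longleftrightarrow> continuous_on ({0..} \<times> {0..}) (case_prod \<beta>) \<and>
     (\<forall>t\<ge>0. classK (\<lambda>r. \<beta> r t)) \<and>
     (\<forall>r\<ge>0. (\<forall>t1 t2. 0 \<le> t1 \<longrightarrow> t1 \<le> t2 \<longrightarrow> \<beta> r t2 \<le> \<beta> r t1) \<and>
             ((\<lambda>t. \<beta> r t) \<longlongrightarrow> 0) at_top)"

text \<open>Inverse of a K-infinity function on R+.\<close>
definition Kinv :: "(real \<Rightarrow> real) \<Rightarrow> real \<Rightarrow> real" where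
  "Kinv g = inv_into {0..} g"

text \<open>Local Lipschitz continuity on a set S (w.r.t. the relative topology).\<close>
definition locLip :: "'a::metric_space set \<Rightarrow> ('a \<Rightarrow> 'b::metric_space) \<Rightarrow> bool" where
  "locLip S V \<longleftrightarrow> (\<forall>\<xi>\<in>S. \<exists>\<delta>>0. \<exists>L. \<forall>a\<in>S \<inter> ball \<xi> \<delta>. \<forall>b\<in>S \<inter> ball \<xi> \<delta>.
       dist (V a) (V b) \<le> L * dist a b)"

section \<open>Block structure of the state / input spaces\<close>

text \<open>The global state x in R^N is real^'d; coordinate k belongs to subsystem blk k.
  The component x_i in R^{N_i} is identified with the vector bproj blk i x in the
  coordinate subspace bspace blk i (Euclidean norms agree).\<close>

definition bproj :: "('d::finite \<Rightarrow> nat) \<Rightarrow> nat \<Rightarrow> real^'d \<Rightarrow> real^'d" where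
  "bproj blk i x = (\<chi> k. if blk k = i then x $ k else 0)"

definition bspace :: "('d::finite \<Rightarrow> nat) \<Rightarrow> nat \<Rightarrow> (real^'d) set" where
  "bspace blk i = {x. \<forall>k. blk k \<noteq> i \<longrightarrow> x $ k = 0}"

section \<open>Gain operator, D_alpha, irreducibility, Omega-paths\<close>

definition gain_op :: "nat \<Rightarrow> nat set \<Rightarrow> (nat \<Rightarrow> nat \<Rightarrow> real \<Rightarrow> real) \<Rightarrow> (nat \<Rightarrow> real) \<Rightarrow> nat \<Rightarrow> real" where
  "gain_op n Isum \<gamma> s i =
     (if i \<in> Isum then (\<Sum>j<n. \<gamma> i j (s j)) else Max ((\<lambda>j. \<gamma> i j (s j)) ` {..<n}))"

definition Dalpha :: "nat set \<Rightarrow> (real \<Rightarrow> real) \<Rightarrow> (nat \<Rightarrow> real) \<Rightarrow> nat \<Rightarrow> real" where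
  "Dalpha Isum \<alpha> s i = (if i \<in> Isum then s i + \<alpha> (s i) else s i)"

definition gain_irreducible :: "nat \<Rightarrow> (nat \<Rightarrow> nat \<Rightarrow> real \<Rightarrow> real) \<Rightarrow> bool" where
  "gain_irreducible n \<gamma> \<longleftrightarrow>
     (\<forall>i<n. \<forall>j<n. (i, j) \<in> {(i, j). i < n \<and> j < n \<and> \<not> zero_gain (\<gamma> i j)}\<^sup>*)"

definition Omega_path :: "nat \<Rightarrow> ((nat \<Rightarrow> real) \<Rightarrow> nat \<Rightarrow> real) \<Rightarrow> (nat \<Rightarrow> real \<Rightarrow> real) \<Rightarrow> bool" where
  "Omega_path n M \<sigma> \<longleftrightarrow>
     (\<forall>i<n. classKinf (\<sigma> i)) \<and>
     (\<forall>i<n. locLip {0<..} (Kinv (\<sigma> i))) \<and>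
     (\<forall>P. compact P \<and> P \<subseteq> {0<..} \<longrightarrow>
        (\<exists>c C. 0 < c \<and> c \<le> C \<and>
           (\<forall>i<n. \<forall>r\<in>P. \<forall>d. (Kinv (\<sigma> i) has_real_derivative d) (at r) \<longrightarrow> c \<le> d \<and> d \<le> C))) \<and>
     (\<forall>r>0. \<forall>i<n. M (\<lambda>j. \<sigma> j r) i < \<sigma> i r)"

section \<open>The interconnection and ISS notions\<close>

text \<open>Regularity: continuity, and each f_i locally Lipschitz in x uniformly in |u_i| <= r.\<close>
definition sys_regular :: "nat \<Rightarrow> ('d::finite \<Rightarrow> nat) \<Rightarrow> ('m::finite \<Rightarrow> nat) \<Rightarrow>
    (real^'d \<Rightarrow> real^'m \<Rightarrow> real^'d) \<Rightarrow> bool" where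
  "sys_regular n blk blkU F \<longleftrightarrow> continuous_on UNIV (case_prod F) \<and>
     (\<forall>i<n. \<forall>x u. bproj blk i (F x u) = bproj blk i (F x (bproj blkU i u))) \<and>
     (\<forall>i<n. \<forall>r. \<forall>x0. \<exists>\<delta>>0. \<exists>L. \<forall>x\<in>ball x0 \<delta>. \<forall>y\<in>ball x0 \<delta>. \<forall>u.
        norm (bproj blkU i u) \<le> r \<longrightarrow>
        norm (bproj blk i (F x u) - bproj blk i (F y u)) \<le> L * norm (x - y))"

definition sub_ISS_Lyap :: "nat \<Rightarrow> ('d::finite \<Rightarrow> nat) \<Rightarrow> nat set \<Rightarrow>
    (real^'d \<Rightarrow> real^'m::finite \<Rightarrow> real^'d) \<Rightarrow> (nat \<Rightarrow> real^'d \<Rightarrow> real) \<Rightarrow>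
    (nat \<Rightarrow> nat \<Rightarrow> real \<Rightarrow> real) \<Rightarrow> (nat \<Rightarrow> real \<Rightarrow> real) \<Rightarrow> (nat \<Rightarrow> real \<Rightarrow> real) \<Rightarrow> nat \<Rightarrow> bool" where
  "sub_ISS_Lyap n blk Isum F V \<gamma> gi \<alpha>i i \<longleftrightarrow>
     continuous_on (bspace blk i) (V i) \<and>
     (\<exists>\<psi>1 \<psi>2. classKinf \<psi>1 \<and> classKinf \<psi>2 \<and>
        (\<forall>\<xi>\<in>bspace blk i. \<psi>1 (norm \<xi>) \<le> V i \<xi> \<and> V i \<xi> \<le> \<psi>2 (norm \<xi>))) \<and>
     locLip (bspace blk i - {0}) (V i) \<and>
     classK (gi i) \<and> posdef (\<alpha>i i) \<and>
     (\<forall>x u D. (V i has_derivative D) (at (bproj blk i x) within bspace blk i) \<longrightarrow>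
        V i (bproj blk i x) \<ge>
          (if i \<in> Isum then (\<Sum>j<n. \<gamma> i j (V j (bproj blk j x))) + gi i (norm u)
           else max (Max ((\<lambda>j. \<gamma> i j (V j (bproj blk j x))) ` {..<n})) (gi i (norm u))) \<longrightarrow>
        D (bproj blk i (F x u)) \<le> - \<alpha>i i (norm (bproj blk i x)))"

definition ISS_Lyap :: "(real^'d::finite \<Rightarrow> real^'m::finite \<Rightarrow> real^'d) \<Rightarrow> (real^'d \<Rightarrow> real) \<Rightarrow> bool" where
  "ISS_Lyap F V \<longleftrightarrow> continuous_on UNIV V \<and>
     (\<exists>\<psi>1 \<psi>2. classKinf \<psi>1 \<and> classKinf \<psi>2 \<and> (\<forall>x. \<psi>1 (norm x) \<le> V x \<and> V x \<le> \<psi>2 (norm x))) \<and>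
     locLip (UNIV - {0}) V \<and>
     (\<exists>\<gamma> \<alpha>. classK \<gamma> \<and> posdef \<alpha> \<and>
        (\<forall>x u D. (V has_derivative D) (at x) \<longrightarrow> V x \<ge> \<gamma> (norm u) \<longrightarrow> D (F x u) \<le> - \<alpha> (norm x)))"

text \<open>Inputs: measurable, essentially bounded on [0,inf); L-infinity norm = ess sup.\<close>
definition admissible_input :: "(real \<Rightarrow> 'm::euclidean_space) \<Rightarrow> bool" where
  "admissible_input u \<longleftrightarrow> u \<in> borel_measurable lborel \<and>
     (\<exists>c. AE t in lborel. 0 \<le> t \<longrightarrow> norm (u t) \<le> c)"

definition linf :: "(real \<Rightarrow> 'm::euclidean_space) \<Rightarrow> real" where
  "linf u = Inf {c. 0 \<le> c \<and> (AE t in lborel. 0 \<le> t \<longrightarrow> norm (u t) \<le> c)}"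

text \<open>Caratheodory solution on [0,T].\<close>
definition is_solution :: "('x::euclidean_space \<Rightarrow> 'm \<Rightarrow> 'x) \<Rightarrow> (real \<Rightarrow> 'm) \<Rightarrow> (real \<Rightarrow> 'x) \<Rightarrow> real \<Rightarrow> bool" where
  "is_solution F u x T \<longleftrightarrow> continuous_on {0..T} x \<and>
     (\<forall>t\<in>{0..T}. ((\<lambda>s. F (x s) (u s)) has_integral (x t - x 0)) {0..t})"

definition ISS :: "('x::euclidean_space \<Rightarrow> 'm::euclidean_space \<Rightarrow> 'x) \<Rightarrow> bool" where
  "ISS F \<longleftrightarrow>
     (\<exists>\<beta> \<gamma>. classKL \<beta> \<and> classK \<gamma> \<and>
        (\<forall>u x T. admissible_input u \<longrightarrow> 0 \<le> T \<longrightarrow> is_solution F u x T \<longrightarrow>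
           (\<forall>t\<in>{0..T}. norm (x t) \<le> \<beta> (norm (x 0)) t + \<gamma> (linf u)))) \<and>
     (\<forall>x0 u. admissible_input u \<longrightarrow> (\<exists>x. x 0 = x0 \<and> (\<forall>T\<ge>0. is_solution F u x T)))"

end

theory Submission
  imports Defs
begin

text \<open>
  Let \<open>M = D\<^sub>\<alpha> \<circ> \<Gamma>\<close>. Along a path \<open>\<sigma>\<close> with \<open>M (\<sigma> r) < \<sigma> r\<close>, every subsystem \<open>i\<close> that attains the
  maximum in \<open>V x = max\<^sub>i \<sigma>\<^sub>i\<^sup>-\<^sup>1 (V\<^sub>i x\<^sub>i)\<close> satisfies its own decrease condition with room to spare for
  the input. The decrease of \<open>V\<^sub>i\<close> is known only where \<open>V\<^sub>i\<close> is differentiable; by Rademacher's theorem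
  and Fubini it integrates to a bound on the upper Dini derivative of \<open>V\<^sub>i\<close> at every point, which
  passes to the maximum even where \<open>V\<close> is differentiable but no active \<open>V\<^sub>i\<close> is.

  Stability needs one such path. Brouwer's theorem gives points \<open>s\<close> of any prescribed size with
  \<open>M s \<le> s\<close>; iterating \<open>(id + M) / 2\<close> from \<open>s\<close> gives an increasing path from \<open>0\<close> to \<open>s\<close>, and a compactness
  argument yields one path up to infinity. Applying \<open>(id + M) / 2\<close> to it \<open>n\<close> times makes the
  inequality strict, irreducibility makes all components positive and unbounded, and a piecewise
  linear interpolation makes the path bi-Lipschitz. The resulting \<open>V\<close> decreases along solutions at
  a rate \<open>\<kappa> V\<close>, which integrates to the KL estimate; the estimate in turn bounds solutions a priori, so that
  Picard iteration for a truncated vector field produces global solutions.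
\<close>

section \<open>Lipschitz functions and the theorem of Rademacher\<close>

text \<open>Two mismatches shape the proof. The small-gain hypothesis concerns
  \<open>\<Gamma> \<circ> D\<close>, the paths concern \<open>D \<circ> \<Gamma>\<close>; the order
  is exchanged by testing the hypothesis at \<open>\<Gamma> s\<close> instead of \<open>s\<close>
  (see \<open>M_not_ge\<close>). And the decrease condition of an active subsystem is needed at
  almost all points near \<open>x\<close>, not at \<open>x\<close>, where \<open>V i\<close> may
  fail to be differentiable: this is why the path inequality must be strict, for then the condition
  persists on a neighbourhood while the input value is frozen. Positive lower bounds that are known
  only on compact intervals are turned into continuous positive definite functions by
  \<open>posdef_minorant\<close>. This happens three times: for the step length along the path, for
  the decay rate in terms of the norm of the state, and for the decay rate in terms of the value of
  the Lyapunov function. Brouwer's theorem is applied inside the state space itself, which has room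
  for an \<open>n\<close>-component vector because every subsystem contributes at least one
  coordinate.\<close>

lemma lipschitz_increasing_integral_representation:
  fixes f :: "real \<Rightarrow> real"
  assumes lip: "L-lipschitz_on UNIV f" and inc: "\<And>x y. x \<le> y \<Longrightarrow> y - x \<le> f y - f x"
  obtains h where "\<And>a b. a \<le> b \<Longrightarrow> (h has_integral (f b - f a)) {a..b}"
proof -
  have inj: "x = y" if "f x = f y" for x y
    using inc[of x y] inc[of y x] that by linarith
  have cont: "continuous_on A f" for A
    using lip lipschitz_on_continuous_on continuous_on_subset by blast
  have surj: "\<exists>x. f x = y" for y
  proof -
    define a where "a = - \<bar>y - f 0\<bar>" define b where "b = \<bar>y - f 0\<bar>"
    have "f a \<le> y" "y \<le> f b" "a \<le> b"
      using inc[of a 0] inc[of 0 b] by (auto simp: a_def b_def)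
    then show ?thesis using IVT'[of f a y b] cont by blast
  qed
  define g where "g = inv f"
  have bij: "bij f" using inj surj by (metis bijI injI surjI)
  have fg: "f (g y) = y" and gf: "g (f x) = x" for x y
    unfolding g_def using bij by (auto simp: bij_is_surj bij_is_inj surj_f_inv_f)
  have "\<bar>g x - g y\<bar> \<le> \<bar>x - y\<bar>" for x y
    using inc[of "g x" "g y"] inc[of "g y" "g x"] by (auto simp: fg abs_if split: if_splits)
  then have "1-lipschitz_on UNIV g" by (auto intro!: lipschitz_onI simp: dist_real_def)
  then have gm [measurable]: "g \<in> borel_measurable borel"
    by (intro borel_measurable_continuous_onI lipschitz_on_continuous_on)
  \<comment> \<open>The push-forward under the inverse gives a set the length of its image under
    \<open>f\<close>, so half-open intervals receive the increments of \<open>f\<close>. Slope at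
    least 1 makes \<open>g\<close> 1-Lipschitz, hence measurable; the Lipschitz bound on
    \<open>f\<close> keeps null sets null, so a Radon-Nikodym density exists.\<close>
  define N where "N = distr lborel borel g"
  have N_sets: "sets N = sets lborel" by (simp add: N_def)
  have vim: "g -` A = f ` A" for A
    by (auto simp: gf) (metis fg image_eqI)
  have N_em: "emeasure N A = emeasure lborel (f ` A)" if "A \<in> sets borel" for A
    using that unfolding N_def by (subst emeasure_distr) (auto simp: vim)
  have fIoc: "f ` {a<..b} = {f a<..f b}" if "a \<le> b" for a b
  proof -
    have mono: "f x < f y \<longleftrightarrow> x < y" "f x \<le> f y \<longleftrightarrow> x \<le> y" for x y
      using inc[of x y] inc[of y x] inj[of x y] by (smt (verit))+
    have "y \<in> f ` {a<..b}" if "f a < y" "y \<le> f b" for y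
      using that mono(1)[of a "g y"] mono(2)[of "g y" b] by (intro image_eqI[of _ _ "g y"]) (auto simp: fg)
    then show ?thesis by (auto simp: mono)
  qed
  have ac: "absolutely_continuous lborel N"
    unfolding absolutely_continuous_def
  proof
    fix A :: "real set" assume A: "A \<in> null_sets lborel"
    then have "negligible A"
      by (simp add: negligible_iff_null_sets null_sets_completionI)
    then have "negligible (f ` A)"
      by (rule negligible_locally_Lipschitz_image[rotated])
         (use lip in \<open>auto simp: lipschitz_on_def dist_norm intro!: exI[of _ UNIV] exI[of _ L]\<close>)
    moreover have "f ` A \<in> sets borel"
      using A measurable_sets[OF gm, of A] by (simp add: vim null_sets_def)
    ultimately have "emeasure lborel (f ` A) = 0"
      by (simp add: negligible_iff_null_sets null_sets_completion_iff null_sets_def)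
    then show "A \<in> null_sets N" using A N_em[of A] N_sets by (auto simp: null_sets_def)
  qed
  obtain k where km [measurable]: "k \<in> borel_measurable lborel" and k: "density lborel k = N"
    using sigma_finite_measure.Radon_Nikodym[OF sigma_finite_lborel ac N_sets] by auto
  have nnk: "(\<integral>\<^sup>+x. k x * indicator {a<..b} x \<partial>lborel) = ennreal (f b - f a)" if "a \<le> b" for a b
  proof -
    have "(\<integral>\<^sup>+x. k x * indicator {a<..b} x \<partial>lborel) = emeasure N {a<..b}"
      unfolding k[symmetric] by (subst emeasure_density) auto
    also have "\<dots> = ennreal (f b - f a)"
      using inc[OF that] that by (subst N_em) (auto simp: fIoc)
    finally show ?thesis .
  qed
  have fin: "AE x in lborel. k x \<noteq> \<infinity>"
  proof -
    have "AE x in lborel. \<forall>n::nat. k x * indicator {- real n<..real n} x \<noteq> \<infinity>"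
      unfolding AE_all_countable
      by (intro allI nn_integral_PInf_AE) (auto simp: nnk)
    then show ?thesis
    proof (rule AE_mp, intro AE_I2 impI)
      fix x assume *: "\<forall>n::nat. k x * indicator {- real n<..real n} x \<noteq> \<infinity>"
      obtain n :: nat where "\<bar>x\<bar> < n" using reals_Archimedean2 by blast
      then have "indicator {- real n<..real n} x = (1::ennreal)" by (auto simp: indicator_def)
      then show "k x \<noteq> \<infinity>" using *[rule_format, of n] by simp
    qed
  qed
  define h where "h = (\<lambda>x. enn2real (k x))"
  have hm [measurable]: "h \<in> borel_measurable borel" using km by (simp add: h_def)
  have "(h has_integral (f b - f a)) {a..b}" if "a \<le> b" for a b
  proof -
    have "(\<integral>\<^sup>+x. ennreal (h x * indicator {a<..b} x) \<partial>lborel) = ennreal (f b - f a)"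
      unfolding nnk[OF that, symmetric]
      by (rule nn_integral_cong_AE, rule AE_mp[OF fin])
         (auto simp: h_def indicator_def ennreal_enn2real_if top.not_eq_extremum)
    then have "((\<lambda>x. h x * indicator {a<..b} x) has_integral (f b - f a)) UNIV"
      using inc[OF that] that by (intro nn_integral_has_integral) (auto simp: h_def)
    then have "((\<lambda>x. if x \<in> {a<..b} then h x else 0) has_integral (f b - f a)) UNIV"
      by (rule has_integral_eq[rotated]) auto
    then have "(h has_integral (f b - f a)) {a<..b}"
      by (simp only: has_integral_restrict_UNIV)
    moreover have "negligible {x \<in> {a<..b} - {a..b}. h x \<noteq> 0}"
      by (rule negligible_subset[of "{a}"]) auto
    moreover have "negligible {x \<in> {a..b} - {a<..b}. h x \<noteq> 0}"
      by (rule negligible_subset[of "{a}"]) auto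
    ultimately show ?thesis
      using has_integral_spike_set_eq by blast
  qed
  then show ?thesis using that by blast
qed

text \<open>Slopes of \<open>f\<close> are at least \<open>- L\<close>, so adding
  \<open>(L + 1) * x\<close> makes them at least 1 and yields an integrand; Lebesgue differentiation
  then identifies that integrand with the derivative off a null set.\<close>

lemma lipschitz_real_integral_derivative:
  fixes f :: "real \<Rightarrow> real"
  assumes lip: "L-lipschitz_on UNIV f"
  obtains h N where "negligible N"
    "\<And>a b. a \<le> b \<Longrightarrow> (h has_integral (f b - f a)) {a..b}"
    "\<And>x. x \<notin> N \<Longrightarrow> (f has_real_derivative h x) (at x)"
proof -
  have L0: "0 \<le> L" using lip lipschitz_on_nonneg by blast
  define F where "F = (\<lambda>x. f x + (L + 1) * x)"
  have Flip: "(L + (L + 1))-lipschitz_on UNIV F"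
    unfolding F_def by (intro lipschitz_on_add lip) (use L0 in \<open>auto intro!: lipschitz_onI simp: dist_real_def abs_mult simp flip: right_diff_distrib\<close>)
  have Finc: "y - x \<le> F y - F x" if "x \<le> y" for x y
  proof -
    have "\<bar>f x - f y\<bar> \<le> L * \<bar>x - y\<bar>" using lipschitz_onD[OF lip, of x y] by (simp add: dist_real_def)
    then show ?thesis using that by (simp add: F_def algebra_simps abs_if split: if_splits)
  qed
  obtain k where k: "\<And>a b. a \<le> b \<Longrightarrow> (k has_integral (F b - F a)) {a..b}"
    using lipschitz_increasing_integral_representation[OF Flip Finc] by blast
  define h where "h = (\<lambda>x. k x - (L + 1))"
  have hI: "(h has_integral (f b - f a)) {a..b}" if "a \<le> b" for a b
  proof -
    have "((\<lambda>x. k x - (L + 1)) has_integral ((F b - F a) - (b - a) * (L + 1))) {a..b}"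
      using has_integral_diff[OF k[OF that] has_integral_const_real[of "L+1" a b]] that by simp
    moreover have "(F b - F a) - (b - a) * (L + 1) = f b - f a" by (simp add: F_def algebra_simps)
    ultimately show ?thesis by (simp add: h_def)
  qed
  have int: "h integrable_on cbox a b" for a b
    using hI[of a b] by (cases "a \<le> b") (auto simp: integrable_on_def)
  \<comment> \<open>The differentiation theorem gives averages over intervals to the right of a
    point. The reflected integrand supplies those to the left, at the price of a second exceptional
    set.\<close>
  have int': "(\<lambda>x. h (-x)) integrable_on cbox a b" for a b
    using int[of "-b" "-a"] integrable_reflect[of h b a] integrable_reflect[of h "-a" "-b"] by simp
  obtain N1 where N1: "negligible N1" "\<And>x e. \<lbrakk>x \<notin> N1; 0 < e\<rbrakk> \<Longrightarrow>
               \<exists>d>0. \<forall>t. 0 < t \<and> t < d \<longrightarrow> norm(integral (cbox x (x + t *\<^sub>R One)) h /\<^sub>R t ^ DIM(real) - h x) < e"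
    using integrable_ccontinuous_explicit[OF int] by metis
  obtain N2 where N2: "negligible N2" "\<And>x e. \<lbrakk>x \<notin> N2; 0 < e\<rbrakk> \<Longrightarrow>
               \<exists>d>0. \<forall>t. 0 < t \<and> t < d \<longrightarrow> norm(integral (cbox x (x + t *\<^sub>R One)) (\<lambda>x. h (-x)) /\<^sub>R t ^ DIM(real) - h (-x)) < e"
    using integrable_ccontinuous_explicit[OF int'] by metis
  define N where "N = N1 \<union> uminus ` N2"
  have "negligible (uminus ` N2)" using N2(1)
    by (rule negligible_locally_Lipschitz_image[rotated])
       (auto intro!: exI[of _ "UNIV::real set"] exI[of _ "1::real"] simp: abs_minus_commute)
  then have "negligible N" using N1 by (simp add: N_def)
  moreover have "(f has_real_derivative h x) (at x)" if x: "x \<notin> N" for x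
    unfolding has_field_derivative_iff
  proof (rule LIM_I)
    fix e :: real assume "e > 0"
    have "x \<notin> N1" using x by (auto simp: N_def)
    from N1(2)[OF this \<open>e > 0\<close>] obtain d1 where d1: "d1 > 0"
      "\<And>t. 0 < t \<Longrightarrow> t < d1 \<Longrightarrow> \<bar>integral {x..x+t} h / t - h x\<bar> < e"
      by (auto simp: divide_inverse_commute)
    have "-x \<notin> N2" using x by (auto simp: N_def image_iff)
    from N2(2)[OF this \<open>e > 0\<close>] obtain d2 where d2: "d2 > 0"
      "\<And>t. 0 < t \<Longrightarrow> t < d2 \<Longrightarrow> \<bar>integral {-x..-x+t} (\<lambda>x. h (-x)) / t - h x\<bar> < e"
      by (auto simp: divide_inverse_commute)
    have "norm ((f y - f x) / (y - x) - h x) < e" if "y \<noteq> x" "norm (y - x) < min d1 d2" for y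
    proof (cases "y > x")
      case True
      then show ?thesis using d1(2)[of "y - x"] that integral_unique[OF hI[of x y]] by auto
    next
      case False
      then have "integral {-x..-x+(x-y)} (\<lambda>x. h (-x)) = f x - f y"
        using that hI[of y x] Henstock_Kurzweil_Integration.integral_reflect_real[of x y h] by (simp add: integral_unique)
      moreover have "(f y - f x) / (y - x) = (f x - f y) / (x - y)"
        using that by (simp add: field_simps)
      ultimately show ?thesis using d2(2)[of "x - y"] that False by auto
    qed
    then show "\<exists>s>0. \<forall>y. y \<noteq> x \<and> norm (y - x) < s \<longrightarrow> norm ((f y - f x) / (y - x) - h x) < e"
      using d1 d2 by (intro exI[of _ "min d1 d2"]) auto
  qed
  ultimately show ?thesis using that hI by blast
qed

section \<open>Directional derivatives almost everywhere and their additivity\<close>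

lemma AE_lborel_translate:
  fixes c :: "'a::euclidean_space"
  assumes "AE x in lborel. P x"
  shows "AE x in lborel. P (x + c)"
proof -
  have "AE x in distr lborel borel ((+) c). P x"
    unfolding lborel_distr_plus by (rule assms)
  then have "AE x in lborel. P (c + x)" by (rule AE_distrD[rotated]) simp
  then show ?thesis by (simp add: add.commute)
qed

lemma negligible_AE_lborel: "negligible N \<Longrightarrow> AE x in lborel. x \<notin> N"
  by (metis AE_completion_iff AE_not_in negligible_iff_null_sets)

lemma AE_lborel_ex: "AE x in (lborel :: 'a::euclidean_space measure). P x \<Longrightarrow> \<exists>x. P x"
proof -
  assume *: "AE x in (lborel :: 'a::euclidean_space measure). P x"
  have "ae_filter (lborel :: 'a measure) \<noteq> bot" by (simp add: ae_filter_eq_bot_iff emeasure_lborel_UNIV)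
  with * show ?thesis using eventually_happens by blast
qed

definition dquot :: "('a::real_vector \<Rightarrow> real) \<Rightarrow> 'a \<Rightarrow> real \<Rightarrow> 'a \<Rightarrow> real" where
  "dquot g v t x = (g (x + t *\<^sub>R v) - g x) / t"

lemma has_real_derivative_dquot_iff:
  "((\<lambda>t. g (x + t *\<^sub>R v)) has_real_derivative d) (at 0) \<longleftrightarrow> ((\<lambda>t. dquot g v t x) \<longlongrightarrow> d) (at 0)"
  unfolding has_field_derivative_iff dquot_def by simp

text \<open>Existence of the directional derivative in Cauchy form. All quantifiers range over
  countable sets (rational increments, tolerances \<open>1 / Suc k\<close>), so that the set of good
  points is visibly Borel.\<close>

definition dquot_cauchy :: "('a::real_vector \<Rightarrow> real) \<Rightarrow> 'a \<Rightarrow> 'a \<Rightarrow> bool" where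
  "dquot_cauchy g v x \<longleftrightarrow> (\<forall>k::nat. \<exists>m::nat. \<forall>s::rat. \<forall>t::rat.
     0 < \<bar>of_rat s :: real\<bar> \<and> \<bar>of_rat s :: real\<bar> < 1 / Suc m \<and> 0 < \<bar>of_rat t :: real\<bar> \<and> \<bar>of_rat t :: real\<bar> < 1 / Suc m \<longrightarrow>
     \<bar>dquot g v (of_rat s) x - dquot g v (of_rat t) x\<bar> \<le> 1 / Suc k)"

lemma dquot_measurable [measurable]:
  fixes g :: "'a::euclidean_space \<Rightarrow> real"
  assumes [measurable]: "g \<in> borel_measurable borel"
  shows "dquot g v t \<in> borel_measurable borel"
  unfolding dquot_def by measurable

lemma dquot_cauchyI:
  assumes "((\<lambda>t. dquot g v t x) \<longlongrightarrow> d) (at 0)"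
  shows "dquot_cauchy g v x"
  unfolding dquot_cauchy_def
proof
  fix k :: nat
  have "0 < 1 / (2 * real (Suc k))" by simp
  from LIM_D[OF assms this] obtain r where r: "r > 0"
    "\<And>t. t \<noteq> 0 \<Longrightarrow> \<bar>t\<bar> < r \<Longrightarrow> \<bar>dquot g v t x - d\<bar> < 1 / (2 * real (Suc k))" by auto
  obtain m where m: "1 / real (Suc m) < r" using \<open>r > 0\<close> nat_approx_posE by blast
  have half: "1 / (2 * real (Suc k)) + 1 / (2 * real (Suc k)) = 1 / Suc k" by (simp add: field_simps)
  show "\<exists>m::nat. \<forall>s::rat. \<forall>t::rat.
     0 < \<bar>of_rat s :: real\<bar> \<and> \<bar>of_rat s :: real\<bar> < 1 / Suc m \<and> 0 < \<bar>of_rat t :: real\<bar> \<and> \<bar>of_rat t :: real\<bar> < 1 / Suc m \<longrightarrow>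
     \<bar>dquot g v (of_rat s) x - dquot g v (of_rat t) x\<bar> \<le> 1 / Suc k"
  proof (intro exI[of _ m] allI impI)
    fix s t :: rat
    assume *: "0 < \<bar>of_rat s :: real\<bar> \<and> \<bar>of_rat s :: real\<bar> < 1 / Suc m \<and> 0 < \<bar>of_rat t :: real\<bar> \<and> \<bar>of_rat t :: real\<bar> < 1 / Suc m"
    have "\<bar>dquot g v (of_rat s) x - d\<bar> < 1 / (2 * real (Suc k))"
      using * m by (intro r(2)) auto
    moreover have "\<bar>dquot g v (of_rat t) x - d\<bar> < 1 / (2 * real (Suc k))"
      using * m by (intro r(2)) auto
    ultimately show "\<bar>dquot g v (of_rat s) x - dquot g v (of_rat t) x\<bar> \<le> 1 / Suc k"
      using half by (simp only: abs_less_iff abs_le_iff) argo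
  qed
qed

text \<open>The difference quotient is continuous in \<open>t\<close> away from 0, so the Cauchy
  estimate extends from rational to real increments.\<close>

lemma dquot_cauchyD:
  fixes g :: "'a::euclidean_space \<Rightarrow> real"
  assumes cont: "continuous_on UNIV g" and c: "dquot_cauchy g v x"
  shows "((\<lambda>t. dquot g v t x) \<longlongrightarrow> lim (\<lambda>n. dquot g v (1 / Suc n) x)) (at 0)"
proof -
  let ?q = "\<lambda>t. dquot g v t x"
  have qcont: "isCont ?q t" if "t \<noteq> 0" for t
  proof -
    have gc: "isCont g y" for y using cont by (simp add: continuous_on_eq_continuous_at)
    show ?thesis unfolding dquot_def using that
      by (intro continuous_intros isCont_o2[OF _ gc]) auto
  qed
  have key: "\<exists>m::nat. \<forall>s t. 0 < \<bar>s\<bar> \<and> \<bar>s\<bar> < 1 / Suc m \<and> 0 < \<bar>t\<bar> \<and> \<bar>t\<bar> < 1 / Suc m \<longrightarrow> \<bar>?q s - ?q t\<bar> \<le> 1 / Suc k" for k :: nat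
  proof -
    obtain m :: nat where m: "\<And>s t::rat. 0 < \<bar>of_rat s :: real\<bar> \<Longrightarrow> \<bar>of_rat s :: real\<bar> < 1 / Suc m \<Longrightarrow> 0 < \<bar>of_rat t :: real\<bar> \<Longrightarrow> \<bar>of_rat t :: real\<bar> < 1 / Suc m \<Longrightarrow>
     \<bar>?q (of_rat s) - ?q (of_rat t)\<bar> \<le> 1 / Suc k"
      using c unfolding dquot_cauchy_def by meson
    show ?thesis
    proof (intro exI[of _ m] allI impI, rule field_le_epsilon)
      fix s t e :: real
      assume st: "0 < \<bar>s\<bar> \<and> \<bar>s\<bar> < 1 / Suc m \<and> 0 < \<bar>t\<bar> \<and> \<bar>t\<bar> < 1 / Suc m" and e: "0 < e"
      have approx: "\<exists>r::rat. 0 < \<bar>of_rat r :: real\<bar> \<and> \<bar>of_rat r :: real\<bar> < 1 / Suc m \<and> \<bar>?q (of_rat r) - ?q s\<bar> < e / 2"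
        if s: "0 < \<bar>s\<bar>" "\<bar>s\<bar> < 1 / Suc m" for s
      proof -
        from qcont[of s] s e obtain d where d: "d > 0" "\<And>t. \<bar>t - s\<bar> < d \<Longrightarrow> \<bar>?q t - ?q s\<bar> < e / 2"
          unfolding continuous_at_eps_delta dist_real_def by (metis abs_0 half_gt_zero less_irrefl)
        \<comment> \<open>Close enough to \<open>s\<close> that the rational neither vanishes nor
          leaves the range in which the Cauchy estimate holds.\<close>
        define d' where "d' = min d (min \<bar>s\<bar> (1 / Suc m - \<bar>s\<bar>))"
        have "d' > 0" using d s by (simp add: d'_def)
        then obtain r where "r \<in> \<rat>" "s - d' < r" "r < s + d'" 
          using Rats_dense_in_real[of "s - d'" "s + d'"] by auto
        then obtain r' :: rat where r': "r = of_rat r'" by (metis Rats_cases)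
        have rr: "\<bar>r - s\<bar> < d'" using \<open>s - d' < r\<close> \<open>r < s + d'\<close> by linarith
        have "0 < \<bar>r\<bar>" "\<bar>r\<bar> < 1 / Suc m" using rr by (auto simp: d'_def)
        moreover have "\<bar>?q r - ?q s\<bar> < e / 2" using rr by (intro d) (auto simp: d'_def)
        ultimately show ?thesis unfolding r' by blast
      qed
      obtain s' t' :: rat where "0 < \<bar>of_rat s' :: real\<bar>" "\<bar>of_rat s' :: real\<bar> < 1 / Suc m" "\<bar>?q (of_rat s') - ?q s\<bar> < e / 2"
        "0 < \<bar>of_rat t' :: real\<bar>" "\<bar>of_rat t' :: real\<bar> < 1 / Suc m" "\<bar>?q (of_rat t') - ?q t\<bar> < e / 2"
        using approx[of s] approx[of t] st by blast
      with m[of s' t'] show "\<bar>?q s - ?q t\<bar> \<le> 1 / Suc k + e" by linarith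
    qed
  qed
  have small: "\<forall>\<^sub>F n in sequentially. 1 / real (Suc n) < 1 / Suc m" for m
    by (rule eventually_sequentiallyI[of "Suc m"]) (auto simp: field_simps)
  have "Cauchy (\<lambda>n. ?q (1 / Suc n))"
  proof (rule metric_CauchyI)
    fix e :: real assume "e > 0"
    then obtain k where k: "1 / real (Suc k) < e" using nat_approx_posE by blast
    obtain m where m: "\<And>s t. 0 < \<bar>s\<bar> \<Longrightarrow> \<bar>s\<bar> < 1 / Suc m \<Longrightarrow> 0 < \<bar>t\<bar> \<Longrightarrow> \<bar>t\<bar> < 1 / Suc m \<Longrightarrow> \<bar>?q s - ?q t\<bar> \<le> 1 / Suc k"
      using key[of k] by meson
    have "dist (?q (1 / Suc i)) (?q (1 / Suc j)) < e" if "i \<ge> Suc m" "j \<ge> Suc m" for i j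
    proof -
      have "\<bar>?q (1 / Suc i) - ?q (1 / Suc j)\<bar> \<le> 1 / Suc k"
        using that by (intro m) (auto simp: field_simps)
      then show ?thesis using k by (simp add: dist_real_def)
    qed
    then show "\<exists>M. \<forall>i\<ge>M. \<forall>j\<ge>M. dist (?q (1 / Suc i)) (?q (1 / Suc j)) < e" by blast
  qed
  then have conv: "(\<lambda>n. ?q (1 / Suc n)) \<longlonglongrightarrow> lim (\<lambda>n. ?q (1 / Suc n))"
    by (simp add: Cauchy_convergent convergent_LIMSEQ_iff[symmetric])
  show ?thesis
  proof (rule LIM_I)
    fix e :: real assume "e > 0"
    then obtain k where k: "1 / real (Suc k) < e" using nat_approx_posE by blast
    obtain m where m: "\<And>s t. 0 < \<bar>s\<bar> \<Longrightarrow> \<bar>s\<bar> < 1 / Suc m \<Longrightarrow> 0 < \<bar>t\<bar> \<Longrightarrow> \<bar>t\<bar> < 1 / Suc m \<Longrightarrow> \<bar>?q s - ?q t\<bar> \<le> 1 / Suc k"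
      using key[of k] by meson
    have "norm (?q t - lim (\<lambda>n. ?q (1 / Suc n))) < e" if t: "t \<noteq> 0" "norm (t - 0) < 1 / Suc m" for t
    proof -
      have "(\<lambda>n. \<bar>?q t - ?q (1 / Suc n)\<bar>) \<longlonglongrightarrow> \<bar>?q t - lim (\<lambda>n. ?q (1 / Suc n))\<bar>"
        by (intro tendsto_intros conv)
      moreover have "\<forall>\<^sub>F n in sequentially. \<bar>?q t - ?q (1 / Suc n)\<bar> \<le> 1 / Suc k"
        using small[of m] by eventually_elim (rule m, use t in auto)
      ultimately have "\<bar>?q t - lim (\<lambda>n. ?q (1 / Suc n))\<bar> \<le> 1 / Suc k"
        using tendsto_upperbound trivial_limit_sequentially by blast
      then show ?thesis using k by simp
    qed
    then show "\<exists>s>0. \<forall>t. t \<noteq> 0 \<and> norm (t - 0) < s \<longrightarrow> norm (?q t - lim (\<lambda>n. ?q (1 / Suc n))) < e"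
      by (intro exI[of _ "1 / Suc m"]) auto
  qed
qed

text \<open>Tonelli on the pairs \<open>(x, t)\<close>: almost every point of each line \<open>x + t v\<close> is good, and the
  exceptional sets for different \<open>t\<close> are translates of each other.\<close>

lemma lipschitz_directional_derivative_AE:
  fixes g :: "'a::euclidean_space \<Rightarrow> real"
  assumes lip: "L-lipschitz_on UNIV g"
  shows "AE x in lborel. ((\<lambda>t. dquot g v t x) \<longlongrightarrow> lim (\<lambda>n. dquot g v (1 / Suc n) x)) (at 0)"
proof -
  have L0: "0 \<le> L" using lip lipschitz_on_nonneg by blast
  have cont: "continuous_on UNIV g" using lip by (rule lipschitz_on_continuous_on)
  then have [measurable]: "g \<in> borel_measurable borel" by (rule borel_measurable_continuous_onI)
  have meas [measurable]: "Measurable.pred borel (dquot_cauchy g v)"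
    unfolding dquot_cauchy_def by measurable
  have line: "AE t in lborel. dquot_cauchy g v (x + t *\<^sub>R v)" for x
  proof -
    have "(L * norm v)-lipschitz_on UNIV (\<lambda>t. g (x + t *\<^sub>R v))"
    proof (rule lipschitz_onI)
      fix s t
      have "dist (g (x + s *\<^sub>R v)) (g (x + t *\<^sub>R v)) \<le> L * dist (x + s *\<^sub>R v) (x + t *\<^sub>R v)"
        by (rule lipschitz_onD[OF lip]) auto
      also have "dist (x + s *\<^sub>R v) (x + t *\<^sub>R v) = \<bar>s - t\<bar> * norm v"
        by (simp add: dist_norm flip: scaleR_diff_left)
      finally show "dist (g (x + s *\<^sub>R v)) (g (x + t *\<^sub>R v)) \<le> L * norm v * dist s t"
        by (simp add: dist_real_def mult_ac)
    qed (use L0 in auto)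
    then obtain h N where N: "negligible N" and h: "\<And>t. t \<notin> N \<Longrightarrow> ((\<lambda>t. g (x + t *\<^sub>R v)) has_real_derivative h t) (at t)"
      using lipschitz_real_integral_derivative by metis
    have "dquot_cauchy g v (x + t *\<^sub>R v)" if "t \<notin> N" for t
    proof -
      have "((\<lambda>s. g (x + (t + s) *\<^sub>R v)) has_real_derivative h t) (at 0)"
        using DERIV_shift[of "\<lambda>t. g (x + t *\<^sub>R v)" "h t" 0 t] h[OF that] by (simp add: add.commute)
      then have "((\<lambda>s. g ((x + t *\<^sub>R v) + s *\<^sub>R v)) has_real_derivative h t) (at 0)"
        by (simp add: algebra_simps)
      then show ?thesis unfolding has_real_derivative_dquot_iff by (rule dquot_cauchyI)
    qed
    then show ?thesis using negligible_AE_lborel[OF N] by (auto elim: eventually_mono)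
  qed
  have "Measurable.pred (lborel \<Otimes>\<^sub>M lborel) (\<lambda>x :: 'a \<times> real. dquot_cauchy g v (fst x + snd x *\<^sub>R v))"
    by measurable
  then have meas2: "{x :: 'a \<times> real \<in> space (lborel \<Otimes>\<^sub>M lborel). dquot_cauchy g v (fst x + snd x *\<^sub>R v)} \<in> sets (lborel \<Otimes>\<^sub>M lborel)"
    by (rule predE)
  have "AE x in lborel. AE t in lborel. dquot_cauchy g v (x + t *\<^sub>R v)"
    using line by simp
  then have "AE t in lborel. AE x in lborel. dquot_cauchy g v (x + t *\<^sub>R v)"
    using meas2 by (subst (asm) lborel_pair.AE_commute) auto
  then obtain t where "AE x in lborel. dquot_cauchy g v (x + t *\<^sub>R v)"
    using AE_lborel_ex by blast
  from AE_lborel_translate[OF this, of "- (t *\<^sub>R v)"] 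
  have "AE x in lborel. dquot_cauchy g v x" by simp
  then show ?thesis by (rule eventually_mono) (rule dquot_cauchyD[OF cont])
qed

text \<open>A limit along one sequence of increments: total, Borel measurable in \<open>x\<close>,
  and equal to the directional derivative wherever that exists.\<close>

definition ddir :: "('a::real_vector \<Rightarrow> real) \<Rightarrow> 'a \<Rightarrow> 'a \<Rightarrow> real" where
  "ddir g v x = lim (\<lambda>n. dquot g v (1 / Suc n) x)"

lemma dquot_bound:
  fixes g :: "'a::euclidean_space \<Rightarrow> real"
  assumes lip: "L-lipschitz_on UNIV g"
  shows "\<bar>dquot g v t x\<bar> \<le> L * norm v"
proof (cases "t = 0")
  case False
  have "dist (g (x + t *\<^sub>R v)) (g x) \<le> L * dist (x + t *\<^sub>R v) x"
    by (rule lipschitz_onD[OF lip]) auto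
  then show ?thesis using False by (simp add: dquot_def dist_norm field_simps)
qed (use lipschitz_on_nonneg[OF lip] in \<open>auto simp: dquot_def\<close>)

text \<open>By Lebesgue differentiation almost every value is a limit of averages over boxes, and
  these all vanish.\<close>

lemma AE_eq_0_if_box_integrals_0:
  fixes f :: "'a::euclidean_space \<Rightarrow> real"
  assumes "\<And>a b. (f has_integral 0) (cbox a b)"
  shows "AE x in lborel. f x = 0"
proof -
  have int: "f integrable_on cbox a b" for a b using assms by blast
  obtain N where N: "negligible N" "\<And>x e. \<lbrakk>x \<notin> N; 0 < e\<rbrakk> \<Longrightarrow> \<exists>d>0. \<forall>h. 0 < h \<and> h < d \<longrightarrow>
      norm (integral (cbox x (x + h *\<^sub>R One)) f /\<^sub>R h ^ DIM('a) - f x) < e"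
    using integrable_ccontinuous_explicit[OF int] by metis
  have "f x = 0" if "x \<notin> N" for x
  proof (rule ccontr)
    assume "f x \<noteq> 0"
    then obtain d where "d > 0" and d: "\<And>h. 0 < h \<Longrightarrow> h < d \<Longrightarrow>
      norm (integral (cbox x (x + h *\<^sub>R One)) f /\<^sub>R h ^ DIM('a) - f x) < \<bar>f x\<bar>"
      using N(2)[OF \<open>x \<notin> N\<close>, of "\<bar>f x\<bar>"] by auto
    then show False using d[of "d/2"] integral_unique[OF assms] by simp
  qed
  then show ?thesis using negligible_AE_lborel[OF N(1)] by (auto elim: eventually_mono)
qed

text \<open>Dominated convergence: off the frontier of the box, which is negligible, the integrand
  is eventually 0, and since \<open>t\<close> is bounded all translates lie in one ball.\<close>

lemma translated_box_difference_tendsto_0: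
  fixes u :: "'a::euclidean_space" and t :: "nat \<Rightarrow> real"
  assumes t: "t \<longlonglongrightarrow> 0"
  shows "(\<lambda>n. \<integral>x. \<bar>indicator (cbox a b) (x - t n *\<^sub>R u) - indicator (cbox a b) x :: real\<bar> \<partial>lborel) \<longlonglongrightarrow> 0"
proof -
  let ?I = "indicator (cbox a b) :: 'a \<Rightarrow> real"
  have "Bseq t" using t convergent_def convergent_imp_Bseq by blast
  then obtain K where K: "\<And>n. \<bar>t n\<bar> \<le> K" unfolding Bseq_def by auto
  obtain r where r: "cbox a b \<subseteq> cball 0 r" using bounded_subset_cball bounded_cbox by (metis bounded_pos subset_iff mem_cball_0)
  define R where "R = r + K * norm u"
  have "K \<ge> 0" using K[of 0] by linarith
  have bnd: "norm \<bar>?I (x - t n *\<^sub>R u) - ?I x\<bar> \<le> indicator (cball 0 R) x" for x n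
  proof (cases "x \<in> cball 0 R")
    case False
    have "norm (t n *\<^sub>R u) \<le> K * norm u" using K[of n] by (simp add: mult_right_mono)
    then have "norm (x - t n *\<^sub>R u) > r"
      using False norm_triangle_ineq2[of x "t n *\<^sub>R u"] by (auto simp: R_def)
    then have "x - t n *\<^sub>R u \<notin> cbox a b" using r by (auto dest!: subsetD)
    moreover have "K * norm u \<ge> 0" using \<open>K \<ge> 0\<close> by simp
    then have "x \<notin> cbox a b" using False r by (auto simp: R_def dest!: subsetD)
    ultimately show ?thesis by simp
  qed (auto simp: indicator_def)
  have "(\<lambda>n. \<integral>x. \<bar>?I (x - t n *\<^sub>R u) - ?I x\<bar> \<partial>lborel) \<longlonglongrightarrow> (\<integral>x. 0 \<partial>(lborel::'a measure))"
  proof (rule integral_dominated_convergence[where w="indicator (cball 0 R)"])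
    show "integrable lborel (indicator (cball 0 R) :: 'a \<Rightarrow> real)"
      by (intro integrable_real_indicator) (use emeasure_bounded_finite[OF bounded_cball] in auto)
    show "AE x in lborel. norm \<bar>?I (x - t n *\<^sub>R u) - ?I x\<bar> \<le> indicator (cball 0 R) x" for n
      using bnd by simp
    have "AE x in lborel. x \<notin> frontier (cbox a b)"
      by (intro negligible_AE_lborel negligible_convex_frontier convex_box)
    then show "AE x in lborel. (\<lambda>n. \<bar>?I (x - t n *\<^sub>R u) - ?I x\<bar>) \<longlonglongrightarrow> 0"
    proof (rule eventually_mono)
      fix x assume x: "x \<notin> frontier (cbox a b)"
      have lim: "(\<lambda>n. x - t n *\<^sub>R u) \<longlonglongrightarrow> x - 0 *\<^sub>R u" by (intro tendsto_intros t)
      have "\<forall>\<^sub>F n in sequentially. ?I (x - t n *\<^sub>R u) = ?I x"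
      proof (cases "x \<in> cbox a b")
        case True
        then have "x \<in> interior (cbox a b)" using x by (simp add: frontier_def)
        with lim have "\<forall>\<^sub>F n in sequentially. x - t n *\<^sub>R u \<in> interior (cbox a b)"
          using topological_tendstoD[OF lim, of "interior (cbox a b)"] open_interior[of "cbox a b"] by simp
        then show ?thesis by eventually_elim (use True interior_subset[of "cbox a b"] in \<open>auto simp: indicator_def dest: subsetD\<close>)
      next
        case False
        have "\<forall>\<^sub>F n in sequentially. x - t n *\<^sub>R u \<in> - cbox a b"
          using topological_tendstoD[OF lim, of "- cbox a b"] closed_cbox[of a b] False by (simp add: open_Compl)
        then show ?thesis by eventually_elim (use False in auto)
      qed
      then show "(\<lambda>n. \<bar>?I (x - t n *\<^sub>R u) - ?I x\<bar>) \<longlonglongrightarrow> 0"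
        by (intro tendsto_eventually) (auto elim: eventually_mono)
    qed
  qed auto
  then show ?thesis by simp
qed

lemma integral_lborel_translate:
  fixes f :: "'a::euclidean_space \<Rightarrow> real"
  assumes [measurable]: "f \<in> borel_measurable borel"
  shows "(\<integral>x. f (x + c) \<partial>lborel) = (\<integral>x. f x \<partial>lborel)"
proof -
  have "(\<integral>x. f x \<partial>lborel) = (\<integral>x. f x \<partial>(distr lborel borel ((+) c)))" by (simp only: lborel_distr_plus)
  also have "\<dots> = (\<integral>x. f (c + x) \<partial>lborel)" by (rule integral_distr) auto
  finally show ?thesis by (simp add: add.commute)
qed

lemma integrable_box_mult:
  fixes f :: "'a::euclidean_space \<Rightarrow> real"
  assumes [measurable]: "f \<in> borel_measurable borel" and b: "\<And>x. \<bar>f x\<bar> \<le> B" "bounded S" and [measurable]: "S \<in> sets borel"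
  shows "integrable lborel (\<lambda>x. indicator S x * f x)"
proof (rule Bochner_Integration.integrable_bound)
  show "integrable lborel (\<lambda>x. indicator S x * B :: real)"
    using emeasure_bounded_finite[OF \<open>bounded S\<close>] by (intro integrable_mult_left integrable_real_indicator) auto
  have "0 \<le> B" using b(1)[of undefined] by linarith
  then show "AE x in lborel. norm (indicator S x * f x) \<le> norm (indicator S x * B)"
    using b(1) by (intro AE_I2) (auto simp: indicator_def)
qed auto

text \<open>Averaged over a box \<open>B\<close>, the defect of additivity at scale \<open>t\<close> is, after a change of
  variables, at most a constant times the volume of the symmetric difference of \<open>B\<close> and \<open>B + t u\<close>.\<close>

lemma ddir_additive_AE:
  fixes g :: "'a::euclidean_space \<Rightarrow> real"
  assumes lip: "L-lipschitz_on UNIV g"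
  shows "AE x in lborel. ddir g (u + v) x = ddir g u x + ddir g v x"
proof -
  define t where "t = (\<lambda>n::nat. 1 / real (Suc n))"
  have tpos: "t n > 0" for n by (simp add: t_def)
  have tlim: "t \<longlonglongrightarrow> 0"
    unfolding t_def using LIMSEQ_Suc[OF lim_1_over_n] by simp
  have L0: "0 \<le> L" using lip lipschitz_on_nonneg by blast
  have "continuous_on UNIV g" using lip by (rule lipschitz_on_continuous_on)
  then have gm [measurable]: "g \<in> borel_measurable borel" by (rule borel_measurable_continuous_onI)
  have dm [measurable]: "ddir g w \<in> borel_measurable borel" for w
    unfolding ddir_def by measurable
  define E where "E = (\<lambda>x. ddir g (u + v) x - ddir g u x - ddir g v x)"
  define e where "e = (\<lambda>n x. dquot g (u + v) (t n) x - dquot g u (t n) x - dquot g v (t n) x)"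
  have em [measurable]: "e n \<in> borel_measurable borel" for n unfolding e_def by measurable
  have Em [measurable]: "E \<in> borel_measurable borel" unfolding E_def by measurable
  have lims: "AE x in lborel. (\<lambda>n. dquot g w (t n) x) \<longlonglongrightarrow> ddir g w x" for w
    using lipschitz_directional_derivative_AE[OF lip, of w]
  proof (rule eventually_mono)
    fix x assume *: "((\<lambda>t. dquot g w t x) \<longlongrightarrow> lim (\<lambda>n. dquot g w (1 / real (Suc n)) x)) (at 0)"
    have "filterlim t (at 0) sequentially"
      unfolding filterlim_at using tlim tpos by (auto simp: less_imp_neq[THEN not_sym] intro!: always_eventually)
    from filterlim_compose[OF * this] show "(\<lambda>n. dquot g w (t n) x) \<longlonglongrightarrow> ddir g w x"
      by (simp add: ddir_def)
  qed
  have elim: "AE x in lborel. (\<lambda>n. e n x) \<longlonglongrightarrow> E x"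
    using lims[of "u+v"] lims[of u] lims[of v]
    by eventually_elim (auto simp: e_def E_def intro!: tendsto_intros)
  define C where "C = L * norm (u + v) + L * norm u + L * norm v"
  have eb: "\<bar>e n x\<bar> \<le> C" for n x
    using dquot_bound[OF lip, of "u+v" "t n" x] dquot_bound[OF lip, of u "t n" x] dquot_bound[OF lip, of v "t n" x]
    unfolding e_def C_def by linarith
  have C0: "C \<ge> 0" using L0 by (simp add: C_def)
  have box0: "((\<lambda>x. if (\<lambda>n. e n x) \<longlonglongrightarrow> E x then E x else 0) has_integral 0) (cbox a b)" for a b
  proof -
    let ?I = "indicator (cbox a b) :: 'a \<Rightarrow> real"
    have w: "integrable lborel (\<lambda>x. ?I x * C)"
      by (intro integrable_box_mult) (auto simp: C0)
    have bounded: "AE x in lborel. norm (?I x * e n x) \<le> ?I x * C" for n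
      using eb by (intro AE_I2) (auto simp: indicator_def)
    have conv: "AE x in lborel. (\<lambda>n. ?I x * e n x) \<longlonglongrightarrow> ?I x * E x"
      using elim by eventually_elim (auto intro!: tendsto_intros)
    have m1: "(\<lambda>x. ?I x * E x) \<in> borel_measurable lborel" "\<And>n. (\<lambda>x. ?I x * e n x) \<in> borel_measurable lborel"
      by simp_all
    have 1: "(\<lambda>n. \<integral>x. ?I x * e n x \<partial>lborel) \<longlonglongrightarrow> (\<integral>x. ?I x * E x \<partial>lborel)"
      by (rule integral_dominated_convergence[OF m1 w conv bounded])
    have int: "integrable lborel (\<lambda>x. ?I x * E x)"
      by (rule integrable_dominated_convergence[OF m1 w conv bounded])
    have 2: "(\<lambda>n. \<integral>x. ?I x * e n x \<partial>lborel) \<longlonglongrightarrow> 0"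
    proof (rule Lim_null_comparison)
      let ?d = "\<lambda>n. \<integral>x. \<bar>?I (x - t n *\<^sub>R u) - ?I x\<bar> \<partial>lborel"
      show "(\<lambda>n. (L * norm v) * ?d n) \<longlonglongrightarrow> 0"
        by (intro tendsto_mult_right_zero translated_box_difference_tendsto_0 tlim)
      have "\<bar>\<integral>x. ?I x * e n x \<partial>lborel\<bar> \<le> (L * norm v) * ?d n" for n
      proof -
        let ?k = "dquot g v (t n)"
        \<comment> \<open>The defect telescopes into the \<open>v\<close>-quotient at the shifted
          point minus the one at \<open>x\<close>. Under the integral the shift can then be moved
          onto the box.\<close>
        have "e n x = ?k (x + t n *\<^sub>R u) - ?k x" for x
          using tpos[of n] by (simp add: e_def dquot_def field_simps scaleR_add_right add_ac)
        then have "(\<integral>x. ?I x * e n x \<partial>lborel) = (\<integral>x. ?I x * ?k (x + t n *\<^sub>R u) - ?I x * ?k x \<partial>lborel)"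
          by (simp only: right_diff_distrib)
        also have "\<dots> = (\<integral>x. ?I x * ?k (x + t n *\<^sub>R u) \<partial>lborel) - (\<integral>x. ?I x * ?k x \<partial>lborel)"
          by (intro Bochner_Integration.integral_diff integrable_box_mult[where B="L * norm v"] dquot_bound[OF lip]) auto
        also have "(\<integral>x. ?I x * ?k (x + t n *\<^sub>R u) \<partial>lborel) = (\<integral>x. ?I (x - t n *\<^sub>R u) * ?k x \<partial>lborel)"
          using integral_lborel_translate[of "\<lambda>x. ?I (x - t n *\<^sub>R u) * ?k x" "t n *\<^sub>R u"] by simp
        finally have eq: "(\<integral>x. ?I x * e n x \<partial>lborel) = (\<integral>x. ?I (x - t n *\<^sub>R u) * ?k x \<partial>lborel) - (\<integral>x. ?I x * ?k x \<partial>lborel)" .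
        have shift: "?I (x - t n *\<^sub>R u) = indicator (cbox (a + t n *\<^sub>R u) (b + t n *\<^sub>R u)) x" for x
          by (auto simp: indicator_def mem_box algebra_simps)
        have i1: "integrable lborel (\<lambda>x. ?I (x - t n *\<^sub>R u) * f x)" if "f \<in> borel_measurable borel" "\<And>x. \<bar>f x\<bar> \<le> B" for f B
          unfolding shift by (rule integrable_box_mult[OF that]) auto
        have i2: "integrable lborel (\<lambda>x. ?I x * f x)" if "f \<in> borel_measurable borel" "\<And>x. \<bar>f x\<bar> \<le> B" for f B
          by (rule integrable_box_mult[OF that]) auto
        have kb: "\<bar>?k x\<bar> \<le> L * norm v" for x by (rule dquot_bound[OF lip])
        have eq2: "(\<integral>x. ?I x * e n x \<partial>lborel) = (\<integral>x. ?I (x - t n *\<^sub>R u) * ?k x - ?I x * ?k x \<partial>lborel)"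
          unfolding eq by (intro Bochner_Integration.integral_diff[symmetric] i1[OF _ kb] i2[OF _ kb]) auto
        have "\<bar>\<integral>x. ?I x * e n x \<partial>lborel\<bar> \<le> (\<integral>x. \<bar>?I (x - t n *\<^sub>R u) * ?k x - ?I x * ?k x\<bar> \<partial>lborel)"
          unfolding eq2 by (rule integral_abs_bound)
        also have "\<dots> \<le> (\<integral>x. (L * norm v) * \<bar>?I (x - t n *\<^sub>R u) - ?I x\<bar> \<partial>lborel)"
        proof (rule integral_mono)
          show "integrable lborel (\<lambda>x. \<bar>?I (x - t n *\<^sub>R u) * ?k x - ?I x * ?k x\<bar>)"
            by (rule integrable_abs, rule Bochner_Integration.integrable_diff, rule i1[OF _ kb], simp, rule i2[OF _ kb], simp)
          have "integrable lborel (\<lambda>x. ?I (x - t n *\<^sub>R u))" "integrable lborel ?I"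
            using i1[of "\<lambda>_. 1" 1] i2[of "\<lambda>_. 1" 1] by auto
          then have "integrable lborel (\<lambda>x. \<bar>?I (x - t n *\<^sub>R u) - ?I x\<bar>)"
            by (rule integrable_abs[OF Bochner_Integration.integrable_diff])
          then show "integrable lborel (\<lambda>x. (L * norm v) * \<bar>?I (x - t n *\<^sub>R u) - ?I x\<bar>)"
            by (rule integrable_mult_right)
          fix x
          have "\<bar>?I (x - t n *\<^sub>R u) * ?k x - ?I x * ?k x\<bar> = \<bar>?I (x - t n *\<^sub>R u) - ?I x\<bar> * \<bar>?k x\<bar>"
            by (simp add: abs_mult flip: left_diff_distrib)
          also have "\<dots> \<le> \<bar>?I (x - t n *\<^sub>R u) - ?I x\<bar> * (L * norm v)"
            by (intro mult_left_mono kb) auto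
          finally show "\<bar>?I (x - t n *\<^sub>R u) * ?k x - ?I x * ?k x\<bar> \<le> (L * norm v) * \<bar>?I (x - t n *\<^sub>R u) - ?I x\<bar>"
            by (simp add: mult_ac)
        qed
        finally show ?thesis by simp
      qed
      then show "\<forall>\<^sub>F n in sequentially. norm (\<integral>x. ?I x * e n x \<partial>lborel) \<le> (L * norm v) * ?d n"
        by simp
    qed
    have "(\<integral>x. ?I x * E x \<partial>lborel) = 0" using LIMSEQ_unique[OF 1 2] .
    then have "((\<lambda>x. ?I x * E x) has_integral 0) UNIV"
      using has_integral_integral_lborel[OF int] by simp
    then have "((\<lambda>x. if x \<in> cbox a b then E x else 0) has_integral 0) UNIV"
      by (rule has_integral_eq[rotated]) auto
    then have "(E has_integral 0) (cbox a b)" by (simp only: has_integral_restrict_UNIV)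
    moreover have "AE x in lborel. x \<in> cbox a b \<longrightarrow> (if (\<lambda>n. e n x) \<longlonglongrightarrow> E x then E x else 0) = E x"
      using elim by eventually_elim auto
    ultimately show ?thesis by (subst has_integral_AE) auto
  qed
  have "AE x in lborel. (if (\<lambda>n. e n x) \<longlonglongrightarrow> E x then E x else 0) = 0"
    using box0 by (rule AE_eq_0_if_box_integrals_0)
  then have "AE x in lborel. E x = 0" using elim by eventually_elim auto
  then show ?thesis by eventually_elim (simp add: E_def)
qed

text \<open>Homogeneity comes from the chain rule and additivity from
  \<open>ddir_additive_AE\<close>. The null set depends on the coefficients \<open>c\<close>, so
  linearity is available for countably many directions at once only; this is why the next lemma
  starts from a dense set of directions.\<close>

lemma has_real_derivative_along_coordinates_AE:
  fixes g :: "'a::euclidean_space \<Rightarrow> real"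
  assumes lip: "L-lipschitz_on UNIV g" and "finite A"
  shows "AE x in lborel. ((\<lambda>t. g (x + t *\<^sub>R (\<Sum>b\<in>A. c b *\<^sub>R b))) has_real_derivative (\<Sum>b\<in>A. c b * ddir g b x)) (at 0)"
  using \<open>finite A\<close>
proof (induction A rule: finite_induct)
  case (insert b A)
  let ?S = "\<Sum>b\<in>A. c b *\<^sub>R b"
  have deriv: "AE x in lborel. ((\<lambda>t. g (x + t *\<^sub>R v)) has_real_derivative ddir g v x) (at 0)" for v
    using lipschitz_directional_derivative_AE[OF lip, of v]
    unfolding has_real_derivative_dquot_iff ddir_def .
  show ?case
    using insert.IH deriv[of b] deriv[of "c b *\<^sub>R b"] deriv[of ?S] deriv[of "c b *\<^sub>R b + ?S"] ddir_additive_AE[OF lip, of "c b *\<^sub>R b" ?S]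
  proof eventually_elim
    case (elim x)
    have "((\<lambda>t. g (x + (t * c b) *\<^sub>R b)) has_real_derivative ddir g b x * c b) (at 0)"
    proof (rule DERIV_chain2[of "\<lambda>t. g (x + t *\<^sub>R b)"])
      show "((\<lambda>t. g (x + t *\<^sub>R b)) has_real_derivative ddir g b x) (at (0 * c b))" using elim(2) by simp
      show "((\<lambda>t. t * c b) has_real_derivative c b) (at 0)" by (auto intro!: derivative_eq_intros)
    qed
    then have "ddir g (c b *\<^sub>R b) x = c b * ddir g b x"
      using elim(3) DERIV_unique by (fastforce simp: mult.commute)
    moreover have "ddir g ?S x = (\<Sum>b\<in>A. c b * ddir g b x)"
      using elim(1,4) DERIV_unique by blast
    ultimately show ?case using elim(5,6) insert.hyps by simp
  qed
qed simp

text \<open>By compactness finitely many directions of \<open>D\<close> are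
  \<open>\<eta>\<close>-dense in the unit ball. Their quotients converge uniformly, and the
  Lipschitz bound carries the estimate to all other directions.\<close>

lemma has_derivative_from_dense_directions:
  fixes g :: "'a::euclidean_space \<Rightarrow> real"
  assumes lip: "L-lipschitz_on UNIV g"
    and dense: "\<And>U. open U \<Longrightarrow> U \<noteq> {} \<Longrightarrow> \<exists>v\<in>D. v \<in> U"
    and dir: "\<And>v. v \<in> D \<Longrightarrow> ((\<lambda>t. g (x + t *\<^sub>R v)) has_real_derivative (z \<bullet> v)) (at 0)"
  shows "(g has_derivative (\<lambda>v. z \<bullet> v)) (at x)"
  unfolding has_derivative_at_alt
proof (intro conjI allI impI)
  show "bounded_linear ((\<bullet>) z)" by (rule bounded_linear_inner_right)
  fix e :: real assume "e > 0"
  have L0: "0 \<le> L" using lip lipschitz_on_nonneg by blast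
  \<comment> \<open>Replacing a unit vector by an \<open>\<eta>\<close>-close one costs
    \<open>L * \<eta>\<close> in \<open>g\<close> and \<open>norm z * \<eta>\<close> in the linear
    form, together at most \<open>e / 2\<close>; the other half is left for the quotients.\<close>
  define \<eta> where "\<eta> = e / (2 * (L + norm z + 1))"
  have pos: "L + norm z + 1 > 0" using L0 by (simp add: add_nonneg_pos)
  have \<eta>: "\<eta> > 0" using \<open>e > 0\<close> pos by (simp add: \<eta>_def)
  have \<eta>e: "(L + norm z) * \<eta> \<le> e / 2" 
  proof -
    have "(L + norm z) * \<eta> \<le> (L + norm z + 1) * \<eta>" using \<eta> by (simp add: mult_right_mono)
    also have "\<dots> = e / 2"
    proof -
      have "p * (e / (2 * p)) = e / 2" if "p > 0" for p :: real using that by simp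
      from this[OF pos] show ?thesis unfolding \<eta>_def .
    qed
    finally show ?thesis .
  qed
  have "cball 0 1 \<subseteq> (\<Union>v\<in>D. ball v \<eta>)"
  proof
    fix w :: 'a
    obtain v where "v \<in> D" "v \<in> ball w \<eta>" using dense[of "ball w \<eta>"] \<eta> by auto
    then show "w \<in> (\<Union>v\<in>D. ball v \<eta>)" by (auto simp: dist_commute)
  qed
  then obtain K where K: "K \<subseteq> D" "finite K" "cball 0 1 \<subseteq> (\<Union>v\<in>K. ball v \<eta>)"
    using compactE_image[OF compact_cball, of D "\<lambda>v. ball v \<eta>" 0 1] by (metis open_ball)
  have "\<forall>\<^sub>F t in at 0. \<forall>v\<in>K. \<bar>dquot g v t x - z \<bullet> v\<bar> < e / 2"
  proof (rule eventually_ball_finite[OF K(2)], rule)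
    fix v assume "v \<in> K"
    then have "((\<lambda>t. dquot g v t x) \<longlongrightarrow> z \<bullet> v) (at 0)"
      using dir K by (auto simp: has_real_derivative_dquot_iff)
    from tendstoD[OF this, of "e/2"] \<open>e > 0\<close> show "\<forall>\<^sub>F t in at 0. \<bar>dquot g v t x - z \<bullet> v\<bar> < e / 2"
      by (simp add: dist_real_def)
  qed
  then obtain d where d: "d > 0" "\<And>t v. t \<noteq> 0 \<Longrightarrow> \<bar>t\<bar> < d \<Longrightarrow> v \<in> K \<Longrightarrow> \<bar>dquot g v t x - z \<bullet> v\<bar> < e / 2"
    unfolding eventually_at by (auto simp: dist_real_def)
  have "norm (g y - g x - z \<bullet> (y - x)) \<le> e * norm (y - x)" if "norm (y - x) < d" for y
  proof (cases "y = x")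
    case False
    define t where "t = norm (y - x)"
    define w where "w = (1 / t) *\<^sub>R (y - x)"
    have t: "t > 0" "t < d" using False that by (auto simp: t_def)
    have y: "y = x + t *\<^sub>R w" using t by (simp add: w_def)
    have "norm w = 1" using t by (simp add: w_def t_def)
    then obtain v where v: "v \<in> K" "dist v w < \<eta>" using K(3) by (force simp: subset_iff)
    have 1: "\<bar>g (x + t *\<^sub>R w) - g (x + t *\<^sub>R v)\<bar> \<le> t * (L * \<eta>)"
    proof -
      have "\<bar>g (x + t *\<^sub>R w) - g (x + t *\<^sub>R v)\<bar> \<le> L * dist (x + t *\<^sub>R w) (x + t *\<^sub>R v)"
        using lipschitz_onD[OF lip, of "x + t *\<^sub>R w" "x + t *\<^sub>R v"] by (simp add: dist_real_def)
      also have "dist (x + t *\<^sub>R w) (x + t *\<^sub>R v) = t * dist v w"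
        using t by (simp add: dist_norm norm_minus_commute flip: scaleR_diff_right)
      also have "L * (t * dist v w) \<le> L * (t * \<eta>)"
        using v t L0 by (intro mult_left_mono) auto
      finally show ?thesis by (simp add: mult_ac)
    qed
    have 2: "\<bar>g (x + t *\<^sub>R v) - g x - t * (z \<bullet> v)\<bar> \<le> t * (e / 2)"
    proof -
      have "g (x + t *\<^sub>R v) - g x - t * (z \<bullet> v) = t * (dquot g v t x - z \<bullet> v)"
        using t by (simp add: dquot_def field_simps)
      then show ?thesis using d(2)[of t v] t v by (auto simp: abs_mult)
    qed
    have 3: "\<bar>t * (z \<bullet> v) - t * (z \<bullet> w)\<bar> \<le> t * (norm z * \<eta>)"
    proof -
      have "\<bar>z \<bullet> v - z \<bullet> w\<bar> \<le> norm z * norm (v - w)"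
        by (metis Cauchy_Schwarz_ineq2 inner_diff_right)
      also have "\<dots> \<le> norm z * \<eta>" using v by (intro mult_left_mono) (auto simp: dist_norm)
      finally show ?thesis using t by (simp add: abs_mult flip: right_diff_distrib)
    qed
    have "\<bar>g y - g x - z \<bullet> (y - x)\<bar> \<le> t * (L * \<eta>) + t * (e / 2) + t * (norm z * \<eta>)"
    proof -
      have "z \<bullet> (y - x) = t * (z \<bullet> w)" by (simp add: y)
      then show ?thesis using 1 2 3 unfolding y[symmetric] by linarith
    qed
    also have "\<dots> = t * ((L + norm z) * \<eta> + e / 2)" by (simp add: algebra_simps)
    also have "\<dots> \<le> t * e" using \<eta>e t by (intro mult_left_mono) auto
    finally show ?thesis by (simp add: t_def mult.commute)
  qed simp
  then show "\<exists>d>0. \<forall>y. norm (y - x) < d \<longrightarrow> norm (g y - g x - z \<bullet> (y - x)) \<le> e * norm (y - x)"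
    using d(1) by blast
qed

text \<open>A countable dense set of directions needs only one null set, off which
  \<open>ddir\<close> is linear along all of them.\<close>

theorem Rademacher:
  fixes g :: "'a::euclidean_space \<Rightarrow> real"
  assumes lip: "L-lipschitz_on UNIV g"
  shows "AE x in lborel. g differentiable at x"
proof -
  obtain D :: "'a set" where D: "countable D" "\<And>U. open U \<Longrightarrow> U \<noteq> {} \<Longrightarrow> \<exists>v\<in>D. v \<in> U"
    using countable_dense_setE by metis
  have "AE x in lborel. \<forall>v\<in>D. ((\<lambda>t. g (x + t *\<^sub>R v)) has_real_derivative (\<Sum>b\<in>Basis. (v \<bullet> b) * ddir g b x)) (at 0)"
    unfolding AE_ball_countable[OF D(1)]
  proof
    fix v
    show "AE x in lborel. ((\<lambda>t. g (x + t *\<^sub>R v)) has_real_derivative (\<Sum>b\<in>Basis. (v \<bullet> b) * ddir g b x)) (at 0)"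
      using has_real_derivative_along_coordinates_AE[OF lip finite_Basis, of "\<lambda>b. v \<bullet> b"]
      by (simp add: euclidean_representation)
  qed
  then show ?thesis
  proof eventually_elim
    case (elim x)
    let ?z = "\<Sum>b\<in>Basis. ddir g b x *\<^sub>R b"
    have "(g has_derivative (\<lambda>v. ?z \<bullet> v)) (at x)"
      using elim by (intro has_derivative_from_dense_directions[OF lip D(2)])
                    (auto simp: inner_sum_left inner_commute[of _ "_::'a"] inner_sum_right mult.commute)
    then show ?case unfolding differentiable_def by blast
  qed
qed

section \<open>Almost-everywhere derivative bounds integrated along segments\<close>

lemma lipschitz_on_clamp:
  fixes g :: "'a::euclidean_space \<Rightarrow> real"
  assumes "L-lipschitz_on S g" "convex S" "closed S" "S \<noteq> {}"
  shows "L-lipschitz_on UNIV (\<lambda>x. g (closest_point S x))"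
proof (rule lipschitz_onI)
  fix x y
  have "dist (g (closest_point S x)) (g (closest_point S y)) \<le> L * dist (closest_point S x) (closest_point S y)"
    using assms by (intro lipschitz_onD[OF assms(1)] closest_point_in_set)
  also have "\<dots> \<le> L * dist x y"
    using assms by (intro mult_left_mono closest_point_lipschitz lipschitz_on_nonneg[OF assms(1)])
  finally show "dist (g (closest_point S x)) (g (closest_point S y)) \<le> L * dist x y" .
qed (rule lipschitz_on_nonneg[OF assms(1)])

text \<open>A Lipschitz function is the integral of a derivative that exists off a null set, so
  bounding the derivatives that do exist bounds the increment.\<close>

lemma lipschitz_real_increment_le:
  fixes f :: "real \<Rightarrow> real"
  assumes lip: "L-lipschitz_on {a..b} f" and "a \<le> b"
    and ae: "AE t in lborel. a < t \<longrightarrow> t < b \<longrightarrow> (\<forall>d. (f has_real_derivative d) (at t) \<longrightarrow> d \<le> c)"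
  shows "f b - f a \<le> c * (b - a)"
proof -
  \<comment> \<open>The nearest-point projection is 1-Lipschitz, so the extension to the whole line
    keeps the constant of \<open>f\<close>.\<close>
  define F where "F = (\<lambda>x. f (closest_point {a..b} x))"
  have Feq: "F x = f x" if "x \<in> {a..b}" for x
    using that by (simp add: F_def closest_point_self)
  have "L-lipschitz_on UNIV F"
    unfolding F_def using \<open>a \<le> b\<close> by (intro lipschitz_on_clamp lip) auto
  then obtain h N where N: "negligible N" and h: "\<And>a b. a \<le> b \<Longrightarrow> (h has_integral (F b - F a)) {a..b}"
    "\<And>x. x \<notin> N \<Longrightarrow> (F has_real_derivative h x) (at x)"
    by (rule lipschitz_real_integral_derivative) blast
  obtain N' where N': "negligible N'" "\<And>t d. t \<notin> N' \<Longrightarrow> a < t \<Longrightarrow> t < b \<Longrightarrow> (f has_real_derivative d) (at t) \<Longrightarrow> d \<le> c"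
    using ae by (auto elim!: AE_E simp: null_sets_def)
       (metis (mono_tags, lifting) mem_Collect_eq negligible_iff_null_sets null_setsI null_sets_completionI sets_lborel subsetD)
  have "F b - F a \<le> c * (b - a)"
  \<comment> \<open>The integrand is set to \<open>c\<close> on the exceptional null set, so that
    the comparison holds at every point of the interval.\<close>
  proof (rule has_integral_le[OF has_integral_spike[where S="N \<union> N' \<union> {a, b}" and f="h" and g="\<lambda>x. if x \<in> N \<union> N' \<union> {a, b} then c else h x"]])
    show "negligible (N \<union> N' \<union> {a, b})" using N N' by simp
    show "(h has_integral F b - F a) {a..b}" by (rule h(1)[OF \<open>a \<le> b\<close>])
    show "((\<lambda>x. c) has_integral c * (b - a)) {a..b}"
      using has_integral_const_real[of c a b] \<open>a \<le> b\<close> by (simp add: mult.commute)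
    fix x assume x: "x \<in> {a..b}"
    show "(if x \<in> N \<union> N' \<union> {a, b} then c else h x) \<le> c"
    proof (cases "x \<in> N \<union> N' \<union> {a, b}")
      case False
      then have ab: "a < x" "x < b" using x by auto
      have "\<forall>\<^sub>F y in nhds x. F y = f y"
        using eventually_nhds_in_open[of "{a<..<b}" x] ab by (auto elim!: eventually_mono simp: Feq)
      then have "(f has_real_derivative h x) (at x)"
        using h(2)[of x] False DERIV_cong_ev[OF refl _ refl, of F f x "h x"] by auto
      then show ?thesis using N'(2)[of x] ab False by auto
    qed simp
  qed auto
  then show ?thesis using \<open>a \<le> b\<close> by (simp add: Feq)
qed

lemma AE_lborel_ball_ex:
  fixes x :: "'a::euclidean_space"
  assumes "AE y in lborel. P y" "e > 0"
  shows "\<exists>y\<in>ball x e. P y"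
proof (rule ccontr)
  assume "\<not> ?thesis"
  then have "AE y in lborel. y \<notin> ball x e" using assms(1) by (auto elim: eventually_mono)
  then have "ball x e \<in> null_sets lborel" by (subst AE_iff_null_sets) auto
  then have "negligible (ball x e)" by (simp add: negligible_iff_null_sets null_sets_completionI)
  then show False using open_not_negligible[of "ball x e"] \<open>e > 0\<close> by auto
qed

text \<open>The bound on the derivative is assumed only where a derivative exists; it is integrated along
  almost every line in direction \<open>w\<close>.\<close>

lemma lipschitz_directional_decrease:
  fixes g :: "'a::euclidean_space \<Rightarrow> real"
  assumes lip: "L-lipschitz_on (ball x r) g" and r: "r > 0"
    and der: "\<And>y D. y \<in> ball x r \<Longrightarrow> (g has_derivative D) (at y) \<Longrightarrow> D w \<le> - a"
  shows "\<exists>d>0. \<forall>h. 0 \<le> h \<and> h < d \<longrightarrow> g (x + h *\<^sub>R w) \<le> g x - h * a"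
proof -
  define S where "S = cball x (r / 2)"
  have S: "convex S" "closed S" "S \<noteq> {}" "S \<subseteq> ball x r" using r by (auto simp: S_def)
  define G where "G = (\<lambda>y. g (closest_point S y))"
  have Glip: "L-lipschitz_on UNIV G"
    unfolding G_def using S lip by (intro lipschitz_on_clamp) (auto intro: lipschitz_on_subset)
  have L0: "0 \<le> L" using lip lipschitz_on_nonneg by blast
  have Geq: "G y = g y" if "y \<in> S" for y using that by (simp add: G_def closest_point_self)
  obtain N where N: "N \<in> null_sets lborel" "\<And>y. y \<notin> N \<Longrightarrow> G differentiable at y"
  proof -
    from AE_E[OF Rademacher[OF Glip]] obtain N where "{y \<in> space lborel. \<not> G differentiable at y} \<subseteq> N"
      "emeasure lborel N = 0" "N \<in> sets lborel" by blast
    then show ?thesis by (intro that[of N]) (auto simp: null_sets_def)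
  qed
  then have [measurable]: "N \<in> sets borel" by auto
  have Nae: "AE y in lborel. y \<notin> N" using N(1) by (rule AE_not_in)
  have "Measurable.pred (lborel \<Otimes>\<^sub>M lborel) (\<lambda>p :: 'a \<times> real. fst p + snd p *\<^sub>R w \<notin> N)"
    by measurable
  then have meas: "{p :: 'a \<times> real \<in> space (lborel \<Otimes>\<^sub>M lborel). fst p + snd p *\<^sub>R w \<notin> N} \<in> sets (lborel \<Otimes>\<^sub>M lborel)"
    by (rule predE)
  have "AE t in lborel. AE y in lborel. y + t *\<^sub>R w \<notin> N"
    by (intro AE_I2 AE_lborel_translate[OF Nae])
  then have ae: "AE y in lborel. AE t in lborel. y + t *\<^sub>R w \<notin> N"
    using lborel_pair.AE_commute[OF meas] by blast
  \<comment> \<open>Displacements \<open>h *\<^sub>R w\<close> with \<open>h < d\<close> are shorter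
    than \<open>r / 4\<close>. Started within \<open>r / 4\<close> of \<open>x\<close>, the segment
    stays in the ball of radius \<open>r / 2\<close>, on which \<open>G\<close> agrees with
    \<open>g\<close>.\<close>
  define d where "d = r / (4 * (norm w + 1))"
  have d: "d > 0" using r by (simp add: d_def add_nonneg_pos)
  have dw: "h * norm w < r / 4" if "0 \<le> h" "h < d" for h
  proof -
    have "h * norm w \<le> h * (norm w + 1)" using that by (intro mult_left_mono) auto
    also have "\<dots> < d * (norm w + 1)" using that by (intro mult_strict_right_mono) (auto simp: add_nonneg_pos)
    also have "\<dots> = r / 4" by (simp add: d_def field_simps add_nonneg_eq_0_iff)
    finally show ?thesis .
  qed
  have "g (x + h *\<^sub>R w) \<le> g x - h * a" if h: "0 \<le> h" "h < d" for h
  proof (rule field_le_epsilon)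
    fix e :: real assume "e > 0"
    \<comment> \<open>The segment through \<open>x\<close> itself may be exceptional, so a nearby
      \<open>y\<close> is used. The second bound makes the change of \<open>G\<close> from
      \<open>x\<close> to \<open>y\<close> at most \<open>e / 2\<close>, which is paid once at each
      end of the segment.\<close>
    define q where "q = min (r / 4) (e / (2 * (L + 1)))"
    have q: "q > 0" using \<open>e > 0\<close> r L0 by (simp add: q_def)
    obtain y where y: "y \<in> ball x q" "AE t in lborel. y + t *\<^sub>R w \<notin> N"
      using AE_lborel_ball_ex[OF ae q] by blast
    have in_S: "y + t *\<^sub>R w \<in> ball x (r / 2)" if "0 \<le> t" "t \<le> h" for t
    proof -
      have "dist x (y + t *\<^sub>R w) \<le> dist x y + norm (t *\<^sub>R w)"
        using norm_triangle_ineq4[of "x - y" "t *\<^sub>R w"] by (simp add: dist_norm algebra_simps)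
      then show ?thesis using y(1) dw[of t] that h by (simp add: q_def)
    qed
    have "G (y + h *\<^sub>R w) - G (y + 0 *\<^sub>R w) \<le> (- a) * (h - 0)"
    proof (rule lipschitz_real_increment_le[where L="L * norm w"])
      show "(L * norm w)-lipschitz_on {0..h} (\<lambda>t. G (y + t *\<^sub>R w))"
      proof (rule lipschitz_onI)
        fix s t
        have "dist (G (y + s *\<^sub>R w)) (G (y + t *\<^sub>R w)) \<le> L * dist (y + s *\<^sub>R w) (y + t *\<^sub>R w)"
          by (rule lipschitz_onD[OF Glip]) auto
        also have "dist (y + s *\<^sub>R w) (y + t *\<^sub>R w) = \<bar>s - t\<bar> * norm w"
          by (simp add: dist_norm flip: scaleR_diff_left)
        finally show "dist (G (y + s *\<^sub>R w)) (G (y + t *\<^sub>R w)) \<le> L * norm w * dist s t"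
          by (simp add: dist_real_def mult_ac)
      qed (use L0 in auto)
      show "AE t in lborel. 0 < t \<longrightarrow> t < h \<longrightarrow> (\<forall>d. ((\<lambda>t. G (y + t *\<^sub>R w)) has_real_derivative d) (at t) \<longrightarrow> d \<le> - a)"
        using y(2)
      proof (eventually_elim, intro impI allI)
        fix t d'
        assume t: "y + t *\<^sub>R w \<notin> N" "0 < t" "t < h" and d': "((\<lambda>t. G (y + t *\<^sub>R w)) has_real_derivative d') (at t)"
        obtain D where D: "(G has_derivative D) (at (y + t *\<^sub>R w))"
          using N(2)[OF t(1)] unfolding differentiable_def by blast
        have "((\<lambda>t. y + t *\<^sub>R w) has_derivative (\<lambda>s. s *\<^sub>R w)) (at t)"
          by (auto intro!: derivative_eq_intros)
        from has_derivative_compose[OF this D]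
        have "((\<lambda>t. G (y + t *\<^sub>R w)) has_derivative (\<lambda>s. D (s *\<^sub>R w))) (at t)" .
        then have "(\<lambda>s. D (s *\<^sub>R w)) = (*) d'"
          using d' has_derivative_unique by (auto simp: has_field_derivative_def)
        from fun_cong[OF this, of 1] have "D w = d'" by simp
        moreover have "(g has_derivative D) (at (y + t *\<^sub>R w))"
        proof (rule has_derivative_transform_within_open[OF D])
          show "open (ball x (r / 2))" "y + t *\<^sub>R w \<in> ball x (r / 2)" using in_S t by auto
          show "G z = g z" if "z \<in> ball x (r / 2)" for z using that by (intro Geq) (auto simp: S_def)
        qed
        moreover have "y + t *\<^sub>R w \<in> ball x r" using in_S[of t] t r by auto
        ultimately show "d' \<le> - a" using der by blast
      qed
    qed (use h in auto)
    moreover have "G (x + h *\<^sub>R w) - G (y + h *\<^sub>R w) \<le> e / 2" "G y - G x \<le> e / 2"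
    proof -
      have "L * dist x y \<le> (L + 1) * q"
        using y(1) L0 by (intro mult_mono) auto
      also have "\<dots> \<le> (L + 1) * (e / (2 * (L + 1)))"
        using L0 by (intro mult_left_mono) (auto simp: q_def)
      also have "\<dots> = e / 2" using L0 by (simp add: field_simps add_nonneg_eq_0_iff)
      finally have le: "L * dist x y \<le> e / 2" .
      show "G (x + h *\<^sub>R w) - G (y + h *\<^sub>R w) \<le> e / 2"
        using lipschitz_onD[OF Glip, of "x + h *\<^sub>R w" "y + h *\<^sub>R w"] le by (simp add: dist_real_def)
      show "G y - G x \<le> e / 2"
        using lipschitz_onD[OF Glip, of y x] le by (simp add: dist_real_def dist_commute)
    qed
    moreover have "G (x + h *\<^sub>R w) = g (x + h *\<^sub>R w)"
      using dw[OF h] h r by (intro Geq) (simp add: S_def dist_norm)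
    moreover have "G x = g x" using r by (intro Geq) (simp add: S_def)
    ultimately show "g (x + h *\<^sub>R w) \<le> g x - h * a + e" by (simp add: algebra_simps)
  qed
  then show ?thesis using d by blast
qed

section \<open>Comparison functions\<close>

lemma classK_less: "classK g \<Longrightarrow> 0 \<le> x \<Longrightarrow> x < y \<Longrightarrow> g x < g y"
  unfolding classK_def by (auto simp: strict_mono_on_def)

lemma classK_le: "classK g \<Longrightarrow> 0 \<le> x \<Longrightarrow> x \<le> y \<Longrightarrow> g x \<le> g y"
  using classK_less[of g x y] by (cases "x = y") auto

lemma classK_zero: "classK g \<Longrightarrow> g 0 = 0"
  by (simp add: classK_def)

lemma classK_nonneg: "classK g \<Longrightarrow> 0 \<le> x \<Longrightarrow> 0 \<le> g x"
  using classK_le[of g 0 x] by (simp add: classK_zero)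

lemma classK_pos: "classK g \<Longrightarrow> 0 < x \<Longrightarrow> 0 < g x"
  using classK_less[of g 0 x] by (simp add: classK_zero)

lemma classK_le_iff: "classK g \<Longrightarrow> 0 \<le> x \<Longrightarrow> 0 \<le> y \<Longrightarrow> g x \<le> g y \<longleftrightarrow> x \<le> y"
  using classK_le[of g x y] classK_less[of g y x] by (cases "x \<le> y") auto

lemma classK_less_iff: "classK g \<Longrightarrow> 0 \<le> x \<Longrightarrow> 0 \<le> y \<Longrightarrow> g x < g y \<longleftrightarrow> x < y"
  using classK_le_iff[of g y x] by (simp add: not_le[symmetric])

lemma classK_cont: "classK g \<Longrightarrow> continuous_on {0..} g"
  by (simp add: classK_def)

lemma classKinf_classK: "classKinf g \<Longrightarrow> classK g"
  by (simp add: classKinf_def)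

lemma classK_compose: "classK f \<Longrightarrow> classK g \<Longrightarrow> classK (\<lambda>x. f (g x))"
  using classK_less[of f] classK_less[of g] classK_nonneg[of g] unfolding classK_def
  by (auto intro!: strict_mono_onI continuous_on_compose2[of "{0..}" f])

lemma classKinf_compose: "classKinf f \<Longrightarrow> classKinf g \<Longrightarrow> classKinf (\<lambda>x. f (g x))"
  unfolding classKinf_def using classK_compose[of f g] filterlim_compose[of f at_top at_top g at_top] by simp

lemma classKinf_surj:
  assumes "classKinf g" "0 \<le> y"
  obtains x where "0 \<le> x" "g x = y"
proof -
  have "\<forall>\<^sub>F x in at_top. y \<le> g x \<and> 0 \<le> x"
    using assms eventually_ge_at_top[of 0] by (auto simp: classKinf_def filterlim_at_top intro: eventually_conj)
  then obtain b where b: "y \<le> g b" "0 \<le> b" using eventually_happens'[of at_top] by force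
  have "continuous_on {0..b} g"
    using classK_cont[OF classKinf_classK[OF assms(1)]] continuous_on_subset by fastforce
  with IVT'[of g 0 y b] b assms show ?thesis
    using that classK_zero[OF classKinf_classK[OF assms(1)]] by auto
qed

lemma Kinv_Kinf: "classKinf g \<Longrightarrow> 0 \<le> y \<Longrightarrow> g (Kinv g y) = y"
  and Kinv_nonneg: "classKinf g \<Longrightarrow> 0 \<le> y \<Longrightarrow> 0 \<le> Kinv g y"
proof -
  assume "classKinf g" "0 \<le> y"
  then have "y \<in> g ` {0..}" by (metis atLeast_iff classKinf_surj image_eqI)
  then show "g (Kinv g y) = y" "0 \<le> Kinv g y"
    unfolding Kinv_def using inv_into_into[of y g "{0..}"] by (auto simp: f_inv_into_f)
qed

lemma Kinv_cancel: "classKinf g \<Longrightarrow> 0 \<le> x \<Longrightarrow> Kinv g (g x) = x"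
  using classK_le_iff[OF classKinf_classK, of g x "Kinv g (g x)"] classK_le_iff[OF classKinf_classK, of g "Kinv g (g x)" x]
  by (simp add: Kinv_Kinf Kinv_nonneg classK_nonneg[OF classKinf_classK])

lemma Kinv_le_iff: "classKinf g \<Longrightarrow> 0 \<le> x \<Longrightarrow> 0 \<le> y \<Longrightarrow> Kinv g y \<le> x \<longleftrightarrow> y \<le> g x"
  using classK_le_iff[OF classKinf_classK, of g "Kinv g y" x] by (simp add: Kinv_Kinf Kinv_nonneg)

lemma Kinv_less_iff: "classKinf g \<Longrightarrow> 0 \<le> x \<Longrightarrow> 0 \<le> y \<Longrightarrow> Kinv g y < x \<longleftrightarrow> y < g x"
  using classK_less_iff[OF classKinf_classK, of g "Kinv g y" x] by (simp add: Kinv_Kinf Kinv_nonneg)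

lemma less_Kinv_iff: "classKinf g \<Longrightarrow> 0 \<le> x \<Longrightarrow> 0 \<le> y \<Longrightarrow> x < Kinv g y \<longleftrightarrow> g x < y"
  using Kinv_le_iff[of g x y] by linarith

lemma Kinv_classKinf:
  assumes g: "classKinf g"
  shows "classKinf (Kinv g)"
  unfolding classKinf_def classK_def
proof (intro conjI)
  have K: "classK g" using g by (rule classKinf_classK)
  show "Kinv g 0 = 0" using Kinv_cancel[OF g, of 0] classK_zero[OF K] by simp
  show smono: "strict_mono_on {0..} (Kinv g)"
  proof (rule strict_mono_onI)
    fix r s :: real assume "r \<in> {0..}" "s \<in> {0..}" "r < s"
    then show "Kinv g r < Kinv g s"
      by (subst Kinv_less_iff) (auto simp: g Kinv_Kinf Kinv_nonneg)
  qed
  show "filterlim (Kinv g) at_top at_top"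
    unfolding filterlim_at_top_ge[where c=0]
  proof safe
    fix Z :: real assume "0 \<le> Z"
    show "\<forall>\<^sub>F x in at_top. Z \<le> Kinv g x"
      using eventually_ge_at_top[of "g Z + 1"]
    proof eventually_elim
      case (elim x)
      have "0 \<le> g Z" by (rule classK_nonneg[OF K \<open>0 \<le> Z\<close>])
      then show ?case using less_Kinv_iff[OF g \<open>0 \<le> Z\<close>, of x] elim by auto
    qed
  qed
  show "continuous_on {0..} (Kinv g)"
    unfolding continuous_on_iff
  proof (intro ballI allI impI)
    fix y e :: real assume y: "y \<in> {0..}" and e: "e > 0"
    define x where "x = Kinv g y"
    have x: "0 \<le> x" "g x = y" using y by (auto simp: x_def Kinv_nonneg[OF g] Kinv_Kinf[OF g])
    define d1 where "d1 = g (x + e) - y"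
    have d1: "d1 > 0" using classK_less[OF K, of x "x + e"] x e by (simp add: d1_def)
    \<comment> \<open>For \<open>x < e\<close> the lower estimate is free because
      \<open>Kinv g\<close> is nonnegative, and any positive value serves.\<close>
    define d2 where "d2 = (if x < e then 1 else y - g (x - e))"
    have d2: "d2 > 0" using classK_less[OF K, of "x - e" x] x e by (auto simp: d2_def)
    have "dist (Kinv g y') (Kinv g y) < e" if y': "y' \<in> {0..}" "dist y' y < min d1 d2" for y'
    proof -
      have "y' < g (x + e)" using y' by (simp add: d1_def dist_real_def abs_less_iff)
      then have "Kinv g y' < x + e" using Kinv_less_iff[OF g, of "x + e" y'] x e y' by simp
      moreover have "x - e < Kinv g y'"
      proof (cases "x < e")
        case True
        then show ?thesis using Kinv_nonneg[OF g, of y'] y' by simp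
      next
        case False
        then have "g (x - e) < y'" using y' by (simp add: d2_def dist_real_def abs_less_iff)
        then show ?thesis using less_Kinv_iff[OF g, of "x - e" y'] False y' by simp
      qed
      ultimately show ?thesis by (simp add: dist_real_def abs_less_iff flip: x_def)
    qed
    then show "\<exists>d>0. \<forall>x'\<in>{0..}. dist x' y < d \<longrightarrow> dist (Kinv g x') (Kinv g y) < e"
      using d1 d2 by (intro exI[of _ "min d1 d2"]) auto
  qed
qed

lemma classK_add: "classK f \<Longrightarrow> classK g \<Longrightarrow> classK (\<lambda>x. f x + g x)"
  using classK_less[of f] classK_less[of g] unfolding classK_def
  by (auto intro!: continuous_on_add strict_mono_onI add_strict_mono)

lemma classKinf_add: "classKinf f \<Longrightarrow> classK g \<Longrightarrow> classKinf (\<lambda>x. f x + g x)"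
  unfolding classKinf_def
proof (intro conjI)
  assume f: "classK f \<and> filterlim f at_top at_top" and g: "classK g"
  show "classK (\<lambda>x. f x + g x)" using f g by (blast intro: classK_add)
  have "\<forall>\<^sub>F x in at_top. f x \<le> f x + g x"
    using eventually_ge_at_top[of 0] by eventually_elim (simp add: classK_nonneg[OF g])
  then show "filterlim (\<lambda>x. f x + g x) at_top at_top"
    by (rule filterlim_at_top_mono[OF conjunct2[OF f]])
qed

lemma classKinf_id: "classKinf (\<lambda>x. x)"
  unfolding classKinf_def classK_def by (auto intro!: strict_mono_onI filterlim_ident)

lemma classKinf_cmult: "0 < c \<Longrightarrow> classKinf (\<lambda>x. c * x)"
  unfolding classKinf_def classK_def
  using filterlim_tendsto_pos_mult_at_top[OF tendsto_const _ filterlim_ident]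
  by (auto intro!: strict_mono_onI continuous_on_mult_left continuous_on_id)

lemma classKinf_min:
  assumes "classKinf f" "classKinf g" shows "classKinf (\<lambda>x. min (f x) (g x))"
  unfolding classKinf_def classK_def
proof (intro conjI)
  have K: "classK f" "classK g" using assms by (auto intro: classKinf_classK)
  show "continuous_on {0..} (\<lambda>x. min (f x) (g x))" by (intro continuous_intros classK_cont K)
  show "strict_mono_on {0..} (\<lambda>x. min (f x) (g x))"
    by (intro strict_mono_onI) (use classK_less[OF K(1)] classK_less[OF K(2)] in \<open>auto simp: min_less_iff_disj intro: less_trans\<close>)
  show "min (f 0) (g 0) = 0" by (simp add: K classK_zero)
  show "filterlim (\<lambda>x. min (f x) (g x)) at_top at_top"
    using assms unfolding classKinf_def filterlim_at_top by (auto intro: eventually_conj)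
qed

lemma classK_finite_upper:
  fixes n :: nat
  assumes "\<And>i. i < n \<Longrightarrow> classK (f i)"
  shows "\<exists>\<psi>. classK \<psi> \<and> (\<forall>i<n. \<forall>r\<ge>0. f i r \<le> \<psi> r)"
  using assms
proof (induction n)
  case 0
  then show ?case using classKinf_classK[OF classKinf_id] by auto
next
  case (Suc n)
  then obtain \<psi> where "classK \<psi>" "\<forall>i<n. \<forall>r\<ge>0. f i r \<le> \<psi> r" by force
  moreover have "classK (f n)" using Suc by simp
  ultimately show ?case
    by (intro exI[of _ "\<lambda>r. \<psi> r + f n r"])
       (auto intro: classK_add simp: less_Suc_eq classK_nonneg intro: add_increasing2)
qed

lemma classKinf_finite_upper:
  fixes n :: nat
  assumes "\<And>i. i < n \<Longrightarrow> classKinf (f i)"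
  shows "\<exists>\<psi>. classKinf \<psi> \<and> (\<forall>i<n. \<forall>r\<ge>0. f i r \<le> \<psi> r)"
proof -
  obtain \<psi> where \<psi>: "classK \<psi>" "\<forall>i<n. \<forall>r\<ge>0. f i r \<le> \<psi> r"
    using classK_finite_upper[of n f] assms classKinf_classK by blast
  then show ?thesis
    by (intro exI[of _ "\<lambda>r. r + \<psi> r"]) (force intro: classKinf_add classKinf_id)
qed

lemma classKinf_finite_lower:
  fixes n :: nat
  assumes "\<And>i. i < n \<Longrightarrow> classKinf (f i)"
  shows "\<exists>\<psi>. classKinf \<psi> \<and> (\<forall>i<n. \<forall>r\<ge>0. \<psi> r \<le> f i r)"
  using assms
proof (induction n)
  case 0
  then show ?case using classKinf_id by auto
next
  case (Suc n)
  then obtain \<psi> where "classKinf \<psi>" "\<forall>i<n. \<forall>r\<ge>0. \<psi> r \<le> f i r" by force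
  moreover have "classKinf (f n)" using Suc by simp
  ultimately show ?case
    by (intro exI[of _ "\<lambda>r. min (\<psi> r) (f n r)"])
       (auto intro: classKinf_min simp: less_Suc_eq min_le_iff_disj)
qed

lemma gain_function_le: "classKinf g \<or> zero_gain g \<Longrightarrow> 0 \<le> x \<Longrightarrow> x \<le> y \<Longrightarrow> g x \<le> g y"
  using classK_le[OF classKinf_classK, of g x y] by (auto simp: zero_gain_def)

lemma gain_function_nonneg: "classKinf g \<or> zero_gain g \<Longrightarrow> 0 \<le> x \<Longrightarrow> 0 \<le> g x"
  using classK_nonneg[OF classKinf_classK, of g x] by (auto simp: zero_gain_def)

lemma gain_function_continuous:
  assumes "classKinf g \<or> zero_gain g"
  shows "continuous_on {0..} g"
proof (cases "zero_gain g")
  case True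
  then have "continuous_on {0..} g \<longleftrightarrow> continuous_on {0..} (\<lambda>x::real. 0::real)"
    by (intro continuous_on_cong) (auto simp: zero_gain_def)
  then show ?thesis by simp
qed (use assms classK_cont classKinf_classK in blast)

lemma isCont_clamp:
  assumes "continuous_on {0..} (g :: real \<Rightarrow> real)"
  shows "isCont (\<lambda>x. g (max 0 x)) x"
proof -
  have "continuous_on UNIV (\<lambda>x. g (max 0 x))"
    by (intro continuous_on_compose2[OF assms] continuous_intros) auto
  then show ?thesis by (simp add: continuous_on_eq_continuous_at)
qed

text \<open>The minorant is the infimal convolution of a locally bounded-below rate with the absolute value.\<close>

lemma posdef_minorant:
  fixes P :: "real \<Rightarrow> real \<Rightarrow> bool"
  assumes mono: "\<And>r e e'. P r e \<Longrightarrow> 0 < e' \<Longrightarrow> e' \<le> e \<Longrightarrow> P r e'"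
    and loc: "\<And>a b. 0 < a \<Longrightarrow> a \<le> b \<Longrightarrow> \<exists>e>0. \<forall>r\<in>{a..b}. P r e"
  obtains q where "posdef q" "\<And>r. 0 < r \<Longrightarrow> P r (q r)" "\<And>r s. \<bar>q r - q s\<bar> \<le> \<bar>r - s\<bar>" "\<And>r. 0 \<le> r \<Longrightarrow> q r \<le> r"
proof -
  define E where "E = (\<lambda>s. {e. 0 \<le> e \<and> e \<le> s \<and> (e = 0 \<or> P s e)})"
  \<comment> \<open>Half the supremum lies below some admissible rate, so \<open>P s (m s)\<close>
    follows by monotonicity without the supremum being attained. The cap \<open>e \<le> s\<close> in
    \<open>E\<close> keeps it finite and gives \<open>m s \<le> s / 2\<close>, hence
    \<open>q r \<le> r\<close>.\<close>
  define m where "m = (\<lambda>s. Sup (E s) / 2)"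
  have bdd: "bdd_above (E s)" for s by (rule bdd_aboveI[of _ s]) (auto simp: E_def)
  have mlow: "min e s / 2 \<le> m s" if "0 < s" "0 < e" "P s e" for s e
  proof -
    have "min e s \<in> E s" using that mono[of s e "min e s"] by (auto simp: E_def)
    then show ?thesis using cSup_upper[OF _ bdd] by (simp add: m_def)
  qed
  have m0: "0 \<le> m s" "m s \<le> s / 2" if "0 < s" for s
  proof -
    have z: "0 \<in> E s" using that by (auto simp: E_def)
    show "0 \<le> m s" using cSup_upper[OF z bdd] by (simp add: m_def)
    have "Sup (E s) \<le> s" using z by (intro cSup_least) (auto simp: E_def)
    then show "m s \<le> s / 2" by (simp add: m_def)
  qed
  have mpos: "0 < m s" if s: "0 < s" for s
  proof -
    obtain e where "e > 0" "P s e" using loc[OF s order_refl] by auto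
    then show ?thesis using mlow[OF s] s by fastforce
  qed
  have Pm: "P s (m s)" if "0 < s" for s
  proof -
    have "m s < Sup (E s)" using mpos[OF that] by (simp add: m_def)
    moreover have "E s \<noteq> {}" using that by (auto simp: E_def intro!: exI[of _ 0])
    ultimately obtain e where "e \<in> E s" "m s < e" using less_cSupD by blast
    then show ?thesis using mono[of s e "m s"] mpos[OF that] by (auto simp: E_def)
  qed
  define q where "q = (\<lambda>r. Inf ((\<lambda>s. m s + \<bar>r - s\<bar>) ` {0<..}))"
  have bb: "bdd_below ((\<lambda>s. m s + \<bar>r - s\<bar>) ` {0<..})" for r
    by (rule bdd_belowI[of _ 0]) (auto intro!: add_nonneg_nonneg m0)
  have ub: "q r \<le> m s + \<bar>r - s\<bar>" if "0 < s" for r s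
    unfolding q_def using that by (intro cInf_lower bb) auto
  have lb: "c \<le> q r" if "\<And>s. 0 < s \<Longrightarrow> c \<le> m s + \<bar>r - s\<bar>" for c r
    unfolding q_def using that by (intro cInf_greatest) auto
  have lip1: "q r \<le> q s + \<bar>r - s\<bar>" for r s
  proof -
    have "q r - \<bar>r - s\<bar> \<le> q s"
    proof (rule lb)
      fix t :: real assume "0 < t"
      then show "q r - \<bar>r - s\<bar> \<le> m t + \<bar>s - t\<bar>" using ub[of t r] by linarith
    qed
    then show ?thesis by linarith
  qed
  have lip: "\<bar>q r - q s\<bar> \<le> \<bar>r - s\<bar>" for r s
    using lip1[of r s] lip1[of s r] by linarith
  have q0: "0 \<le> q r" for r by (rule lb) (auto intro!: add_nonneg_nonneg m0)
  have qpos: "0 < q r" if r: "0 < r" for r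
  proof -
    \<comment> \<open>Points near \<open>r\<close> contribute through \<open>m\<close>, which is
      bounded below there; the others contribute at least \<open>r / 2\<close> through their
      distance from \<open>r\<close>.\<close>
    obtain e where e: "e > 0" "\<And>s. s \<in> {r/2..2*r} \<Longrightarrow> P s e" using loc[of "r/2" "2*r"] r by auto
    have "min (min e (r/2) / 2) (r/2) \<le> q r"
    proof (rule lb)
      fix s :: real assume s: "0 < s"
      show "min (min e (r/2) / 2) (r/2) \<le> m s + \<bar>r - s\<bar>"
      proof (cases "s \<in> {r/2..2*r}")
        case True
        then have "min e s / 2 \<le> m s" using mlow[OF s e(1)] e(2) by blast
        moreover have "min e (r/2) \<le> min e s" using True by auto
        ultimately show ?thesis by linarith
      next
        case False
        then have "r / 2 \<le> \<bar>r - s\<bar>" using r by (auto simp: abs_if)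
        then show ?thesis using m0(1)[OF s] by linarith
      qed
    qed
    then show ?thesis using e(1) r by (smt (verit) field_sum_of_halves)
  qed
  have qle: "q r \<le> r" if "0 \<le> r" for r
  proof (rule field_le_epsilon)
    fix e :: real assume "0 < e"
    then have "0 < r + e / 2" using that by linarith
    from ub[OF this, of r] m0(2)[OF this] show "q r \<le> r + e" using \<open>0 < e\<close> that by simp
  qed
  have "posdef q"
    unfolding posdef_def
  proof (intro conjI allI impI)
    show "continuous_on {0..} q"
      by (rule lipschitz_on_continuous_on[of 1]) (auto intro!: lipschitz_onI simp: dist_real_def lip)
    fix r :: real assume "0 \<le> r"
    show "q r \<ge> 0" by (rule q0)
    show "(q r = 0) = (r = 0)" using qpos[of r] qle[of r] q0[of r] \<open>0 \<le> r\<close> by force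
  qed
  moreover have "P r (q r)" if "0 < r" for r
    using mono[OF Pm[OF that] qpos[OF that]] ub[OF that, of r] by simp
  ultimately show ?thesis using lip qle that by blast
qed

section \<open>Existence of paths of strict decrease\<close>

lemma tendsto_Max_image:
  fixes f :: "'i \<Rightarrow> 'z \<Rightarrow> real"
  assumes "finite I" "I \<noteq> {}" "\<And>j. j \<in> I \<Longrightarrow> (f j \<longlongrightarrow> l j) F"
  shows "((\<lambda>z. Max ((\<lambda>j. f j z) ` I)) \<longlongrightarrow> Max (l ` I)) F"
  using assms
proof (induction I rule: finite_ne_induct)
  case (insert j I)
  have "((\<lambda>z. max (f j z) (Max ((\<lambda>j. f j z) ` I))) \<longlongrightarrow> max (l j) (Max (l ` I))) F"
    using insert by (intro tendsto_max) auto
  then show ?case using insert by simp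
qed simp

lemma Max_image_mono:
  fixes f g :: "'i \<Rightarrow> real"
  assumes "finite I" "I \<noteq> {}" "\<And>j. j \<in> I \<Longrightarrow> f j \<le> g j"
  shows "Max (f ` I) \<le> Max (g ` I)"
  using assms by (auto intro!: Max.boundedI intro: order_trans[OF _ Max_ge])

text \<open>The comparison functions are only specified on \<open>{0..}\<close>; clamping their arguments makes the
  monotone operator \<open>M\<close> continuous and monotone on all vectors.\<close>

locale mixed_gains =
  fixes n :: nat and Isum :: "nat set" and \<gamma> :: "nat \<Rightarrow> nat \<Rightarrow> real \<Rightarrow> real" and \<alpha> :: "real \<Rightarrow> real"
  assumes n_pos: "0 < n"
    and gains: "\<And>i j. i < n \<Longrightarrow> j < n \<Longrightarrow> classKinf (\<gamma> i j) \<or> zero_gain (\<gamma> i j)"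
    and irred: "gain_irreducible n \<gamma>"
    and alpha: "classKinf \<alpha>"
    and small_gain: "\<And>s. (\<forall>i<n. 0 \<le> s i) \<Longrightarrow> (\<exists>i<n. s i \<noteq> 0) \<Longrightarrow>
                       (\<exists>i<n. gain_op n Isum \<gamma> (Dalpha Isum \<alpha> s) i < s i)"
begin

definition G :: "(nat \<Rightarrow> real) \<Rightarrow> nat \<Rightarrow> real" where
  "G s = gain_op n Isum \<gamma> (\<lambda>j. max 0 (s j))"

definition M :: "(nat \<Rightarrow> real) \<Rightarrow> nat \<Rightarrow> real" where
  "M s = Dalpha Isum (\<lambda>r. \<alpha> (max 0 r)) (G s)"

lemma gain_mono: "i < n \<Longrightarrow> j < n \<Longrightarrow> 0 \<le> x \<Longrightarrow> x \<le> y \<Longrightarrow> \<gamma> i j x \<le> \<gamma> i j y"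
  using gain_function_le[OF gains] .

lemma gain_nonneg: "i < n \<Longrightarrow> j < n \<Longrightarrow> 0 \<le> x \<Longrightarrow> 0 \<le> \<gamma> i j x"
  using gain_function_nonneg[OF gains] .

lemma gain_zero: "i < n \<Longrightarrow> j < n \<Longrightarrow> \<gamma> i j 0 = 0"
  using gains[of i j] classK_zero[OF classKinf_classK, of "\<gamma> i j"] by (auto simp: zero_gain_def)

lemma gain_cont: "i < n \<Longrightarrow> j < n \<Longrightarrow> isCont (\<lambda>x. \<gamma> i j (max 0 x)) x"
  by (intro isCont_clamp gain_function_continuous gains)

lemma alpha_cont: "isCont (\<lambda>x. \<alpha> (max 0 x)) x"
  by (intro isCont_clamp classK_cont classKinf_classK alpha)

lemma M_tendsto:
  assumes i: "i < n" and s: "\<And>j. j < n \<Longrightarrow> ((\<lambda>z. s z j) \<longlongrightarrow> l j) F"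
  shows "((\<lambda>z. M (s z) i) \<longlongrightarrow> M l i) F"
proof -
  have g: "((\<lambda>z. \<gamma> i j (max 0 (s z j))) \<longlongrightarrow> \<gamma> i j (max 0 (l j))) F" if "j < n" for j
    by (rule isCont_tendsto_compose[OF gain_cont[OF i that] s[OF that]])
  have "((\<lambda>z. G (s z) i) \<longlongrightarrow> G l i) F"
    unfolding G_def gain_op_def using g n_pos
    by (auto intro!: tendsto_sum tendsto_Max_image)
  then show ?thesis
    unfolding M_def Dalpha_def
    by (auto intro!: tendsto_add isCont_tendsto_compose[OF alpha_cont])
qed

lemma M_continuous_on:
  assumes "i < n" "\<And>j. j < n \<Longrightarrow> continuous_on S (\<lambda>z. s z j)"
  shows "continuous_on S (\<lambda>z. M (s z) i)"
  using assms unfolding continuous_on_def by (auto intro!: M_tendsto)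

lemma G_mono: "i < n \<Longrightarrow> (\<And>j. j < n \<Longrightarrow> s j \<le> t j) \<Longrightarrow> G s i \<le> G t i"
  unfolding G_def gain_op_def using n_pos
  by (auto intro!: sum_mono Max_image_mono gain_mono max.mono)

lemma G_nonneg: "i < n \<Longrightarrow> 0 \<le> G s i"
  unfolding G_def gain_op_def using n_pos
  by (auto intro!: sum_nonneg gain_nonneg simp: Max_ge_iff lessThan_empty_iff)

lemma D_le_iff: "0 \<le> x \<Longrightarrow> 0 \<le> y \<Longrightarrow> x + \<alpha> (max 0 x) \<le> y + \<alpha> (max 0 y) \<longleftrightarrow> x \<le> y"
  using classK_le_iff[OF classK_add[OF classKinf_classK[OF classKinf_id] classKinf_classK[OF alpha]], of x y] by simp

lemma D_less_iff: "0 \<le> x \<Longrightarrow> 0 \<le> y \<Longrightarrow> x + \<alpha> (max 0 x) < y + \<alpha> (max 0 y) \<longleftrightarrow> x < y"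
  using D_le_iff[of y x] by (simp add: not_le[symmetric])

lemma M_mono: "i < n \<Longrightarrow> (\<And>j. j < n \<Longrightarrow> s j \<le> t j) \<Longrightarrow> M s i \<le> M t i"
  using G_mono[of i s t] G_nonneg[of i s] G_nonneg[of i t] D_le_iff[of "G s i" "G t i"]
  by (auto simp: M_def Dalpha_def)

lemma M_ge_G: "i < n \<Longrightarrow> G s i \<le> M s i"
  using G_nonneg[of i s] classK_nonneg[OF classKinf_classK[OF alpha], of "G s i"] by (auto simp: M_def Dalpha_def)

lemma M_nonneg: "i < n \<Longrightarrow> 0 \<le> M s i"
  using M_ge_G[of i s] G_nonneg[of i s] by linarith

lemma G_ge_gain: "i < n \<Longrightarrow> j < n \<Longrightarrow> 0 \<le> s j \<Longrightarrow> \<gamma> i j (s j) \<le> G s i"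
proof -
  assume ij: "i < n" "j < n" and s: "0 \<le> s j"
  have "\<gamma> i j (max 0 (s j)) \<le> (\<Sum>j<n. \<gamma> i j (max 0 (s j)))"
    using ij by (intro member_le_sum) (auto intro: gain_nonneg)
  moreover have "\<gamma> i j (max 0 (s j)) \<le> Max ((\<lambda>j. \<gamma> i j (max 0 (s j))) ` {..<n})"
    using ij by (intro Max_ge) auto
  ultimately show ?thesis using s unfolding G_def gain_op_def by (auto simp: max_def)
qed

lemma M_ge_gain: "i < n \<Longrightarrow> j < n \<Longrightarrow> 0 \<le> s j \<Longrightarrow> \<gamma> i j (s j) \<le> M s i"
  using G_ge_gain M_ge_G order_trans by blast

lemma M_eq: "(\<And>j. j < n \<Longrightarrow> 0 \<le> s j) \<Longrightarrow> i < n \<Longrightarrow> M s i = Dalpha Isum \<alpha> (gain_op n Isum \<gamma> s) i"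
proof -
  assume s: "\<And>j. j < n \<Longrightarrow> 0 \<le> s j" and i: "i < n"
  have *: "\<gamma> i j (max 0 (s j)) = \<gamma> i j (s j)" if "j < n" for j using s[OF that] by (simp add: max_def)
  have "gain_op n Isum \<gamma> s i = G s i"
    unfolding G_def gain_op_def using * by (auto intro!: sum.cong arg_cong[where f=Max] image_cong)
  then show ?thesis using G_nonneg[OF i, of s] by (simp add: M_def Dalpha_def max_def)
qed

text \<open>With \<open>w = G s\<close>, the assumption says that \<open>s\<close> lies below
  \<open>D w\<close>, so applying the monotone \<open>G\<close> puts \<open>w\<close> below
  \<open>G (D w)\<close>. The small-gain condition excludes this unless \<open>w\<close> vanishes,
  and then so do \<open>M s\<close> and \<open>s\<close>.\<close>

lemma M_not_ge:
  assumes s: "\<And>i. i < n \<Longrightarrow> 0 \<le> s i" and ge: "\<And>i. i < n \<Longrightarrow> s i \<le> M s i" and "i < n"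
  shows "s i = 0"
proof (rule ccontr)
  assume si: "s i \<noteq> 0"
  define w where "w = G s"
  have w0: "0 \<le> w j" if "j < n" for j using G_nonneg[OF that] by (simp add: w_def)
  have Dw: "Dalpha Isum \<alpha> w j = M s j" if "j < n" for j
    using w0[OF that] by (simp add: M_def Dalpha_def w_def max_def)
  have "w i \<noteq> 0"
  proof
    assume "w i = 0"
    then have "M s i = 0" using classK_zero[OF classKinf_classK[OF alpha]] by (simp add: M_def Dalpha_def w_def)
    then show False using ge[OF \<open>i < n\<close>] s[OF \<open>i < n\<close>] si by simp
  qed
  then obtain k where k: "k < n" "gain_op n Isum \<gamma> (Dalpha Isum \<alpha> w) k < w k"
    using small_gain[of w] w0 \<open>i < n\<close> by blast
  have Dw0: "0 \<le> Dalpha Isum \<alpha> w j" if "j < n" for j using Dw[OF that] M_nonneg[OF that] by simp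
  have "G s k \<le> G (Dalpha Isum \<alpha> w) k" using ge Dw by (intro G_mono k) auto
  moreover have "G (Dalpha Isum \<alpha> w) k = gain_op n Isum \<gamma> (Dalpha Isum \<alpha> w) k"
    unfolding G_def gain_op_def using Dw0 by (auto intro!: sum.cong arg_cong[where f=Max] image_cong simp: max_def)
  ultimately show False using k by (simp add: w_def)
qed

text \<open>At a fixed point of \<open>\<Phi>\<close> the excess of \<open>M\<close> over the
  identity is proportional to the point. Were it nonzero, every positive component would lie below
  its image under \<open>M\<close>, and the zero components do so anyway, against
  \<open>M_not_ge\<close>. The injection \<open>k\<close> places the \<open>n\<close> components in
  a Euclidean space for Brouwer's theorem.\<close>

lemma exists_subinvariant_of_sum:
  fixes k :: "nat \<Rightarrow> 'd::finite" and R :: real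
  assumes inj: "inj_on k {..<n}" and R: "0 < R"
  shows "\<exists>s. (\<forall>i<n. 0 \<le> s i \<and> M s i \<le> s i) \<and> (\<Sum>i<n. s i) = R"
proof -
  define K where "K = k ` {..<n}"
  define sv where "sv = (\<lambda>(x::real^'d) i. x $ k i)"
  define \<Delta> where "\<Delta> = {x::real^'d. (\<forall>j. 0 \<le> x $ j) \<and> (\<forall>j. j \<notin> K \<longrightarrow> x $ j = 0) \<and> (\<Sum>i<n. x $ k i) = R}"
  define e where "e = (\<lambda>x i. max 0 (M (sv x) i - sv x i))"
  define S where "S = (\<lambda>x. \<Sum>i<n. e x i)"
  define ki where "ki = inv_into {..<n} k"
  have ki: "ki (k i) = i" if "i < n" for i using inj that by (simp add: ki_def)
  \<comment> \<open>The excess is added and the result rescaled to total mass \<open>R\<close>, so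
    the simplex \<open>\<Delta>\<close> is mapped into itself; the denominator is at least
    \<open>R\<close>.\<close>
  define \<Phi> where "\<Phi> = (\<lambda>x. \<chi> j. if j \<in> K then R * (x $ j + e x (ki j)) / (R + S x) else 0)"
  have e0: "0 \<le> e x i" for x i by (simp add: e_def)
  have S0: "0 \<le> S x" for x by (simp add: S_def sum_nonneg e0)
  have pos: "0 < R + S x" for x using R S0[of x] by linarith
  have \<Phi>k: "\<Phi> x $ k i = R * (x $ k i + e x i) / (R + S x)" if "i < n" for x i
    using that by (simp add: \<Phi>_def K_def ki)
  have svc: "continuous_on UNIV (\<lambda>x. sv x j)" for j unfolding sv_def by (intro continuous_intros)
  have ec: "continuous_on UNIV (\<lambda>x. e x i)" if "i < n" for i
    unfolding e_def by (intro continuous_intros M_continuous_on svc that)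
  have Sc: "continuous_on UNIV S" unfolding S_def by (intro continuous_on_sum ec) auto
  have "continuous_on UNIV (\<lambda>x. \<Phi> x $ j)" for j
  proof (cases "j \<in> K")
    case True
    then obtain i where "i < n" "j = k i" by (auto simp: K_def)
    then show ?thesis using pos
      by (simp add: \<Phi>k) (intro continuous_intros Sc ec, auto simp: less_imp_neq[THEN not_sym])
  qed (simp add: \<Phi>_def)
  then have \<Phi>c: "continuous_on \<Delta> \<Phi>"
    using continuous_on_vec_lambda[of UNIV "\<lambda>j x. \<Phi> x $ j"] by (auto intro: continuous_on_subset)
  have "\<Phi> x \<in> \<Delta>" if x: "x \<in> \<Delta>" for x
  proof -
    have "(\<Sum>i<n. \<Phi> x $ k i) = (\<Sum>i<n. R * (x $ k i + e x i) / (R + S x))" by (simp add: \<Phi>k)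
    also have "\<dots> = R * ((\<Sum>i<n. x $ k i) + S x) / (R + S x)"
      by (simp add: S_def sum.distrib sum_distrib_left sum_divide_distrib add_divide_distrib distrib_left)
    also have "\<dots> = R" using x pos[of x] by (simp add: \<Delta>_def)
    finally show ?thesis using x R e0 S0[of x] by (auto simp: \<Delta>_def \<Phi>_def)
  qed
  then have \<Phi>im: "\<Phi> \<in> \<Delta> \<rightarrow> \<Delta>" by blast
  have convex: "convex \<Delta>"
    unfolding convex_def \<Delta>_def
    by (auto simp: sum.distrib simp flip: sum_distrib_left distrib_right)
  have "closed \<Delta>"
  proof -
    have "\<Delta> = (\<Inter>j. {x. 0 \<le> x $ j}) \<inter> (\<Inter>j\<in>-K. {x. x $ j = 0}) \<inter> {x. (\<Sum>i<n. x $ k i) = R}"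
      by (auto simp: \<Delta>_def)
    also have "closed \<dots>"
      by (intro closed_Int closed_INT ballI closed_Collect_le closed_Collect_eq continuous_intros)
    finally show ?thesis .
  qed
  moreover have "bounded \<Delta>"
  proof (rule boundedI)
    fix x assume x: "x \<in> \<Delta>"
    have "norm x \<le> (\<Sum>j\<in>UNIV. \<bar>x $ j\<bar>)" by (rule norm_le_l1_cart)
    also have "\<dots> = (\<Sum>j\<in>K. \<bar>x $ j\<bar>)" using x by (intro sum.mono_neutral_right) (auto simp: \<Delta>_def)
    also have "\<dots> = (\<Sum>i<n. \<bar>x $ k i\<bar>)" unfolding K_def using inj by (simp add: sum.reindex)
    also have "\<dots> = R" using x by (simp add: \<Delta>_def)
    finally show "norm x \<le> R" .
  qed
  ultimately have compact: "compact \<Delta>" by (simp add: compact_eq_bounded_closed)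
  have "(\<Sum>i<n. (axis (k 0) R :: real^'d) $ k i) = (\<Sum>i<n. if i = 0 then R else 0)"
    using inj_on_eq_iff[OF inj, of _ 0] n_pos by (intro sum.cong) (auto simp: axis_def)
  then have "axis (k 0) R \<in> \<Delta>" using R n_pos by (auto simp: \<Delta>_def axis_def K_def)
  then have ne: "\<Delta> \<noteq> {}" by blast
  obtain x where x: "x \<in> \<Delta>" "\<Phi> x = x"
    using brouwer[OF compact convex ne \<Phi>c \<Phi>im] .
  have x0: "0 \<le> sv x i" for i using x by (auto simp: \<Delta>_def sv_def)
  have fp: "R * e x i = S x * sv x i" if "i < n" for i
  proof -
    have "R * (x $ k i + e x i) / (R + S x) = x $ k i" using \<Phi>k[OF that, of x] x(2) by simp
    then show ?thesis using pos[of x] by (simp add: field_simps sv_def)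
  qed
  have "S x = 0"
  proof (rule ccontr)
    assume "S x \<noteq> 0"
    then have Sp: "0 < S x" using S0[of x] by linarith
    have "sv x i \<le> M (sv x) i" if "i < n" for i
    proof (cases "sv x i = 0")
      case False
      then have "0 < S x * sv x i" using Sp x0[of i] by simp
      then have "0 < R * e x i" using fp[OF that] by simp
      then have "0 < e x i" using R by (simp add: zero_less_mult_iff)
      then show ?thesis by (simp add: e_def)
    qed (simp add: M_nonneg[OF that])
    then have "sv x i = 0" if "i < n" for i using M_not_ge[of "sv x" i] x0 that by blast
    then show False using x(1) R by (auto simp: \<Delta>_def sv_def)
  qed
  then have "e x i = 0" if "i < n" for i using fp[OF that] R by simp
  then have "M (sv x) i \<le> sv x i" if "i < n" for i using that by (force simp: e_def max_def split: if_splits)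
  then show ?thesis using x0 x(1) by (intro exI[of _ "sv x"]) (auto simp: \<Delta>_def sv_def)
qed

text \<open>Averaging with the identity, instead of iterating \<open>M\<close>, at most halves a
  component in each step and so preserves positivity, even if \<open>M\<close> vanishes. It also
  makes strictness of the inequality spread from component to component.\<close>

primrec desc :: "(nat \<Rightarrow> real) \<Rightarrow> nat \<Rightarrow> nat \<Rightarrow> real" where
  "desc S 0 = S"
| "desc S (Suc k) = (\<lambda>i. (desc S k i + M (desc S k) i) / 2)"

text \<open>The average lies between \<open>M y\<close> and \<open>y\<close>, so by monotonicity its
  image lies below \<open>M y\<close>, hence below the average.\<close>

lemma desc_invariant:
  assumes S: "\<And>i. i < n \<Longrightarrow> M S i \<le> S i"
  shows "i < n \<Longrightarrow> M (desc S k) i \<le> desc S k i"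
proof (induction k arbitrary: i)
  case (Suc k)
  have "M (desc S (Suc k)) i \<le> M (desc S k) i"
    using Suc by (intro M_mono) (auto simp: field_simps)
  also have "\<dots> \<le> desc S (Suc k) i" using Suc.IH[OF Suc.prems] by (simp add: field_simps)
  finally show ?case .
qed (simp add: S)

lemma desc_step:
  assumes S: "\<And>i. i < n \<Longrightarrow> M S i \<le> S i" and "i < n"
  shows "M (desc S k) i \<le> desc S (Suc k) i" "desc S (Suc k) i \<le> desc S k i"
  using desc_invariant[OF S \<open>i < n\<close>, of k] by (auto simp: field_simps)

lemma desc_antimono:
  assumes S: "\<And>i. i < n \<Longrightarrow> M S i \<le> S i" and "i < n" "k \<le> l"
  shows "desc S l i \<le> desc S k i"
  using \<open>k \<le> l\<close> desc_step(2)[OF S \<open>i < n\<close>] by (rule lift_Suc_antimono_le[rotated]) 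

lemma desc_nonneg:
  assumes "\<And>i. i < n \<Longrightarrow> M S i \<le> S i" and i: "i < n" 
  shows "0 \<le> desc S k i"
  using desc_invariant[OF assms, of k] M_nonneg[OF i, of "desc S k"] by linarith

text \<open>The decreasing iterates converge, by continuity to a fixed point of \<open>M\<close>,
  and \<open>M_not_ge\<close> leaves only the origin.\<close>

lemma desc_tendsto_0:
  assumes S: "\<And>i. i < n \<Longrightarrow> M S i \<le> S i" and "i < n"
  shows "(\<lambda>k. desc S k i) \<longlonglongrightarrow> 0"
proof -
  have "\<exists>l. (\<lambda>k. desc S k i) \<longlonglongrightarrow> l" if i: "i < n" for i
  proof -
    have "decseq (\<lambda>k. desc S k i)" using desc_antimono[OF S i] by (auto simp: decseq_def)
    moreover have "\<forall>k. 0 \<le> desc S k i" using desc_nonneg[OF S i] by blast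
    ultimately show ?thesis using decseq_convergent[of "\<lambda>k. desc S k i" 0] by metis
  qed
  then obtain l where l: "\<And>i. i < n \<Longrightarrow> (\<lambda>k. desc S k i) \<longlonglongrightarrow> l i" by metis
  have fp: "M l i = l i" if i: "i < n" for i
  proof -
    have "(\<lambda>k. (desc S k i + M (desc S k) i) / 2) \<longlonglongrightarrow> (l i + M l i) / 2"
      by (intro tendsto_divide tendsto_add tendsto_const l i M_tendsto) auto
    moreover have "(\<lambda>k. desc S (Suc k) i) \<longlonglongrightarrow> l i" using l[OF i] by (rule LIMSEQ_Suc)
    ultimately have "(l i + M l i) / 2 = l i" using LIMSEQ_unique by fastforce
    then show ?thesis by simp
  qed
  have "0 \<le> l i" if i: "i < n" for i
    by (rule LIMSEQ_le_const[OF l[OF i]]) (use desc_nonneg[OF S i] in blast)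
  then have "l i = 0" using M_not_ge[of l i] fp \<open>i < n\<close> by simp
  then show ?thesis using l[OF \<open>i < n\<close>] by simp
qed

end

section \<open>Weakly decreasing paths and their strict improvement\<close>

context mixed_gains begin

text \<open>The parameter is the coordinate sum. Together with monotonicity this makes every
  component 1-Lipschitz, so continuity is automatic and all clauses survive pointwise limits, as the
  compactness argument requires.\<close>

definition subpath :: "real \<Rightarrow> (real \<Rightarrow> nat \<Rightarrow> real) \<Rightarrow> bool" where
  "subpath R p \<longleftrightarrow> (\<forall>r\<in>{0..R}. (\<forall>i<n. 0 \<le> p r i \<and> M (p r) i \<le> p r i) \<and> (\<Sum>i<n. p r i) = r) \<and>
     (\<forall>r r' i. 0 \<le> r \<longrightarrow> r \<le> r' \<longrightarrow> r' \<le> R \<longrightarrow> i < n \<longrightarrow> p r i \<le> p r' i)"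

lemma subpath_subset: "subpath R' p \<Longrightarrow> R \<le> R' \<Longrightarrow> subpath R p"
  unfolding subpath_def by (meson atLeastAtMost_iff order_trans)

text \<open>Consecutive iterates are joined by segments. A point \<open>c\<close> of segment
  \<open>k\<close> satisfies \<open>M c \<le> M (y k) \<le> y (Suc k) \<le> c\<close>, any two
  points of the polygon are comparable, and their sums fill the interval from 0 to \<open>R\<close>,
  so the sum can serve as parameter.\<close>

lemma exists_subpath:
  assumes S: "\<And>i. i < n \<Longrightarrow> M S i \<le> S i" and R: "(\<Sum>i<n. S i) = R"
  shows "\<exists>p. subpath R p"
proof -
  define y where "y = desc S"
  define c where "c = (\<lambda>k \<theta> i. (1 - \<theta>) * y (Suc k) i + \<theta> * y k i)"
  have ystep: "y (Suc k) i \<le> y k i" "M (y k) i \<le> y (Suc k) i" if "i < n" for k i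
    using desc_step[OF S that] by (auto simp: y_def)
  have yanti: "y l i \<le> y k i" if "i < n" "k \<le> l" for i k l
    using desc_antimono[OF S that] by (simp add: y_def)
  have y0: "0 \<le> y k i" if "i < n" for k i using desc_nonneg[OF S that] by (simp add: y_def)
  have clo: "y (Suc k) i \<le> c k \<theta> i" and chi: "c k \<theta> i \<le> y k i" if "i < n" "0 \<le> \<theta>" "\<theta> \<le> 1" for k \<theta> i
  proof -
    have eq: "c k \<theta> i = y (Suc k) i + \<theta> * (y k i - y (Suc k) i)" "c k \<theta> i = y k i - (1 - \<theta>) * (y k i - y (Suc k) i)"
      by (auto simp: c_def algebra_simps)
    show "y (Suc k) i \<le> c k \<theta> i" using that ystep(1)[OF that(1), of k] by (simp add: eq(1))
    show "c k \<theta> i \<le> y k i" using that ystep(1)[OF that(1), of k] by (simp add: eq(2))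
  qed
  have csub: "M (c k \<theta>) i \<le> c k \<theta> i" if "i < n" "0 \<le> \<theta>" "\<theta> \<le> 1" for k \<theta> i
  proof -
    have "M (c k \<theta>) i \<le> M (y k) i" using chi that by (intro M_mono) auto
    also have "\<dots> \<le> y (Suc k) i" by (rule ystep(2)[OF that(1)])
    also have "\<dots> \<le> c k \<theta> i" by (rule clo[OF that])
    finally show ?thesis .
  qed
  have chain: "(\<forall>i<n. c k \<theta> i \<le> c l \<eta> i) \<or> (\<forall>i<n. c l \<eta> i \<le> c k \<theta> i)"
    if "0 \<le> \<theta>" "\<theta> \<le> 1" "0 \<le> \<eta>" "\<eta> \<le> 1" for k \<theta> l \<eta>
  proof -
    consider "k < l" | "l < k" | "k = l" by linarith
    then show ?thesis
    proof cases
      case 1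
      then have "c l \<eta> i \<le> c k \<theta> i" if "i < n" for i
        using clo[of i \<theta> k] chi[of i \<eta> l] yanti[of i "Suc k" l] that \<open>0 \<le> \<theta>\<close> \<open>\<theta> \<le> 1\<close> \<open>0 \<le> \<eta>\<close> \<open>\<eta> \<le> 1\<close> by fastforce
      then show ?thesis by blast
    next
      case 2
      then have "c k \<theta> i \<le> c l \<eta> i" if "i < n" for i
        using clo[of i \<eta> l] chi[of i \<theta> k] yanti[of i "Suc l" k] that \<open>0 \<le> \<theta>\<close> \<open>\<theta> \<le> 1\<close> \<open>0 \<le> \<eta>\<close> \<open>\<eta> \<le> 1\<close> by fastforce
      then show ?thesis by blast
    next
      case 3
      have "c k \<theta>' i \<le> c k \<eta>' i" if "i < n" "\<theta>' \<le> \<eta>'" for i \<theta>' \<eta>'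
      proof -
        have "c k \<eta>' i - c k \<theta>' i = (\<eta>' - \<theta>') * (y k i - y (Suc k) i)" by (simp add: c_def algebra_simps)
        moreover have "0 \<le> \<dots>" using that ystep(1)[OF that(1), of k] by simp
        ultimately show ?thesis by linarith
      qed
      then show ?thesis using 3 by (meson linear)
    qed
  qed
  define T where "T = (\<lambda>k. \<Sum>i<n. y k i)"
  have T0: "T 0 = R" using R by (simp add: T_def y_def)
  have Tlim: "T \<longlonglongrightarrow> 0"
    unfolding T_def y_def using tendsto_sum[of "{..<n}" "\<lambda>i k. desc S k i" "\<lambda>_. 0" sequentially] desc_tendsto_0[OF S] by auto
  have ex: "\<exists>k \<theta>. 0 \<le> \<theta> \<and> \<theta> \<le> 1 \<and> (\<Sum>i<n. c k \<theta> i) = r" if r: "0 < r" "r \<le> R" for r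
  proof -
    have "\<exists>k. T k < r" using order_tendstoD(2)[OF Tlim r(1)] eventually_happens by fastforce
    then obtain k where "T k < r" "\<And>m. m < k \<Longrightarrow> \<not> T m < r" using exists_least_iff[of "\<lambda>k. T k < r"] by blast
    moreover from this obtain m where m: "k = Suc m" using T0 r by (cases k) auto
    ultimately have Tm: "T (Suc m) < r" "r \<le> T m" by (auto simp: not_less)
    define \<theta> where "\<theta> = (r - T (Suc m)) / (T m - T (Suc m))"
    have "0 \<le> \<theta>" "\<theta> \<le> 1" using Tm by (auto simp: \<theta>_def field_simps)
    moreover have "(\<Sum>i<n. c m \<theta> i) = (1 - \<theta>) * T (Suc m) + \<theta> * T m"
      by (simp add: c_def T_def sum.distrib sum_distrib_left)
    moreover have "\<dots> = T (Suc m) + \<theta> * (T m - T (Suc m))" by (simp add: algebra_simps)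
    moreover have "\<dots> = r" using Tm by (simp add: \<theta>_def)
    ultimately show ?thesis by metis
  qed
  then obtain kk tt where kt: "\<And>r. 0 < r \<Longrightarrow> r \<le> R \<Longrightarrow> 0 \<le> tt r \<and> tt r \<le> 1 \<and> (\<Sum>i<n. c (kk r) (tt r) i) = r"
    by metis
  define p where "p = (\<lambda>r i. if 0 < r then c (kk r) (tt r) i else 0)"
  have p0: "0 \<le> p r i" if "0 \<le> r" "r \<le> R" "i < n" for r i
    using that kt[of r] clo[of i "tt r" "kk r"] y0[of i "Suc (kk r)"] by (fastforce simp: p_def)
  have M0: "M (\<lambda>_. 0) i = 0" if "i < n" for i
    using that n_pos classK_zero[OF classKinf_classK[OF alpha]]
    by (auto simp: M_def Dalpha_def G_def gain_op_def gain_zero lessThan_empty_iff cong: image_cong_simp)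
  have "subpath R p"
    unfolding subpath_def
  proof (intro conjI ballI allI impI)
    fix r i assume r: "r \<in> {0..R}" and i: "i < n"
    show "0 \<le> p r i" using p0 r i by simp
    show "M (p r) i \<le> p r i"
    proof (cases "0 < r")
      case True
      then have "p r = c (kk r) (tt r)" by (auto simp: p_def)
      then show ?thesis using csub[OF i] kt[of r] True r by simp
    next
      case False
      then have "p r = (\<lambda>_. 0)" by (auto simp: p_def)
      then show ?thesis using M0[OF i] by simp
    qed
  next
    fix r assume r: "r \<in> {0..R}"
    then show "(\<Sum>i<n. p r i) = r" using kt[of r] by (cases "0 < r") (auto simp: p_def)
  next
    fix r r' i assume rr: "0 \<le> r" "r \<le> r'" "r' \<le> R" and i: "i < n"
    show "p r i \<le> p r' i"
    proof (cases "0 < r")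
      case False
      then show ?thesis using p0[of r' i] rr i by (simp add: p_def)
    next
      case True
      then have pr: "p r = c (kk r) (tt r)" "p r' = c (kk r') (tt r')" using rr by (auto simp: p_def)
      have k1: "0 \<le> tt r" "tt r \<le> 1" "(\<Sum>i<n. p r i) = r" using kt[of r] True rr by (auto simp: pr)
      have k2: "0 \<le> tt r'" "tt r' \<le> 1" "(\<Sum>i<n. p r' i) = r'" using kt[of r'] True rr by (auto simp: pr)
      show ?thesis
      proof (cases "\<forall>i<n. p r i \<le> p r' i")
        case False
        \<comment> \<open>Comparable the wrong way round although the sums satisfy
          \<open>r \<le> r'\<close>: then all components agree. So the arbitrary choice of
          \<open>kk\<close> and \<open>tt\<close> still gives a monotone path.\<close>
        then have le: "\<forall>i<n. p r' i \<le> p r i" using chain[OF k1(1,2) k2(1,2)] unfolding pr by blast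
        have "(\<Sum>j<n. p r j - p r' j) = r - r'" using k1 k2 by (simp add: sum_subtractf)
        moreover have "p r i - p r' i \<le> (\<Sum>j<n. p r j - p r' j)"
          using le i by (intro member_le_sum) auto
        ultimately show ?thesis using rr by linarith
      qed (use i in blast)
    qed
  qed
  then show ?thesis by blast
qed

text \<open>An increasing path up to one level need not extend beyond it, so the paths reaching higher and
  higher levels are combined by compactness (Tychonoff).\<close>

lemma exists_global_subpath:
  assumes "\<And>R. 0 < R \<Longrightarrow> \<exists>s. (\<forall>i<n. 0 \<le> s i \<and> M s i \<le> s i) \<and> (\<Sum>i<n. s i) = R"
  shows "\<exists>p. \<forall>R. subpath R p"
proof -
  \<comment> \<open>Nonnegative components with sum \<open>r\<close> are at most \<open>r\<close>; a
    negative parameter gets the single value 0.\<close>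
  define X where "X = (PiE UNIV (\<lambda>(r, i). {0..max 0 r}) :: (real \<times> nat \<Rightarrow> real) set)"
  have Xc: "compact X"
  proof -
    have "compactin (product_topology (\<lambda>_. euclidean) UNIV) X"
      unfolding X_def compactin_PiE by (auto simp: case_prod_unfold)
    then show ?thesis by (simp add: euclidean_product_topology)
  qed
  define A where "A = (\<lambda>m::nat. {f. subpath (real m) (\<lambda>r i. f (r, i))})"
  have ev: "continuous_on UNIV (\<lambda>f :: real \<times> nat \<Rightarrow> real. f z)" for z
    by (rule continuous_on_product_coordinates)
  \<comment> \<open>Each clause of \<open>subpath\<close> compares continuous functions of finitely
    many values of \<open>f\<close>, so \<open>A m\<close> is an intersection of closed
    sets.\<close>
  have Acl: "closed (A m)" for m
  proof -
    have imp: "closed {x. P \<longrightarrow> Q x}" if "P \<Longrightarrow> closed {x. Q x}"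
      for P and Q :: "(real \<times> nat \<Rightarrow> real) \<Rightarrow> bool"
      using that by (cases P) auto
    show ?thesis
      unfolding A_def subpath_def Ball_def
      by (intro closed_Collect_conj closed_Collect_all imp
            closed_Collect_le closed_Collect_eq continuous_on_const ev continuous_on_sum)
         (rule M_continuous_on, assumption, rule ev)
  qed
  have Ane: "X \<inter> A m \<noteq> {}" for m
  proof -
    \<comment> \<open>The level is \<open>m + 1\<close> because the hypothesis asks for a positive
      sum, also for \<open>m = 0\<close>.\<close>
    obtain S where S: "\<forall>i<n. 0 \<le> S i \<and> M S i \<le> S i" "(\<Sum>i<n. S i) = real m + 1"
      using assms[of "real m + 1"] by auto
    then obtain p where p: "subpath (real m + 1) p" using exists_subpath[of S "real m + 1"] by blast
    define f where "f = (\<lambda>(r, i). if 0 \<le> r \<and> r \<le> real m \<and> i < n then p r i else 0)"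
    have p0: "0 \<le> p r i" and ps: "(\<Sum>i<n. p r i) = r" if "0 \<le> r" "r \<le> real m" "i < n" for r i
      using p that by (auto simp: subpath_def)
    have "p r i \<le> r" if "0 \<le> r" "r \<le> real m" "i < n" for r i
      using member_le_sum[of i "{..<n}" "p r"] p0 ps[OF that] that by auto
    then have "f \<in> X" using p0 by (auto simp: X_def f_def)
    moreover have "f \<in> A m"
    proof -
      have Mf: "M (\<lambda>i. f (r, i)) i = M (p r) i" if "0 \<le> r" "r \<le> real m" "i < n" for r i
        using that by (intro antisym M_mono) (auto simp: f_def)
      show ?thesis using p unfolding A_def subpath_def by (auto simp: Mf) (auto simp: f_def)
    qed
    ultimately show ?thesis by blast
  qed
  have Adec: "A m' \<subseteq> A m" if "m \<le> m'" for m m'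
  proof -
    have "real m \<le> real m'" using that by simp
    then show ?thesis using subpath_subset[of "real m'" _ "real m"] unfolding A_def by blast
  qed
  have "X \<inter> \<Inter>(range A) \<noteq> {}"
  proof (rule compact_imp_fip[OF Xc])
    show "closed T" if "T \<in> range A" for T using that Acl by auto
    fix \<F> assume "finite \<F>" "\<F> \<subseteq> range A"
    then obtain I where I: "finite I" "\<F> = A ` I" using finite_subset_image by metis
    define m where "m = Max (insert 0 I)"
    have "A m \<subseteq> A k" if "k \<in> I" for k
      using I(1) that by (intro Adec) (simp add: m_def)
    then have "A m \<subseteq> \<Inter>\<F>" unfolding I(2) by blast
    then show "X \<inter> \<Inter>\<F> \<noteq> {}" using Ane[of m] by blast
  qed
  then obtain f where f: "\<And>m. f \<in> A m" by auto
  have "subpath R (\<lambda>r i. f (r, i))" for R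
  proof -
    obtain m :: nat where "R \<le> real m" using real_arch_simple by blast
    then show ?thesis using f[of m] subpath_subset[of "real m"] unfolding A_def by blast
  qed
  then show ?thesis by blast
qed

text \<open>Along an edge from \<open>k\<close> to \<open>l\<close> the bound
  \<open>\<gamma> k l (y l) \<le> M y k \<le> y k\<close> passes a zero from \<open>k\<close> to
  \<open>l\<close>, and every index can be reached.\<close>

lemma subinvariant_zero_propagates:
  assumes y: "\<And>i. i < n \<Longrightarrow> 0 \<le> y i \<and> M y i \<le> y i" and "i < n" "j < n" "y i = 0"
  shows "y j = 0"
proof -
  have "(i, j) \<in> {(i, j). i < n \<and> j < n \<and> \<not> zero_gain (\<gamma> i j)}\<^sup>*"
    using irred assms by (simp add: gain_irreducible_def)
  then show ?thesis
  proof (induction rule: rtrancl_induct)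
    case (step k l)
    then have kl: "k < n" "l < n" "classKinf (\<gamma> k l)" using gains[of k l] by auto
    have "\<gamma> k l (y l) \<le> M y k" using M_ge_gain[of k l y] y kl by blast
    also have "\<dots> \<le> 0" using y[OF kl(1)] step by simp
    finally show ?case using classK_pos[OF classKinf_classK[OF kl(3)], of "y l"] y[OF kl(2)] by force
  qed (rule \<open>y i = 0\<close>)
qed

lemma subpath_pos:
  assumes "subpath r p" "0 < r" "i < n"
  shows "0 < p r i"
proof (rule ccontr)
  assume *: "\<not> 0 < p r i"
  have p: "0 \<le> p r j \<and> M (p r) j \<le> p r j" if "j < n" for j
    using assms that by (auto simp: subpath_def)
  have "p r i = 0" using * p[OF assms(3)] by auto
  then have "p r j = 0" if "j < n" for j
    using subinvariant_zero_propagates[of "p r", OF p assms(3) that] by blast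
  then have "(\<Sum>j<n. p r j) = 0" by simp
  then show False using assms by (auto simp: subpath_def)
qed

text \<open>Since the sum equals \<open>r\<close>, some component is unbounded. The bound
  \<open>\<gamma> k l (p r l) \<le> p r k\<close> carries unboundedness backwards along the edges of
  the gain graph.\<close>

lemma subpath_unbounded:
  assumes p: "\<And>R. subpath R p" and i: "i < n"
  shows "\<exists>r\<ge>0. B < p r i"
proof -
  have p1: "0 \<le> p r j" "M (p r) j \<le> p r j" "(\<Sum>i<n. p r i) = r" if "j < n" "0 \<le> r" for r j
    using p[of r] that by (auto simp: subpath_def)
  have "\<exists>j<n. \<forall>B. \<exists>r\<ge>0. B < p r j"
  proof (rule ccontr)
    assume "\<not> ?thesis"
    then obtain B where B: "\<And>j r. j < n \<Longrightarrow> 0 \<le> r \<Longrightarrow> p r j \<le> B j" by (metis not_less)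
    define r where "r = \<bar>\<Sum>j<n. B j\<bar> + 1"
    have "r = (\<Sum>j<n. p r j)" using p1(3)[of 0 r] n_pos by (simp add: r_def)
    also have "\<dots> \<le> (\<Sum>j<n. B j)" using B by (intro sum_mono) (auto simp: r_def)
    finally show False by (simp add: r_def)
  qed
  then obtain j where j: "j < n" "\<And>B. \<exists>r\<ge>0. B < p r j" by blast
  have "(i, j) \<in> {(i, j). i < n \<and> j < n \<and> \<not> zero_gain (\<gamma> i j)}\<^sup>*"
    using irred i j by (simp add: gain_irreducible_def)
  then have "\<forall>B. \<exists>r\<ge>0. B < p r i"
  proof (induction rule: converse_rtrancl_induct)
    case base
    then show ?case using j by blast
  next
    case (step k l)
    then have kl: "k < n" "l < n" "classKinf (\<gamma> k l)" using gains[of k l] by auto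
    show ?case
    proof
      fix B :: real
      have "0 \<le> max 0 (B + 1)" by simp
      then obtain x where x: "0 \<le> x" "\<gamma> k l x = max 0 (B + 1)" using classKinf_surj[OF kl(3)] by blast
      obtain r where r: "0 \<le> r" "x < p r l" using step by blast
      have "\<gamma> k l x \<le> \<gamma> k l (p r l)" using gain_mono[OF kl(1,2) x(1)] r by simp
      also have "\<dots> \<le> M (p r) k" using M_ge_gain[of k l "p r"] kl p1 r by simp
      also have "\<dots> \<le> p r k" using p1 kl r by simp
      finally show "\<exists>r\<ge>0. B < p r k" using x r by (intro exI[of _ r]) auto
    qed
  qed
  then show ?thesis by blast
qed

text \<open>If averaging did not strictly enlarge the set of strict components, the remaining components
  \<open>A\<close> would carry a vector \<open>z\<close>, namely \<open>y\<close> restricted to \<open>A\<close>, with \<open>M z \<ge> z\<close>.\<close>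

lemma strict_components_grow:
  assumes y: "\<And>i. i < n \<Longrightarrow> 0 < y i \<and> M y i \<le> y i"
    and A: "A = {i. i < n \<and> M y i = y i}" "A \<noteq> {}"
    and y': "y' = (\<lambda>i. (y i + M y i) / 2)"
  shows "\<exists>i\<in>A. M y' i < y' i"
proof (rule ccontr)
  assume "\<not> ?thesis"
  then have stuck: "y i \<le> M y' i" if "i \<in> A" for i
    using that A y' by (auto simp: not_less)
  have y'le: "y' j \<le> y j" "0 < y' j" if "j < n" for j
    using y[OF that] M_nonneg[OF that, of y] by (auto simp: y')
  have y'less: "y' j < y j" if "j < n" "j \<notin> A" for j
    using y[OF that(1)] that by (auto simp: y' A)
  define z where "z = (\<lambda>i. if i \<in> A then y i else 0)"
  have z0: "0 \<le> z i" if "i < n" for i using y[OF that] by (auto simp: z_def)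
  have "z i \<le> M z i" if i: "i < n" for i
  proof (cases "i \<in> A")
    case False
    then show ?thesis using M_nonneg[OF i] by (simp add: z_def)
  next
    case True
    \<comment> \<open>Row \<open>i\<close> has not decreased although the components outside
      \<open>A\<close> did so strictly. In a sum row these therefore have zero gain; in a max row
      the maximum for \<open>y'\<close> is attained within \<open>A\<close> or is 0. Either way
      \<open>z\<close> already produces the full value of the row.\<close>
    have "M y i \<le> M y' i" using stuck[OF True] True by (simp add: A)
    then have Gle: "G y i \<le> G y' i"
      using D_less_iff[of "G y' i" "G y i"] G_nonneg[OF i] by (auto simp: M_def Dalpha_def split: if_splits)
    have "G y i \<le> G z i"
    proof (cases "i \<in> Isum")
      case sum: True
      have "\<gamma> i j (y j) = \<gamma> i j (z j)" if j: "j < n" for j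
      proof (cases "j \<in> A")
        case False
        have "zero_gain (\<gamma> i j)"
        proof (rule ccontr)
          assume "\<not> zero_gain (\<gamma> i j)"
          then have "\<gamma> i j (y' j) < \<gamma> i j (y j)"
            using gains[OF i j] classK_less[OF classKinf_classK, of "\<gamma> i j" "y' j" "y j"] y'less[OF j False] y'le[OF j] by auto
          moreover have "\<gamma> i k (y' k) \<le> \<gamma> i k (y k)" if "k < n" for k
            using gain_mono[OF i that] y'le[OF that] by auto
          ultimately have "(\<Sum>j<n. \<gamma> i j (y' j)) < (\<Sum>j<n. \<gamma> i j (y j))"
            using j by (intro sum_strict_mono_ex1) auto
          moreover have "(\<Sum>j<n. \<gamma> i j (y' j)) = G y' i" "(\<Sum>j<n. \<gamma> i j (y j)) = G y i"
            using sum y'le y by (auto simp: G_def gain_op_def max_def less_imp_le intro!: sum.cong)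
          ultimately show False using Gle by simp
        qed
        then show ?thesis using z0[OF j] y[OF j] by (auto simp: zero_gain_def)
      qed (simp add: z_def)
      then have "(\<Sum>j<n. \<gamma> i j (y j)) = (\<Sum>j<n. \<gamma> i j (z j))" by simp
      moreover have "(\<Sum>j<n. \<gamma> i j (z j)) = G z i" "(\<Sum>j<n. \<gamma> i j (y j)) = G y i"
        using sum z0 y by (auto simp: G_def gain_op_def max_def less_imp_le intro!: sum.cong)
      ultimately show ?thesis by simp
    next
      case mx: False
      have "Max ((\<lambda>j. \<gamma> i j (max 0 (y' j))) ` {..<n}) \<in> (\<lambda>j. \<gamma> i j (max 0 (y' j))) ` {..<n}"
        using n_pos by (intro Max_in) auto
      then obtain j where j: "j < n" "G y' i = \<gamma> i j (y' j)"
        using mx y'le by (force simp: G_def gain_op_def max_def)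
      have *: "G y i \<le> \<gamma> i j (y' j)" using Gle j by simp
      have **: "\<gamma> i j (y j) \<le> G y i" using G_ge_gain[OF i j(1), of y] y[OF j(1)] by simp
      show ?thesis
      proof (cases "j \<in> A")
        case True
        have "\<gamma> i j (y' j) \<le> \<gamma> i j (y j)" using gain_mono[OF i j(1)] y'le[OF j(1)] by simp
        also have "\<dots> = \<gamma> i j (z j)" using True by (simp add: z_def)
        also have "\<dots> \<le> G z i" using G_ge_gain[OF i j(1), of z] z0[OF j(1)] by simp
        finally show ?thesis using * by linarith
      next
        case False
        have "zero_gain (\<gamma> i j)"
        proof (rule ccontr)
          assume "\<not> zero_gain (\<gamma> i j)"
          then have "\<gamma> i j (y' j) < \<gamma> i j (y j)"
            using gains[OF i j(1)] classK_less[OF classKinf_classK, of "\<gamma> i j" "y' j" "y j"] y'less[OF j(1) False] y'le[OF j(1)] by auto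
          then show False using * ** by linarith
        qed
        then have "G y i \<le> 0" using * y'le[OF j(1)] by (auto simp: zero_gain_def)
        then show ?thesis using G_nonneg[OF i, of z] by linarith
      qed
    qed
    then have "M y i \<le> M z i"
      using D_le_iff[of "G y i" "G z i"] G_nonneg[OF i] by (auto simp: M_def Dalpha_def)
    then show ?thesis using True by (auto simp: z_def A)
  qed
  then have "z i = 0" if "i < n" for i using M_not_ge[of z i] z0 that by blast
  moreover obtain i where i: "i \<in> A" using A(2) by blast
  moreover have "i < n" using i A(1) by blast
  moreover have "z i = y i" using i by (simp add: z_def)
  ultimately show False using y[of i] by force
qed

text \<open>The set of components with equality loses at least one element in each step as long as
  it is nonempty, so \<open>n\<close> steps exhaust it.\<close>

lemma desc_strict:
  assumes y: "\<And>i. i < n \<Longrightarrow> 0 < y i \<and> M y i \<le> y i"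
  shows "i < n \<Longrightarrow> M (desc y n) i < desc y n i"
proof -
  define A where "A = (\<lambda>k. {i. i < n \<and> M (desc y k) i = desc y k i})"
  have inv: "M (desc y k) i \<le> desc y k i" if "i < n" for k i
    by (rule desc_invariant) (use y that in auto)
  have pos: "0 < desc y k i" if "i < n" for k i
  proof (induction k)
    case (Suc k)
    then show ?case using M_nonneg[OF that, of "desc y k"] by simp
  qed (use y that in simp)
  have sub: "A (Suc k) \<subseteq> A k" for k
  proof
    fix i assume i: "i \<in> A (Suc k)"
    then have "i < n" by (simp add: A_def)
    have "M (desc y (Suc k)) i \<le> M (desc y k) i"
      using inv \<open>i < n\<close> by (intro M_mono) (auto simp: field_simps)
    then show "i \<in> A k" using i inv[OF \<open>i < n\<close>, of k] by (simp add: A_def field_simps)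
  qed
  have fin: "finite (A k)" for k by (simp add: A_def)
  have "card (A k) \<le> n - k" for k
  proof (induction k)
    case 0
    have "card (A 0) \<le> card {..<n}" by (rule card_mono) (auto simp: A_def)
    then show ?case by simp
  next
    case (Suc k)
    show ?case
    proof (cases "A k = {}")
      case True
      then show ?thesis using sub[of k] by simp
    next
      case False
      obtain i where "i \<in> A k" "M (desc y (Suc k)) i < desc y (Suc k) i"
        using strict_components_grow[of "desc y k" "A k" "desc y (Suc k)"] inv pos False by (auto simp: A_def)
      moreover from this have "i \<notin> A (Suc k)" unfolding A_def by (simp del: desc.simps)
      ultimately have "A (Suc k) \<subset> A k" using sub[of k] by blast
      then have "card (A (Suc k)) < card (A k)" by (rule psubset_card_mono[OF fin])
      then show ?thesis using Suc by linarith
    qed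
  qed
  from this[of n] have "A n = {}" using fin by simp
  moreover assume "i < n"
  ultimately show ?thesis using inv[of i n] by (force simp: A_def)
qed

end

section \<open>Piecewise linear interpolation in logarithmic time\<close>

definition interp :: "(int \<Rightarrow> real) \<Rightarrow> real \<Rightarrow> real" where
  "interp s x = s \<lfloor>x\<rfloor> + (x - of_int \<lfloor>x\<rfloor>) * (s (\<lfloor>x\<rfloor> + 1) - s \<lfloor>x\<rfloor>)"

lemma interp_of_int [simp]: "interp s (of_int k) = s k"
  by (simp add: interp_def)

text \<open>Interpolation is exact on linear sequences, which reduces slope bounds to monotonicity
  of a tilted sequence.\<close>

lemma interp_diff_linear: "interp (\<lambda>k. s k - m * of_int k) x = interp s x - m * x"
  by (simp add: interp_def algebra_simps)

lemma interp_ge: "s \<lfloor>x\<rfloor> \<le> s (\<lfloor>x\<rfloor> + 1) \<Longrightarrow> s \<lfloor>x\<rfloor> \<le> interp s x"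
  unfolding interp_def by (simp add: of_int_floor_le)

lemma interp_le: "s \<lfloor>x\<rfloor> \<le> s (\<lfloor>x\<rfloor> + 1) \<Longrightarrow> interp s x \<le> s (\<lfloor>x\<rfloor> + 1)"
proof -
  assume *: "s \<lfloor>x\<rfloor> \<le> s (\<lfloor>x\<rfloor> + 1)"
  have "x - of_int \<lfloor>x\<rfloor> \<le> 1" by linarith
  from mult_right_mono[OF this, of "s (\<lfloor>x\<rfloor> + 1) - s \<lfloor>x\<rfloor>"] * show ?thesis by (simp add: interp_def)
qed

lemma interp_mono:
  fixes a b :: int
  assumes s: "\<And>k. a \<le> k \<Longrightarrow> k < b \<Longrightarrow> s k \<le> s (k + 1)" and "of_int a \<le> x" "x \<le> y" "y < of_int b"
  shows "interp s x \<le> interp s y"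
proof -
  have fl: "a \<le> \<lfloor>x\<rfloor>" "\<lfloor>x\<rfloor> \<le> \<lfloor>y\<rfloor>" "\<lfloor>y\<rfloor> < b"
    using assms by (auto simp: le_floor_iff floor_less_iff intro: floor_mono order_trans[OF of_int_floor_le])
  show ?thesis
  proof (cases "\<lfloor>x\<rfloor> = \<lfloor>y\<rfloor>")
    case True
    then show ?thesis using s[of "\<lfloor>x\<rfloor>"] fl \<open>x \<le> y\<close> by (auto simp: interp_def intro!: mult_right_mono)
  next
    case False
    have chain: "s (a + int m) \<le> s (a + int m')" if "m \<le> m'" "a + int m' \<le> b" for m m'
      using that
    proof (induction m' rule: dec_induct)
      case (step k)
      then show ?case using s[of "a + int k"] by (simp add: add.assoc) (smt (verit))
    qed simp
    have "interp s x \<le> s (\<lfloor>x\<rfloor> + 1)" using fl by (intro interp_le s) auto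
    also have "\<dots> \<le> s \<lfloor>y\<rfloor>"
      using chain[of "nat (\<lfloor>x\<rfloor> + 1 - a)" "nat (\<lfloor>y\<rfloor> - a)"] fl False by auto
    also have "\<dots> \<le> interp s y" using fl by (intro interp_ge s) auto
    finally show ?thesis .
  qed
qed

text \<open>Only finitely many slopes occur between the nodes \<open>a\<close> and \<open>b\<close>,
  and all are positive; their extrema bound the increments.\<close>

lemma interp_bilipschitz:
  fixes a b :: int
  assumes s: "\<And>k. s k < s (k + 1)"
  obtains c C where "0 < c" "0 < C"
    "\<And>x y. of_int a \<le> x \<Longrightarrow> x \<le> y \<Longrightarrow> y < of_int b \<Longrightarrow> c * (y - x) \<le> interp s y - interp s x \<and> interp s y - interp s x \<le> C * (y - x)"
proof -
  \<comment> \<open>The extra 1 keeps the set nonempty when there is no node interval between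
    \<open>a\<close> and \<open>b\<close>.\<close>
  define D where "D = insert 1 ((\<lambda>k. s (k + 1) - s k) ` {a..<b})"
  have D: "finite D" "D \<noteq> {}" "\<And>d. d \<in> D \<Longrightarrow> 0 < d" using s by (auto simp: D_def)
  define c where "c = Min D" define C where "C = Max D"
  have c: "0 < c" "\<And>k. a \<le> k \<Longrightarrow> k < b \<Longrightarrow> c \<le> s (k + 1) - s k"
  proof -
    show "0 < c" using D Min_in[of D] by (auto simp: c_def)
    show "c \<le> s (k + 1) - s k" if "a \<le> k" "k < b" for k
      unfolding c_def using that D(1) by (intro Min_le) (auto simp: D_def)
  qed
  have C: "0 < C" "\<And>k. a \<le> k \<Longrightarrow> k < b \<Longrightarrow> s (k + 1) - s k \<le> C"
  proof -
    show "0 < C" using D Max_in[of D] by (auto simp: C_def)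
    show "s (k + 1) - s k \<le> C" if "a \<le> k" "k < b" for k
      unfolding C_def using that D(1) by (intro Max_ge) (auto simp: D_def)
  qed
  have "c * (y - x) \<le> interp s y - interp s x \<and> interp s y - interp s x \<le> C * (y - x)"
    if xy: "of_int a \<le> x" "x \<le> y" "y < of_int b" for x y
  proof
    have "interp (\<lambda>k. s k - c * of_int k) x \<le> interp (\<lambda>k. s k - c * of_int k) y"
      using c(2) by (intro interp_mono[OF _ xy]) (auto simp: algebra_simps)
    then show "c * (y - x) \<le> interp s y - interp s x" by (simp add: interp_diff_linear algebra_simps)
    have "interp (\<lambda>k. C * of_int k - s k) x \<le> interp (\<lambda>k. C * of_int k - s k) y"
      using C(2) by (intro interp_mono[OF _ xy]) (auto simp: algebra_simps)
    moreover have "interp (\<lambda>k. C * of_int k - s k) z = C * z - interp s z" for z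
      by (simp add: interp_def algebra_simps)
    ultimately show "interp s y - interp s x \<le> C * (y - x)" by (simp add: algebra_simps)
  qed
  with c C that show ?thesis by blast
qed

definition bilip_path :: "(real \<Rightarrow> real) \<Rightarrow> bool" where
  "bilip_path \<sigma> \<longleftrightarrow> (\<forall>a b. 0 < a \<longrightarrow> a \<le> b \<longrightarrow> (\<exists>c C. 0 < c \<and> 0 < C \<and>
     (\<forall>x y. a \<le> x \<longrightarrow> x \<le> y \<longrightarrow> y \<le> b \<longrightarrow> c * (y - x) \<le> \<sigma> y - \<sigma> x \<and> \<sigma> y - \<sigma> x \<le> C * (y - x))))"

text \<open>Node \<open>k\<close> sits at \<open>exp k\<close>, so indices tending to minus infinity
  describe the behaviour at 0. As \<open>ln\<close> is itself bi-Lipschitz on compact subintervals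
  of the positive axis, the composition inherits the slope bounds.\<close>

lemma interp_ln_path:
  fixes s :: "int \<Rightarrow> real"
  assumes s: "\<And>k. s k < s (k + 1)" and pos: "\<And>k. 0 < s k"
    and lo: "\<And>e. 0 < e \<Longrightarrow> \<exists>k. s k < e" and hi: "\<And>B. \<exists>k. B < s k"
    and \<sigma>: "\<sigma> = (\<lambda>r. if r \<le> 0 then 0 else interp s (ln r))"
  shows "classKinf \<sigma>" "bilip_path \<sigma>"
proof -
  have bl: "\<exists>c C. 0 < c \<and> 0 < C \<and> (\<forall>x y. a \<le> x \<longrightarrow> x \<le> y \<longrightarrow> y \<le> b \<longrightarrow> c * (y - x) \<le> \<sigma> y - \<sigma> x \<and> \<sigma> y - \<sigma> x \<le> C * (y - x))"
    if ab: "0 < a" "a \<le> b" for a b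
  proof -
    obtain c C where cC: "0 < c" "0 < C" "\<And>x y. of_int \<lfloor>ln a\<rfloor> \<le> x \<Longrightarrow> x \<le> y \<Longrightarrow> y < of_int (\<lfloor>ln b\<rfloor> + 1) \<Longrightarrow>
        c * (y - x) \<le> interp s y - interp s x \<and> interp s y - interp s x \<le> C * (y - x)"
      using interp_bilipschitz[of s "\<lfloor>ln a\<rfloor>" "\<lfloor>ln b\<rfloor> + 1"] s by blast
    have "(c / b) * (y - x) \<le> \<sigma> y - \<sigma> x \<and> \<sigma> y - \<sigma> x \<le> (C / a) * (y - x)" if xy: "a \<le> x" "x \<le> y" "y \<le> b" for x y
    proof -
      have p: "0 < x" "0 < y" "0 < b" using xy ab by auto
      have lnxy: "of_int \<lfloor>ln a\<rfloor> \<le> ln x" "ln x \<le> ln y" "ln y < of_int (\<lfloor>ln b\<rfloor> + 1)"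
      proof -
        have "ln a \<le> ln x" "ln y \<le> ln b" using xy p ab by auto
        then show "of_int \<lfloor>ln a\<rfloor> \<le> ln x" "ln y < of_int (\<lfloor>ln b\<rfloor> + 1)" by linarith+
        show "ln x \<le> ln y" using xy p by simp
      qed
      have up: "ln y - ln x \<le> (y - x) / a"
      proof -
        have "ln y - ln x = ln (y / x)" using p by (simp add: ln_div)
        also have "\<dots> \<le> y / x - 1" using p by (intro ln_le_minus_one) auto
        also have "\<dots> = (y - x) / x" using p by (simp add: field_simps)
        also have "\<dots> \<le> (y - x) / a" using xy ab by (intro divide_left_mono) auto
        finally show ?thesis .
      qed
      have low: "(y - x) / b \<le> ln y - ln x"
      proof -
        have "ln x - ln y = ln (x / y)" using p by (simp add: ln_div)
        also have "\<dots> \<le> x / y - 1" using p by (intro ln_le_minus_one) auto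
        also have "\<dots> = - ((y - x) / y)" using p by (simp add: field_simps)
        finally have "(y - x) / y \<le> ln y - ln x" by simp
        moreover have "(y - x) / b \<le> (y - x) / y" using xy p by (intro divide_left_mono) auto
        ultimately show ?thesis by linarith
      qed
      have \<sigma>xy: "\<sigma> y - \<sigma> x = interp s (ln y) - interp s (ln x)" using p by (simp add: \<sigma>)
      have "c * ((y - x) / b) \<le> c * (ln y - ln x)" using low cC by (intro mult_left_mono) auto
      moreover have "C * (ln y - ln x) \<le> C * ((y - x) / a)" using up cC by (intro mult_left_mono) auto
      ultimately show ?thesis using cC(3)[OF lnxy] unfolding \<sigma>xy by simp
    qed
    then show ?thesis using cC ab by (intro exI[of _ "c / b"] exI[of _ "C / a"]) auto
  qed
  then show "bilip_path \<sigma>" unfolding bilip_path_def by blast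
  have low: "s \<lfloor>ln r\<rfloor> \<le> \<sigma> r" if "0 < r" for r
    using that interp_ge[of s "ln r"] s[of "\<lfloor>ln r\<rfloor>"] by (simp add: \<sigma>)
  have \<sigma>pos: "0 < \<sigma> r" if "0 < r" for r using low[OF that] pos[of "\<lfloor>ln r\<rfloor>"] by linarith
  have less: "\<sigma> x < \<sigma> y" if xy: "0 \<le> x" "x < y" for x y
  proof (cases "x = 0")
    case True
    then show ?thesis using \<sigma>pos[of y] xy by (simp add: \<sigma>)
  next
    case False
    then obtain c where "0 < c" "c * (y - x) \<le> \<sigma> y - \<sigma> x" using bl[of x y] xy by auto
    then show ?thesis using xy by (smt (verit) mult_pos_pos)
  qed
  have \<sigma>exp: "\<sigma> (exp (of_int k)) = s k" for k by (simp add: \<sigma>)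
  have "classK \<sigma>"
    unfolding classK_def
  proof (intro conjI)
    show "\<sigma> 0 = 0" by (simp add: \<sigma>)
    show "strict_mono_on {0..} \<sigma>" using less by (intro strict_mono_onI) auto
    show "continuous_on {0..} \<sigma>"
      unfolding continuous_on_eq_continuous_within
    proof
      fix x :: real assume x: "x \<in> {0..}"
      show "continuous (at x within {0..}) \<sigma>"
      proof (cases "x = 0")
        case True
        show ?thesis unfolding continuous_within_eps_delta
        proof (intro allI impI)
          fix e :: real assume "0 < e"
          then obtain k where k: "s k < e" using lo by blast
          have "dist (\<sigma> y) (\<sigma> x) < e" if "y \<in> {0..}" "dist y x < exp (of_int k)" for y
          proof -
            have y: "0 \<le> y" "y < exp (of_int k)" using that True by (auto simp: dist_real_def)
            have "\<sigma> y < \<sigma> (exp (of_int k))" by (rule less[OF y])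
            moreover have "0 \<le> \<sigma> y" using \<sigma>pos[of y] y by (cases "y = 0") (auto simp: \<sigma>)
            moreover have "\<sigma> x = 0" using True by (simp add: \<sigma>)
            ultimately show ?thesis using k \<sigma>exp[of k] by (simp add: dist_real_def)
          qed
          then show "\<exists>d>0. \<forall>y\<in>{0..}. dist y x < d \<longrightarrow> dist (\<sigma> y) (\<sigma> x) < e"
            by (intro exI[of _ "exp (of_int k)"]) auto
        qed
      next
        case False
        then have x: "0 < x" using x by simp
        obtain C where C: "0 < C" "\<And>u v. x / 2 \<le> u \<Longrightarrow> u \<le> v \<Longrightarrow> v \<le> 2 * x \<Longrightarrow> \<sigma> v - \<sigma> u \<le> C * (v - u)"
          using bl[of "x/2" "2*x"] x by auto
        have "C-lipschitz_on {x/2<..<2*x} \<sigma>"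
        proof (rule lipschitz_on_leI)
          fix u v assume "u \<in> {x/2<..<2*x}" "v \<in> {x/2<..<2*x}" "u \<le> v"
          then have "0 \<le> \<sigma> v - \<sigma> u" "\<sigma> v - \<sigma> u \<le> C * (v - u)"
            using C(2)[of u v] less[of u v] x by (cases "u = v"; auto)+
          then show "dist (\<sigma> u) (\<sigma> v) \<le> C * dist u v" using \<open>u \<le> v\<close> by (simp add: dist_real_def)
        qed (use C in auto)
        then have "continuous_on {x/2<..<2*x} \<sigma>" by (rule lipschitz_on_continuous_on)
        then have "isCont \<sigma> x" using x by (subst (asm) continuous_on_eq_continuous_at) auto
        then show ?thesis by (rule continuous_at_imp_continuous_within)
      qed
    qed
  qed
  moreover have "filterlim \<sigma> at_top at_top"
    unfolding filterlim_at_top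
  proof
    fix Z
    obtain k where k: "Z < s k" using hi by blast
    show "\<forall>\<^sub>F x in at_top. Z \<le> \<sigma> x"
      using eventually_gt_at_top[of "exp (of_int k)"]
    proof eventually_elim
      case (elim x)
      have "\<sigma> (exp (of_int k)) < \<sigma> x" by (rule less[OF _ elim]) simp
      then show ?case using k \<sigma>exp[of k] by simp
    qed
  qed
  ultimately show "classKinf \<sigma>" by (simp add: classKinf_def)
qed

text \<open>The lower derivative bound of an Omega-path in integrated form: a statement about
  increments applies also where the inverse has no derivative.\<close>

definition slope_below :: "(real \<Rightarrow> real) \<Rightarrow> bool" where
  "slope_below \<tau> \<longleftrightarrow> (\<forall>a b. 0 < a \<longrightarrow> a \<le> b \<longrightarrow> (\<exists>c>0. \<forall>x y. a \<le> x \<longrightarrow> x \<le> y \<longrightarrow> y \<le> b \<longrightarrow> c * (y - x) \<le> \<tau> y - \<tau> x))"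

lemma Kinv_bilip:
  assumes K: "classKinf \<sigma>" and bl: "bilip_path \<sigma>"
  shows "locLip {0<..} (Kinv \<sigma>)" "slope_below (Kinv \<sigma>)"
proof -
  note K' = classKinf_classK[OF Kinv_classKinf[OF K]]
  have main: "\<exists>c C. 0 < c \<and> 0 < C \<and> (\<forall>u v. a \<le> u \<longrightarrow> u \<le> v \<longrightarrow> v \<le> b \<longrightarrow>
      c * (v - u) \<le> Kinv \<sigma> v - Kinv \<sigma> u \<and> Kinv \<sigma> v - Kinv \<sigma> u \<le> C * (v - u))" if ab: "0 < a" "a \<le> b" for a b
  proof -
    have "0 < Kinv \<sigma> a" "Kinv \<sigma> a \<le> Kinv \<sigma> b" using ab by (auto intro: classK_pos[OF K'] classK_le[OF K'])
    then obtain c C where cC: "0 < c" "0 < C" "\<And>x y. Kinv \<sigma> a \<le> x \<Longrightarrow> x \<le> y \<Longrightarrow> y \<le> Kinv \<sigma> b \<Longrightarrow>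
        c * (y - x) \<le> \<sigma> y - \<sigma> x \<and> \<sigma> y - \<sigma> x \<le> C * (y - x)"
      using bl unfolding bilip_path_def by metis
    have "(1 / C) * (v - u) \<le> Kinv \<sigma> v - Kinv \<sigma> u \<and> Kinv \<sigma> v - Kinv \<sigma> u \<le> (1 / c) * (v - u)"
      if uv: "a \<le> u" "u \<le> v" "v \<le> b" for u v
    proof -
      have "Kinv \<sigma> a \<le> Kinv \<sigma> u" "Kinv \<sigma> u \<le> Kinv \<sigma> v" "Kinv \<sigma> v \<le> Kinv \<sigma> b"
        using uv ab by (auto intro: classK_le[OF K'])
      from cC(3)[OF this] show ?thesis
        using cC(1,2) uv ab by (simp add: Kinv_Kinf[OF K] field_simps)
    qed
    then show ?thesis using cC by (intro exI[of _ "1 / C"] exI[of _ "1 / c"]) auto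
  qed
  then show "slope_below (Kinv \<sigma>)" unfolding slope_below_def by meson
  show "locLip {0<..} (Kinv \<sigma>)"
    unfolding locLip_def
  proof
    fix \<xi> :: real assume "\<xi> \<in> {0<..}"
    then have \<xi>: "0 < \<xi>" by simp
    then obtain C where C: "0 < C" "\<And>u v. \<xi> / 2 \<le> u \<Longrightarrow> u \<le> v \<Longrightarrow> v \<le> 2 * \<xi> \<Longrightarrow> Kinv \<sigma> v - Kinv \<sigma> u \<le> C * (v - u)"
      using main[of "\<xi>/2" "2*\<xi>"] by auto
    have le: "dist (Kinv \<sigma> u) (Kinv \<sigma> v) \<le> C * dist u v" if "\<xi> / 2 \<le> u" "u \<le> v" "v \<le> 2 * \<xi>" for u v
      using C(2)[OF that] classK_le[OF K', of u v] that \<xi> by (simp add: dist_real_def)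
    have "\<forall>a\<in>{0<..} \<inter> ball \<xi> (\<xi> / 2). \<forall>b\<in>{0<..} \<inter> ball \<xi> (\<xi> / 2). dist (Kinv \<sigma> a) (Kinv \<sigma> b) \<le> C * dist a b"
    proof (intro ballI)
      fix u v assume "u \<in> {0<..} \<inter> ball \<xi> (\<xi> / 2)" "v \<in> {0<..} \<inter> ball \<xi> (\<xi> / 2)"
      then have "\<xi> / 2 \<le> u" "u \<le> 2 * \<xi>" "\<xi> / 2 \<le> v" "v \<le> 2 * \<xi>" by (auto simp: dist_real_def abs_if split: if_splits)
      then show "dist (Kinv \<sigma> u) (Kinv \<sigma> v) \<le> C * dist u v"
        using le[of u v] le[of v u] by (cases "u \<le> v") (auto simp: dist_commute)
    qed
    then show "\<exists>\<delta>>0. \<exists>L. \<forall>a\<in>{0<..} \<inter> ball \<xi> \<delta>. \<forall>b\<in>{0<..} \<inter> ball \<xi> \<delta>. dist (Kinv \<sigma> a) (Kinv \<sigma> b) \<le> L * dist a b"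
      using half_gt_zero[OF \<xi>] by blast
  qed
qed

section \<open>From the strict path to nodes and back to a bi-Lipschitz path\<close>

context mixed_gains begin

lemma subpath_continuous:
  assumes p: "\<And>R. subpath R p" and i: "i < n"
  shows "continuous_on {0..} (\<lambda>r. p r i)"
proof -
  have "1-lipschitz_on {0..} (\<lambda>r. p r i)"
  proof (rule lipschitz_on_leI)
    fix x y :: real assume xy: "x \<in> {0..}" "y \<in> {0..}" "x \<le> y"
    have mono: "p x j \<le> p y j" if "j < n" for j using p[of y] xy that by (auto simp: subpath_def)
    have "p y i - p x i \<le> (\<Sum>j<n. p y j - p x j)" using mono i by (intro member_le_sum) auto
    also have "\<dots> = y - x" using p[of y] xy by (simp add: sum_subtractf subpath_def)
    finally show "dist (p x i) (p y i) \<le> 1 * dist x y" using mono[OF i] xy by (simp add: dist_real_def)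
  qed simp
  then show ?thesis by (rule lipschitz_on_continuous_on)
qed

lemma desc_mono: "(\<And>j. j < n \<Longrightarrow> s j \<le> t j) \<Longrightarrow> i < n \<Longrightarrow> desc s k i \<le> desc t k i"
  by (induction k arbitrary: i) (auto intro!: divide_right_mono add_mono M_mono)

lemma desc_continuous_on:
  assumes "\<And>j. j < n \<Longrightarrow> continuous_on S (\<lambda>z. s z j)"
  shows "i < n \<Longrightarrow> continuous_on S (\<lambda>z. desc (s z) k i)"
  by (induction k arbitrary: i) (auto intro!: assms continuous_intros M_continuous_on)

lemma desc_ge: "i < n \<Longrightarrow> s i / 2 ^ k \<le> desc s k i"
proof (induction k)
  case (Suc k)
  then show ?case using M_nonneg[of i "desc s k"] by (simp add: field_simps add_increasing2)
qed simp

lemma exists_strict_path: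
  fixes k :: "nat \<Rightarrow> 'd::finite"
  assumes inj: "inj_on k {..<n}"
  obtains q :: "real \<Rightarrow> nat \<Rightarrow> real" where "\<And>r i. 0 < r \<Longrightarrow> i < n \<Longrightarrow> 0 < q r i \<and> M (q r) i < q r i"
    "\<And>r r' i. 0 \<le> r \<Longrightarrow> r \<le> r' \<Longrightarrow> i < n \<Longrightarrow> q r i \<le> q r' i"
    "\<And>i. i < n \<Longrightarrow> continuous_on {0..} (\<lambda>r. q r i)"
    "\<And>i B. i < n \<Longrightarrow> \<exists>r\<ge>0. B < q r i"
proof -
  obtain p where p: "\<And>R. subpath R p"
    using exists_global_subpath exists_subinvariant_of_sum[OF inj] by blast
  define q where "q = (\<lambda>r. desc (p r) n)"
  have p1: "0 < p r i \<and> M (p r) i \<le> p r i" if "0 < r" "i < n" for r i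
    using subpath_pos[OF p that] p[of r] that by (auto simp: subpath_def)
  show ?thesis
  proof (rule that[of q])
    show "0 < q r i \<and> M (q r) i < q r i" if "0 < r" "i < n" for r i
    proof
      have "0 < p r i / 2 ^ n" using p1[OF that] by simp
      also have "\<dots> \<le> q r i" unfolding q_def by (rule desc_ge[OF that(2)])
      finally show "0 < q r i" .
      show "M (q r) i < q r i" unfolding q_def by (rule desc_strict) (use p1 that in auto)
    qed
    show "q r i \<le> q r' i" if "0 \<le> r" "r \<le> r'" "i < n" for r r' i
      unfolding q_def using p[of r'] that by (intro desc_mono) (auto simp: subpath_def)
    show "continuous_on {0..} (\<lambda>r. q r i)" if "i < n" for i
      unfolding q_def using that by (intro desc_continuous_on subpath_continuous p)
    show "\<exists>r\<ge>0. B < q r i" if "i < n" for i B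
    proof -
      obtain r where r: "0 \<le> r" "B * 2 ^ n < p r i" using subpath_unbounded[OF p \<open>i < n\<close>] by blast
      have "B < p r i / 2 ^ n" using r by (simp add: field_simps)
      also have "\<dots> \<le> q r i" unfolding q_def by (rule desc_ge[OF \<open>i < n\<close>])
      finally show ?thesis using r by blast
    qed
  qed
qed

text \<open>The nodes are so dense that \<open>M\<close> at the next node is still below the current
  one; by monotonicity this will cover every point in between. The admissible step is a positive
  continuous function \<open>\<delta>\<close> of the position.\<close>

lemma exists_ascending_sequence:
  fixes k :: "nat \<Rightarrow> 'd::finite"
  assumes inj: "inj_on k {..<n}"
  obtains t :: "nat \<Rightarrow> nat \<Rightarrow> real" where
    "\<And>m i. i < n \<Longrightarrow> 0 < t m i \<and> t m i \<le> t (Suc m) i \<and> M (t (Suc m)) i < t m i"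
    "\<And>i B. i < n \<Longrightarrow> \<exists>m. B < t m i"
proof -
  obtain q :: "real \<Rightarrow> nat \<Rightarrow> real" where q1: "\<And>r i. 0 < r \<Longrightarrow> i < n \<Longrightarrow> 0 < q r i \<and> M (q r) i < q r i"
    and q2: "\<And>r r' i. 0 \<le> r \<Longrightarrow> r \<le> r' \<Longrightarrow> i < n \<Longrightarrow> q r i \<le> q r' i"
    and q3: "\<And>i. i < n \<Longrightarrow> continuous_on {0..} (\<lambda>r. q r i)"
    and q4: "\<And>i B. i < n \<Longrightarrow> \<exists>r\<ge>0. B < q r i"
    using exists_strict_path[OF inj] by blast
  define P where "P = (\<lambda>r e. 0 < r \<longrightarrow> 0 \<le> e \<longrightarrow> (\<forall>i<n. M (q (r + e)) i < q r i))"
  have Mq: "M (q x) i \<le> M (q y) i" if "0 \<le> x" "x \<le> y" "i < n" for x y i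
    using q2 that by (intro M_mono) auto
  have Pmono: "P r e'" if "P r e" "0 < e'" "e' \<le> e" for r e e'
    unfolding P_def
  proof (intro impI allI)
    fix i assume i: "0 < r" "0 \<le> e'" "i < n"
    have "M (q (r + e')) i \<le> M (q (r + e)) i" using that i by (intro Mq) auto
    also have "\<dots> < q r i" using that i by (auto simp: P_def)
    finally show "M (q (r + e')) i < q r i" .
  qed
  have Ploc: "\<exists>e>0. \<forall>r\<in>{a..b}. P r e" if ab: "0 < a" "a \<le> b" for a b
  proof -
    have one: "\<exists>e>0. \<forall>r\<in>{a..b}. M (q (r + e)) i < q r i" if i: "i < n" for i
    proof -
      have Mc: "continuous_on {0..} (\<lambda>r. M (q r) i)" by (intro M_continuous_on q3 i)
      have "continuous_on {a..b} (\<lambda>r. q r i - M (q r) i)"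
        by (intro continuous_on_diff continuous_on_subset[OF q3[OF i]] continuous_on_subset[OF Mc]) (use ab in auto)
      then obtain r0 where r0: "r0 \<in> {a..b}" "\<And>r. r \<in> {a..b} \<Longrightarrow> q r0 i - M (q r0) i \<le> q r i - M (q r) i"
        using continuous_attains_inf[of "{a..b}" "\<lambda>r. q r i - M (q r) i"] ab by auto
      have gap: "0 < q r0 i - M (q r0) i" using q1[of r0 i] r0 ab i by auto
      \<comment> \<open>Enlarged to the right by 1, so that \<open>r + e\<close> remains inside for
        steps \<open>e \<le> 1\<close>.\<close>
      have "uniformly_continuous_on {a..b+1} (\<lambda>r. M (q r) i)"
        by (intro compact_uniformly_continuous continuous_on_subset[OF Mc]) (use ab in auto)
      then obtain d where d: "0 < d" "\<And>x y. x \<in> {a..b+1} \<Longrightarrow> y \<in> {a..b+1} \<Longrightarrow> dist y x < d \<Longrightarrow> dist (M (q y) i) (M (q x) i) < q r0 i - M (q r0) i"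
        using gap unfolding uniformly_continuous_on_def by meson
      define e where "e = min 1 (d / 2)"
      have e: "0 < e" "e \<le> 1" "e < d" using d by (auto simp: e_def)
      have "M (q (r + e)) i < q r i" if r: "r \<in> {a..b}" for r
      proof -
        have "dist (M (q (r + e)) i) (M (q r) i) < q r0 i - M (q r0) i"
          using r e by (intro d(2)) (auto simp: dist_real_def)
        then show ?thesis using r0(2)[OF r] by (simp add: dist_real_def abs_less_iff)
      qed
      then show ?thesis using e by blast
    qed
    then obtain e where e: "\<And>i. i < n \<Longrightarrow> 0 < e i" "\<And>i r. i < n \<Longrightarrow> r \<in> {a..b} \<Longrightarrow> M (q (r + e i)) i < q r i"
      by metis
    define e0 where "e0 = Min (e ` {..<n})"
    have e0: "0 < e0" "\<And>i. i < n \<Longrightarrow> e0 \<le> e i" using e n_pos by (auto simp: e0_def Min_gr_iff lessThan_empty_iff)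
    have "P r e0" if r: "r \<in> {a..b}" for r
      unfolding P_def
    proof (intro impI allI)
      fix i assume i: "0 < r" "0 \<le> e0" "i < n"
      have "M (q (r + e0)) i \<le> M (q (r + e i)) i" using e0 i by (intro Mq) auto
      also have "\<dots> < q r i" using e(2)[OF i(3) r] .
      finally show "M (q (r + e0)) i < q r i" .
    qed
    then show ?thesis using e0 by blast
  qed
  obtain \<delta> where \<delta>: "posdef \<delta>" "\<And>r. 0 < r \<Longrightarrow> P r (\<delta> r)" "\<And>r s. \<bar>\<delta> r - \<delta> s\<bar> \<le> \<bar>r - s\<bar>"
    by (rule posdef_minorant[of P], erule Pmono, assumption, assumption, erule Ploc, assumption, blast)
  have \<delta>pos: "0 < \<delta> r" if "0 < r" for r using \<delta>(1) that unfolding posdef_def by (metis less_eq_real_def order_less_irrefl)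
  define r where "r = rec_nat 1 (\<lambda>_ x. x + \<delta> x)"
  have r0: "r 0 = 1" and rS: "r (Suc m) = r m + \<delta> (r m)" for m by (auto simp: r_def)
  have r1: "1 \<le> r m" for m
    by (induction m) (auto simp: r0 rS intro!: add_increasing2 less_imp_le[OF \<delta>pos])
  have rpos: "0 < r m" for m using r1[of m] by linarith
  have rinc: "r m \<le> r (Suc m)" for m using \<delta>pos[OF rpos[of m]] by (simp add: rS)
  have incr: "incseq r" using rinc by (simp add: incseq_SucI)
  \<comment> \<open>A bounded sequence of positions would converge to some \<open>l \<ge> 1\<close>,
    and its steps would force \<open>\<delta> l = 0\<close>.\<close>
  have runb: "\<exists>m. B < r m" for B
  proof (rule ccontr)
    assume "\<not> ?thesis"
    then have "\<forall>m. r m \<le> B" by (simp add: not_less)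
    then obtain l where l: "r \<longlonglongrightarrow> l" using incseq_convergent[OF incr] by blast
    have "1 \<le> l" by (rule LIMSEQ_le_const[OF l]) (use r1 in blast)
    have "continuous_on UNIV \<delta>"
      by (rule lipschitz_on_continuous_on[of 1]) (auto intro!: lipschitz_onI simp: dist_real_def \<delta>)
    then have "(\<lambda>m. \<delta> (r m)) \<longlonglongrightarrow> \<delta> l"
      using l by (auto simp: continuous_on_eq_continuous_at intro: isCont_tendsto_compose)
    moreover have "(\<lambda>m. r (Suc m) - r m) \<longlonglongrightarrow> l - l" by (intro tendsto_diff LIMSEQ_Suc l)
    ultimately have "\<delta> l = 0" using LIMSEQ_unique by (simp add: rS)
    then show False using \<delta>pos[of l] \<open>1 \<le> l\<close> by simp
  qed
  show ?thesis
  proof (rule that[of "\<lambda>m. q (r m)"])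
    show "0 < q (r m) i \<and> q (r m) i \<le> q (r (Suc m)) i \<and> M (q (r (Suc m))) i < q (r m) i" if "i < n" for m i
      using q1[OF rpos that, of m] q2[of "r m" "r (Suc m)" i] rpos[of m] rinc[of m] that \<delta>(2)[OF rpos[of m]] \<delta>pos[OF rpos[of m]]
      by (auto simp: P_def rS)
    show "\<exists>m. B < q (r m) i" if "i < n" for i B
    proof -
      obtain x where x: "0 \<le> x" "B < q x i" using q4[OF \<open>i < n\<close>] by blast
      obtain m where "x < r m" using runb by blast
      then have "q x i \<le> q (r m) i" using x \<open>i < n\<close> by (intro q2) auto
      then show ?thesis using x by (intro exI[of _ m]) linarith
    qed
  qed
qed

text \<open>The ascending nodes may grow only weakly. Factors \<open>1 - \<epsilon> m\<close> that
  increase strictly with \<open>m\<close> repair this within the gap left by \<open>M\<close>. Below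
  node 0 the averaged iteration continues the sequence down to the origin.\<close>

lemma exists_two_sided_sequence:
  fixes k :: "nat \<Rightarrow> 'd::finite"
  assumes inj: "inj_on k {..<n}"
  obtains s :: "int \<Rightarrow> nat \<Rightarrow> real" where
    "\<And>m i. i < n \<Longrightarrow> 0 < s m i \<and> s m i < s (m + 1) i \<and> M (s (m + 1)) i < s m i"
    "\<And>i B. i < n \<Longrightarrow> \<exists>m. B < s m i" "\<And>i e. i < n \<Longrightarrow> 0 < e \<Longrightarrow> \<exists>m. s m i < e"
proof -
  obtain t :: "nat \<Rightarrow> nat \<Rightarrow> real" where
    t: "\<And>m i. i < n \<Longrightarrow> 0 < t m i \<and> t m i \<le> t (Suc m) i \<and> M (t (Suc m)) i < t m i"
    and tunb: "\<And>i B. i < n \<Longrightarrow> \<exists>m. B < t m i"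
    using exists_ascending_sequence[OF inj] by blast
  have "\<exists>E. 0 < E \<and> E < 1 \<and> (\<forall>i<n. M (t (Suc m)) i < (1 - E) * t m i)" for m
  proof -
    \<comment> \<open>Half of the relative gap between \<open>M (t (Suc m)) i\<close> and
      \<open>t m i\<close>, so that the inequality remains strict after shrinking
      \<open>t m\<close>.\<close>
    define f where "f = (\<lambda>i. (t m i - M (t (Suc m)) i) / (2 * t m i))"
    define E where "E = Min (f ` {..<n})"
    have f: "0 < f i" "f i < 1" if "i < n" for i
      using t[OF that, of m] M_nonneg[OF that, of "t (Suc m)"] by (auto simp: f_def field_simps)
    have E: "0 < E" "\<And>i. i < n \<Longrightarrow> E \<le> f i" using f n_pos by (auto simp: E_def Min_gr_iff lessThan_empty_iff)
    have "M (t (Suc m)) i < (1 - E) * t m i" if "i < n" for i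
    proof -
      have "E * t m i \<le> f i * t m i" using E(2)[OF that] t[OF that, of m] by (intro mult_right_mono) auto
      also have "\<dots> = (t m i - M (t (Suc m)) i) / 2" using t[OF that, of m] by (simp add: f_def)
      finally show ?thesis using t[OF that, of m] by (simp add: algebra_simps)
    qed
    moreover have "E < 1" using E(2)[OF n_pos] f[OF n_pos] by linarith
    ultimately show ?thesis using E by blast
  qed
  then obtain E where E: "\<And>m. 0 < E m" "\<And>m. E m < 1" "\<And>m i. i < n \<Longrightarrow> M (t (Suc m)) i < (1 - E m) * t m i"
    by metis
  \<comment> \<open>Halving makes the sequence strictly decreasing, and the minimum keeps it within
    the admissible \<open>E\<close>.\<close>
  define \<epsilon> where "\<epsilon> = rec_nat (E 0) (\<lambda>m x. min (x / 2) (E (Suc m)))"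
  have \<epsilon>0: "\<epsilon> 0 = E 0" and \<epsilon>S: "\<epsilon> (Suc m) = min (\<epsilon> m / 2) (E (Suc m))" for m by (auto simp: \<epsilon>_def)
  have \<epsilon>pos: "0 < \<epsilon> m" for m by (induction m) (auto simp: \<epsilon>0 \<epsilon>S E)
  have \<epsilon>E: "\<epsilon> m \<le> E m" for m by (cases m) (auto simp: \<epsilon>0 \<epsilon>S)
  have \<epsilon>dec: "\<epsilon> (Suc m) < \<epsilon> m" for m using \<epsilon>pos[of m] by (simp add: \<epsilon>S min_def)
  have \<epsilon>1: "\<epsilon> m < 1" for m using \<epsilon>E[of m] E(2)[of m] by linarith
  have \<epsilon>le: "\<epsilon> m \<le> \<epsilon> 0" for m
  proof (induction m)
    case (Suc m)
    then show ?case using \<epsilon>dec[of m] by linarith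
  qed simp
  define u where "u = (\<lambda>m i. (1 - \<epsilon> m) * t m i)"
  have u0: "0 < u m i" if "i < n" for m i using t[OF that, of m] \<epsilon>1[of m] by (simp add: u_def)
  have uinc: "u m i < u (Suc m) i" if "i < n" for m i
  proof -
    have "u m i < (1 - \<epsilon> (Suc m)) * t m i"
      unfolding u_def using \<epsilon>dec[of m] t[OF that, of m] by (intro mult_strict_right_mono) auto
    also have "\<dots> \<le> u (Suc m) i"
      unfolding u_def using \<epsilon>1[of "Suc m"] t[OF that, of m] by (intro mult_left_mono) auto
    finally show ?thesis .
  qed
  have uM: "M (u (Suc m)) i < u m i" if i: "i < n" for m i
  proof -
    have "u (Suc m) j \<le> t (Suc m) j" if "j < n" for j
      using \<epsilon>pos[of "Suc m"] t[OF that, of "Suc m"] by (simp add: u_def algebra_simps)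
    then have "M (u (Suc m)) i \<le> M (t (Suc m)) i" by (intro M_mono i)
    also have "\<dots> < (1 - E m) * t m i" by (rule E(3)[OF i])
    also have "\<dots> \<le> u m i" unfolding u_def using \<epsilon>E[of m] t[OF i, of m] by (intro mult_right_mono) auto
    finally show ?thesis .
  qed
  define d where "d = desc (u 0)"
  have Mu0: "M (u 0) i < u 0 i" if "i < n" for i
  proof -
    have "M (u 0) i \<le> M (u (Suc 0)) i" using uinc by (intro M_mono that less_imp_le)
    then show ?thesis using uM[OF that, of 0] by linarith
  qed
  have dstrict: "M (d m) i < d m i" if "i < n" for m i
    using that
  proof (induction m arbitrary: i)
    case 0
    then show ?case using Mu0 by (simp add: d_def)
  next
    case (Suc m)
    have "M (d (Suc m)) i \<le> M (d m) i"
      using Suc.IH Suc.prems by (intro M_mono) (auto simp: d_def field_simps less_imp_le)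
    also have "\<dots> < d (Suc m) i" using Suc.IH[OF Suc.prems] by (simp add: d_def)
    finally show ?case .
  qed
  have dS: "d (Suc m) i < d m i" "M (d m) i < d (Suc m) i" if "i < n" for m i
    using dstrict[OF that, of m] by (auto simp: d_def)
  have d0: "0 < d m i" if "i < n" for m i
    using dstrict[OF that, of m] M_nonneg[OF that, of "d m"] by linarith
  have dlim: "(\<lambda>m. d m i) \<longlonglongrightarrow> 0" if "i < n" for i
    unfolding d_def using Mu0 that by (intro desc_tendsto_0) (auto simp: less_imp_le)
  \<comment> \<open>The two halves fit together at index 0 because \<open>d 0 = u 0\<close>.\<close>
  define s where "s = (\<lambda>m::int. if 0 \<le> m then u (nat m) else d (nat (- m)))"
  show ?thesis
  proof (rule that[of s])
    fix m :: int and i assume i: "i < n"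
    show "0 < s m i \<and> s m i < s (m + 1) i \<and> M (s (m + 1)) i < s m i"
    proof (cases "0 \<le> m")
      case True
      then have "nat (m + 1) = Suc (nat m)" by simp
      then show ?thesis using True u0[OF i] uinc[OF i] uM[OF i] by (simp add: s_def)
    next
      case False
      define l where "l = nat (- m - 1)"
      have m: "m = - int (Suc l)" using False by (simp add: l_def)
      have s1: "s m = d (Suc l)" by (simp add: s_def m del: of_nat_Suc)
      have s2: "s (m + 1) = d l" by (cases "l = 0") (auto simp: s_def m d_def)
      show ?thesis unfolding s1 s2 using d0[OF i] dS[OF i] by blast
    qed
  next
    fix i B assume i: "i < n"
    obtain m where m: "B / (1 - \<epsilon> 0) < t m i" using tunb[OF i] by blast
    have "B < (1 - \<epsilon> 0) * t m i" using m \<epsilon>1[of 0] by (simp add: field_simps)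
    also have "\<dots> \<le> u m i" unfolding u_def using \<epsilon>le[of m] t[OF i, of m] by (intro mult_right_mono) auto
    finally show "\<exists>m. B < s m i" by (intro exI[of _ "int m"]) (simp add: s_def)
  next
    fix i and e :: real assume i: "i < n" and "0 < e"
    then obtain m where "d m i < e" using order_tendstoD(2)[OF dlim[OF i] \<open>0 < e\<close>] eventually_happens by fastforce
    then have "d (Suc m) i < e" using dS(1)[OF i, of m] by linarith
    then show "\<exists>m. s m i < e" by (intro exI[of _ "- int (Suc m)"]) (simp add: s_def del: of_nat_Suc)
  qed
qed

text \<open>Between the nodes \<open>m\<close> and \<open>m + 1\<close> the path lies between
  \<open>s m\<close> and \<open>s (m + 1)\<close>, so its image under \<open>M\<close> is at most
  \<open>M (s (m + 1))\<close>, which is below \<open>s m\<close> and hence below the path.\<close>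

lemma exists_bilipschitz_path:
  fixes k :: "nat \<Rightarrow> 'd::finite"
  assumes inj: "inj_on k {..<n}"
  obtains \<sigma> where "\<And>i. i < n \<Longrightarrow> classKinf (\<sigma> i) \<and> bilip_path (\<sigma> i)"
    "\<And>r i. 0 < r \<Longrightarrow> i < n \<Longrightarrow> Dalpha Isum \<alpha> (gain_op n Isum \<gamma> (\<lambda>j. \<sigma> j r)) i < \<sigma> i r"
proof -
  obtain s :: "int \<Rightarrow> nat \<Rightarrow> real" where
    s: "\<And>m i. i < n \<Longrightarrow> 0 < s m i \<and> s m i < s (m + 1) i \<and> M (s (m + 1)) i < s m i"
    "\<And>i B. i < n \<Longrightarrow> \<exists>m. B < s m i" "\<And>i e. i < n \<Longrightarrow> 0 < e \<Longrightarrow> \<exists>m. s m i < e"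
    using exists_two_sided_sequence[OF inj] by blast
  define \<sigma> where "\<sigma> = (\<lambda>i r. if r \<le> 0 then 0 else interp (\<lambda>m. s m i) (ln r))"
  show ?thesis
  proof (rule that[of \<sigma>])
    show "classKinf (\<sigma> i) \<and> bilip_path (\<sigma> i)" if i: "i < n" for i
      using interp_ln_path[of "\<lambda>m. s m i" "\<sigma> i"] s(1)[OF i] s(2)[OF i] s(3)[OF i] by (simp add: \<sigma>_def)
    fix r :: real and i assume r: "0 < r" and i: "i < n"
    have b: "s \<lfloor>ln r\<rfloor> j \<le> \<sigma> j r" "\<sigma> j r \<le> s (\<lfloor>ln r\<rfloor> + 1) j" if j: "j < n" for j
      using interp_ge[of "\<lambda>m. s m j" "ln r"] interp_le[of "\<lambda>m. s m j" "ln r"] s(1)[OF j, of "\<lfloor>ln r\<rfloor>"] r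
      by (auto simp: \<sigma>_def)
    have "M (\<lambda>j. \<sigma> j r) i \<le> M (s (\<lfloor>ln r\<rfloor> + 1)) i" using b by (intro M_mono i) auto
    also have "\<dots> < s \<lfloor>ln r\<rfloor> i" using s(1)[OF i] by blast
    also have "\<dots> \<le> \<sigma> i r" using b[OF i] by blast
    finally have "M (\<lambda>j. \<sigma> j r) i < \<sigma> i r" .
    moreover have "0 \<le> \<sigma> j r" if "j < n" for j using b(1)[OF that] s(1)[OF that, of "\<lfloor>ln r\<rfloor>"] by linarith
    ultimately show "Dalpha Isum \<alpha> (gain_op n Isum \<gamma> (\<lambda>j. \<sigma> j r)) i < \<sigma> i r"
      using M_eq[of "\<lambda>j. \<sigma> j r" i] i by simp
  qed
qed

end

section \<open>Dini decrease of the composite Lyapunov function\<close>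

text \<open>Pairs closer than a Lebesgue number of the cover share a ball with a local constant; for
  the others the bound \<open>K\<close> divided by that number serves as a slope. The parameter set
  \<open>C\<close> later holds the input values.\<close>

lemma uniform_lipschitz_on_compact:
  fixes f :: "'u \<Rightarrow> 'a::metric_space \<Rightarrow> 'b::metric_space"
  assumes S: "compact S"
    and loc: "\<And>\<xi>. \<xi> \<in> S \<Longrightarrow> \<exists>\<delta>>0. \<exists>L. \<forall>a\<in>S \<inter> ball \<xi> \<delta>. \<forall>b\<in>S \<inter> ball \<xi> \<delta>. \<forall>u\<in>C. dist (f u a) (f u b) \<le> L * dist a b"
    and bdd: "\<And>u x y. u \<in> C \<Longrightarrow> x \<in> S \<Longrightarrow> y \<in> S \<Longrightarrow> dist (f u x) (f u y) \<le> K"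
  shows "\<exists>L\<ge>0. \<forall>u\<in>C. L-lipschitz_on S (f u)"
proof -
  obtain \<delta> L where \<delta>: "\<And>\<xi>. \<xi> \<in> S \<Longrightarrow> 0 < \<delta> \<xi>"
    and L: "\<And>\<xi> a b u. \<xi> \<in> S \<Longrightarrow> a \<in> S \<inter> ball \<xi> (\<delta> \<xi>) \<Longrightarrow> b \<in> S \<inter> ball \<xi> (\<delta> \<xi>) \<Longrightarrow> u \<in> C \<Longrightarrow> dist (f u a) (f u b) \<le> L \<xi> * dist a b"
    using loc by metis
  have "S \<subseteq> (\<Union>\<xi>\<in>S. ball \<xi> (\<delta> \<xi>))" using \<delta> by force
  then obtain I where I: "I \<subseteq> S" "finite I" "S \<subseteq> (\<Union>\<xi>\<in>I. ball \<xi> (\<delta> \<xi>))"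
    using compactE_image[OF S, of S "\<lambda>\<xi>. ball \<xi> (\<delta> \<xi>)"] by (metis open_ball)
  obtain e where e: "0 < e" "\<forall>x\<in>S. \<exists>G\<in>(\<lambda>\<xi>. ball \<xi> (\<delta> \<xi>)) ` I. ball x e \<subseteq> G"
    by (rule Heine_Borel_lemma[OF S I(3)]) auto
  define L' where "L' = (\<Sum>\<xi>\<in>I. \<bar>L \<xi>\<bar>) + \<bar>K\<bar> / e"
  have L0: "0 \<le> L'" using e by (simp add: L'_def sum_nonneg)
  have "dist (f u x) (f u y) \<le> L' * dist x y" if u: "u \<in> C" and xy: "x \<in> S" "y \<in> S" for u x y
  proof (cases "dist x y < e")
    case True
    obtain \<xi> where \<xi>: "\<xi> \<in> I" "ball x e \<subseteq> ball \<xi> (\<delta> \<xi>)" using e(2) xy by auto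
    have "x \<in> ball x e" "y \<in> ball x e" using e True by auto
    then have "x \<in> ball \<xi> (\<delta> \<xi>)" "y \<in> ball \<xi> (\<delta> \<xi>)" using \<xi>(2) by blast+
    then have "dist (f u x) (f u y) \<le> L \<xi> * dist x y" using \<xi> I xy u by (intro L) blast+
    also have "\<dots> \<le> L' * dist x y"
    proof (rule mult_right_mono)
      have "\<bar>L \<xi>\<bar> \<le> (\<Sum>\<xi>\<in>I. \<bar>L \<xi>\<bar>)" using \<xi> I by (intro member_le_sum) auto
      moreover have "0 \<le> \<bar>K\<bar> / e" using e by simp
      ultimately show "L \<xi> \<le> L'" unfolding L'_def by linarith
    qed simp
    finally show ?thesis .
  next
    case False
    have "dist (f u x) (f u y) \<le> \<bar>K\<bar>" using bdd[OF u xy] by linarith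
    also have "\<dots> = (\<bar>K\<bar> / e) * e" using e by simp
    also have "\<dots> \<le> (\<bar>K\<bar> / e) * dist x y" using False e by (intro mult_left_mono) auto
    also have "\<dots> \<le> L' * dist x y" by (intro mult_right_mono) (auto simp: L'_def sum_nonneg)
    finally show ?thesis .
  qed
  then show ?thesis using L0 by (intro exI[of _ L'] conjI ballI lipschitz_onI) auto
qed

lemma locLip_compact_lipschitz:
  fixes f :: "'a::metric_space \<Rightarrow> 'b::metric_space"
  assumes "compact S" "locLip S f"
  shows "\<exists>L. L-lipschitz_on S f"
proof -
  obtain \<delta> L where \<delta>: "\<And>\<xi>. \<xi> \<in> S \<Longrightarrow> 0 < \<delta> \<xi>"
    and L: "\<And>\<xi> a b. \<xi> \<in> S \<Longrightarrow> a \<in> S \<inter> ball \<xi> (\<delta> \<xi>) \<Longrightarrow> b \<in> S \<inter> ball \<xi> (\<delta> \<xi>) \<Longrightarrow> dist (f a) (f b) \<le> L \<xi> * dist a b"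
    using assms(2) unfolding locLip_def by metis
  have cont: "continuous_on S f"
    unfolding continuous_on_iff
  proof (intro ballI allI impI)
    fix \<xi> e assume \<xi>: "\<xi> \<in> S" and e: "(0::real) < e"
    define d where "d = min (\<delta> \<xi>) (e / (\<bar>L \<xi>\<bar> + 1))"
    have d: "0 < d" using \<delta>[OF \<xi>] e by (simp add: d_def)
    have "dist (f y) (f \<xi>) < e" if y: "y \<in> S" "dist y \<xi> < d" for y
    proof -
      have "dist (f y) (f \<xi>) \<le> L \<xi> * dist y \<xi>" using \<delta>[OF \<xi>] y \<xi> by (intro L) (auto simp: d_def dist_commute)
      also have "\<dots> \<le> (\<bar>L \<xi>\<bar> + 1) * dist y \<xi>" by (intro mult_right_mono) auto
      also have "\<dots> < (\<bar>L \<xi>\<bar> + 1) * (e / (\<bar>L \<xi>\<bar> + 1))" using y by (intro mult_strict_left_mono) (auto simp: d_def)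
      also have "\<dots> = e" by simp
      finally show ?thesis .
    qed
    then show "\<exists>d>0. \<forall>x'\<in>S. dist x' \<xi> < d \<longrightarrow> dist (f x') (f \<xi>) < e" using d by blast
  qed
  then have "bounded (f ` S)" using assms(1) compact_continuous_image compact_imp_bounded by blast
  then obtain K where K: "\<And>x y. x \<in> S \<Longrightarrow> y \<in> S \<Longrightarrow> dist (f x) (f y) \<le> K"
    unfolding bounded_two_points by blast
  have "\<exists>\<delta>>0. \<exists>L. \<forall>a\<in>S \<inter> ball \<xi> \<delta>. \<forall>b\<in>S \<inter> ball \<xi> \<delta>. \<forall>u\<in>{()}. dist (f a) (f b) \<le> L * dist a b"
    if "\<xi> \<in> S" for \<xi>
    using assms(2) that unfolding locLip_def by auto
  from uniform_lipschitz_on_compact[OF assms(1) this K] show ?thesis by blast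
qed

lemma locLip_subset: "locLip S f \<Longrightarrow> T \<subseteq> S \<Longrightarrow> locLip T f"
proof -
  assume f: "locLip S f" and T: "T \<subseteq> S"
  show ?thesis
    unfolding locLip_def
  proof
    fix \<xi> assume "\<xi> \<in> T"
    then obtain \<delta> L where "0 < \<delta>" "\<forall>a\<in>S \<inter> ball \<xi> \<delta>. \<forall>b\<in>S \<inter> ball \<xi> \<delta>. dist (f a) (f b) \<le> L * dist a b"
      using f T unfolding locLip_def by blast
    then show "\<exists>\<delta>>0. \<exists>L. \<forall>a\<in>T \<inter> ball \<xi> \<delta>. \<forall>b\<in>T \<inter> ball \<xi> \<delta>. dist (f a) (f b) \<le> L * dist a b"
      using T by blast
  qed
qed

text \<open>The increment bound for Lipschitz functions, applied to \<open>- \<tau>\<close> on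
  compact intervals.\<close>

lemma slope_below_from_derivative_bound:
  assumes lip: "locLip {0<..} \<tau>"
    and der: "\<And>P. compact P \<Longrightarrow> P \<subseteq> {0<..} \<Longrightarrow> \<exists>c>0. \<forall>r\<in>P. \<forall>d. (\<tau> has_real_derivative d) (at r) \<longrightarrow> c \<le> d"
  shows "slope_below \<tau>"
  unfolding slope_below_def
proof (intro allI impI)
  fix a b :: real assume ab: "0 < a" "a \<le> b"
  obtain c where c: "0 < c" "\<And>r d. r \<in> {a..b} \<Longrightarrow> (\<tau> has_real_derivative d) (at r) \<Longrightarrow> c \<le> d"
    using der[of "{a..b}"] ab by (auto simp: subset_iff)
  have "c * (y - x) \<le> \<tau> y - \<tau> x" if xy: "a \<le> x" "x \<le> y" "y \<le> b" for x y
  proof -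
    have "locLip {x..y} \<tau>" using xy ab by (intro locLip_subset[OF lip]) auto
    then obtain L where "L-lipschitz_on {x..y} \<tau>" using locLip_compact_lipschitz[of "{x..y}" \<tau>] by auto
    then have "L-lipschitz_on {x..y} (\<lambda>t. - \<tau> t)" by (auto simp: lipschitz_on_def dist_real_def)
    then have "- \<tau> y - - \<tau> x \<le> (- c) * (y - x)"
    proof (rule lipschitz_real_increment_le[OF _ xy(2)], intro AE_I2 impI allI)
      fix t d assume t: "x < t" "t < y" and "((\<lambda>t. - \<tau> t) has_real_derivative d) (at t)"
      then have "(\<tau> has_real_derivative - d) (at t)" using DERIV_minus by fastforce
      then show "d \<le> - c" using c(2)[of t "- d"] t xy by auto
    qed
    then show ?thesis by (simp add: algebra_simps)
  qed
  then show "\<exists>c>0. \<forall>x y. a \<le> x \<longrightarrow> x \<le> y \<longrightarrow> y \<le> b \<longrightarrow> c * (y - x) \<le> \<tau> y - \<tau> x" using c by blast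
qed

text \<open>The upper right Dini derivative of \<open>W\<close> at \<open>x\<close> in direction
  \<open>w\<close> is at most \<open>- a\<close>, with the limes superior unfolded.\<close>

definition dini_decrease :: "('a::real_normed_vector \<Rightarrow> real) \<Rightarrow> 'a \<Rightarrow> 'a \<Rightarrow> real \<Rightarrow> bool" where
  "dini_decrease W x w a \<longleftrightarrow> (\<forall>e>0. \<forall>\<^sub>F h in at_right 0. W (x + h *\<^sub>R w) \<le> W x - h * (a - e))"

lemma dini_decrease_mono: "dini_decrease W x w a \<Longrightarrow> a' \<le> a \<Longrightarrow> dini_decrease W x w a'"
  unfolding dini_decrease_def
proof (intro allI impI)
  fix e :: real assume *: "\<forall>e>0. \<forall>\<^sub>F h in at_right 0. W (x + h *\<^sub>R w) \<le> W x - h * (a - e)" "a' \<le> a" "0 < e"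
  then have "\<forall>\<^sub>F h in at_right 0. W (x + h *\<^sub>R w) \<le> W x - h * (a - e)" by blast
  then show "\<forall>\<^sub>F h in at_right 0. W (x + h *\<^sub>R w) \<le> W x - h * (a' - e)"
    using eventually_at_right_less[of 0]
  proof eventually_elim
    case (elim h)
    have "h * (a' - e) \<le> h * (a - e)" using * elim by (intro mult_left_mono) auto
    then show ?case using elim by linarith
  qed
qed

lemma has_derivative_along_line:
  assumes "(f has_derivative D) (at y)"
  shows "((\<lambda>t. f (y + t *\<^sub>R v)) has_real_derivative D v) (at 0)"
proof -
  have "((\<lambda>t::real. y + t *\<^sub>R v) has_derivative (\<lambda>t. t *\<^sub>R v)) (at 0)"
    by (auto intro!: derivative_eq_intros)
  moreover have "(f has_derivative D) (at (y + 0 *\<^sub>R v))" using assms by simp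
  ultimately have "((\<lambda>t. f (y + t *\<^sub>R v)) has_derivative (\<lambda>t. D (t *\<^sub>R v))) (at 0)"
    by (rule has_derivative_compose)
  moreover have "D (t *\<^sub>R v) = D v * t" for t
    using has_derivative_linear[OF assms] by (simp add: linear_cmul mult.commute)
  ultimately show ?thesis by (simp add: has_field_derivative_def)
qed

lemma dini_decrease_derivative:
  assumes D: "(W has_derivative D) (at x)" and dini: "dini_decrease W x w a"
  shows "D w \<le> - a"
proof (rule field_le_epsilon)
  fix e :: real assume "0 < e"
  have "((\<lambda>t. W (x + t *\<^sub>R w)) has_real_derivative D w) (at 0)" by (rule has_derivative_along_line[OF D])
  then have "((\<lambda>h. (W (x + h *\<^sub>R w) - W x) / h) \<longlongrightarrow> D w) (at 0)"
    by (simp add: has_field_derivative_iff)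
  then have lim: "((\<lambda>h. (W (x + h *\<^sub>R w) - W x) / h) \<longlongrightarrow> D w) (at_right 0)"
    by (rule tendsto_within_subset) auto
  have "\<forall>\<^sub>F h in at_right 0. W (x + h *\<^sub>R w) \<le> W x - h * (a - e)"
    using dini \<open>0 < e\<close> by (simp add: dini_decrease_def)
  then have "\<forall>\<^sub>F h in at_right 0. (W (x + h *\<^sub>R w) - W x) / h \<le> - a + e"
    using eventually_at_right_less[of 0]
    by eventually_elim (simp add: field_simps)
  then show "D w \<le> - a + e" by (rule tendsto_upperbound[OF lim]) (simp add: trivial_limit_at_right_real)
qed

lemma lipschitz_derivative_bound:
  fixes f :: "'a::euclidean_space \<Rightarrow> real"
  assumes lip: "L-lipschitz_on S f" and S: "open S" "y \<in> S" and D: "(f has_derivative D) (at y)"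
  shows "\<bar>D v\<bar> \<le> L * norm v"
proof -
  have "((\<lambda>h. (f (y + h *\<^sub>R v) - f y) / h) \<longlongrightarrow> D v) (at 0)"
    using has_derivative_along_line[OF D, of v] by (simp add: has_field_derivative_iff)
  then have lim: "((\<lambda>h. \<bar>(f (y + h *\<^sub>R v) - f y) / h\<bar>) \<longlongrightarrow> \<bar>D v\<bar>) (at 0)"
    by (rule tendsto_rabs)
  have "((\<lambda>h. y + h *\<^sub>R v) \<longlongrightarrow> y + 0 *\<^sub>R v) (at 0)" by (intro tendsto_intros)
  then have "\<forall>\<^sub>F h in at 0. y + h *\<^sub>R v \<in> S" using S topological_tendstoD by fastforce
  then have "\<forall>\<^sub>F h in at 0. \<bar>(f (y + h *\<^sub>R v) - f y) / h\<bar> \<le> L * norm v"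
    using eventually_neq_at_within[of 0]
  proof eventually_elim
    case (elim h)
    have "\<bar>f (y + h *\<^sub>R v) - f y\<bar> \<le> L * norm (h *\<^sub>R v)"
      using lipschitz_onD[OF lip elim(1) S(2)] by (simp add: dist_norm)
    then show ?case using elim by (simp add: abs_divide field_simps)
  qed
  then show ?thesis by (rule tendsto_upperbound[OF lim]) simp
qed

section \<open>Block projections\<close>

lemma bproj_in_bspace [simp]: "bproj blk i x \<in> bspace blk i"
  by (simp add: bproj_def bspace_def)

lemma bproj_bspace: "x \<in> bspace blk i \<Longrightarrow> bproj blk i x = x"
  by (auto simp: bproj_def bspace_def vec_eq_iff)

lemma bproj_linear: "linear (bproj blk i)"
  by (rule linearI) (auto simp: bproj_def vec_eq_iff)

lemma bproj_add: "bproj blk i (x + y) = bproj blk i x + bproj blk i y"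
  and bproj_diff: "bproj blk i (x - y) = bproj blk i x - bproj blk i y"
  and bproj_scaleR: "bproj blk i (c *\<^sub>R x) = c *\<^sub>R bproj blk i x"
  using bproj_linear[of blk i] by (auto simp: linear_add linear_diff linear_cmul)

lemma norm_bproj_le: "norm (bproj blk i x) \<le> norm x"
  by (rule norm_le_componentwise_cart) (simp add: bproj_def)

lemma dist_bproj_le: "dist (bproj blk i x) (bproj blk i y) \<le> dist x y"
  using norm_bproj_le[of blk i "x - y"] by (simp add: dist_norm bproj_diff)

lemma bproj_continuous: "continuous_on S (bproj blk i)"
  using bproj_linear linear_continuous_on linear_conv_bounded_linear by blast

lemma bproj_bproj [simp]: "bproj blk i (bproj blk i x) = bproj blk i x"
  by (simp add: bproj_bspace)

lemma sum_bproj: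
  assumes "\<forall>k. blk k < n"
  shows "(\<Sum>i<n. bproj blk i x) = x"
  using assms by (auto simp: vec_eq_iff bproj_def)

lemma exists_large_block:
  assumes "\<forall>k. blk k < n" "0 < n"
  shows "\<exists>i<n. norm x / real n \<le> norm (bproj blk i x)"
proof (rule ccontr)
  assume "\<not> ?thesis"
  then have "\<And>i. i < n \<Longrightarrow> norm (bproj blk i x) < norm x / real n" by force
  then have "(\<Sum>i<n. norm (bproj blk i x)) < (\<Sum>i<n. norm x / real n)"
    using assms(2) by (intro sum_strict_mono) auto
  moreover have "norm x \<le> (\<Sum>i<n. norm (bproj blk i x))"
    using norm_sum[of "\<lambda>i. bproj blk i x" "{..<n}"] sum_bproj[OF assms(1), of x] by simp
  ultimately show False using assms(2) by simp
qed

lemma continuous_tendsto_nhds: "continuous_on UNIV f \<Longrightarrow> (f \<longlongrightarrow> f x) (nhds x)"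
  by (simp add: continuous_on_def flip: tendsto_at_iff_tendsto_nhds)

lemma continuous_on_Max_image:
  fixes f :: "'i \<Rightarrow> 'z::topological_space \<Rightarrow> real"
  assumes "finite I" "I \<noteq> {}" "\<And>j. j \<in> I \<Longrightarrow> continuous_on S (f j)"
  shows "continuous_on S (\<lambda>z. Max ((\<lambda>j. f j z) ` I))"
  unfolding continuous_on_def
proof
  fix x assume "x \<in> S"
  then show "((\<lambda>z. Max ((\<lambda>j. f j z) ` I)) \<longlongrightarrow> Max ((\<lambda>j. f j x) ` I)) (at x within S)"
    using assms(3) by (intro tendsto_Max_image[OF assms(1,2)]) (auto simp: continuous_on_def)
qed

text \<open>The path is described by properties of the increments of its inverses, so that both an
  arbitrary Omega-path and the path constructed above are instances.\<close>

locale network =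
  fixes n :: nat and blk :: "'d::finite \<Rightarrow> nat"
    and F :: "real^'d \<Rightarrow> real^'m::finite \<Rightarrow> real^'d"
    and Isum :: "nat set" and V :: "nat \<Rightarrow> real^'d \<Rightarrow> real"
    and \<gamma> :: "nat \<Rightarrow> nat \<Rightarrow> real \<Rightarrow> real"
    and gi :: "nat \<Rightarrow> real \<Rightarrow> real" and \<alpha>i :: "nat \<Rightarrow> real \<Rightarrow> real" and \<alpha> :: "real \<Rightarrow> real"
    and \<sigma> :: "nat \<Rightarrow> real \<Rightarrow> real"
  assumes n_pos: "0 < n" and blk_range: "\<forall>k. blk k < n"
    and F_cont: "continuous_on UNIV (case_prod F)"
    and gains: "\<And>i j. i < n \<Longrightarrow> j < n \<Longrightarrow> classKinf (\<gamma> i j) \<or> zero_gain (\<gamma> i j)"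
    and subISS: "\<And>i. i < n \<Longrightarrow> sub_ISS_Lyap n blk Isum F V \<gamma> gi \<alpha>i i"
    and alpha: "classKinf \<alpha>"
    and \<sigma>_Kinf: "\<And>i. i < n \<Longrightarrow> classKinf (\<sigma> i)"
    and \<sigma>_lip: "\<And>i. i < n \<Longrightarrow> locLip {0<..} (Kinv (\<sigma> i))"
    and \<sigma>_slope: "\<And>i. i < n \<Longrightarrow> slope_below (Kinv (\<sigma> i))"
    and \<sigma>_path: "\<And>r i. 0 < r \<Longrightarrow> i < n \<Longrightarrow> Dalpha Isum \<alpha> (gain_op n Isum \<gamma> (\<lambda>j. \<sigma> j r)) i < \<sigma> i r"
begin

text \<open>Lifts \<open>V i\<close> to the full state space, constant in the other blocks, where
  the results on Lipschitz functions apply.\<close>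

definition g :: "nat \<Rightarrow> real^'d \<Rightarrow> real" where "g i x = V i (bproj blk i x)"
definition W :: "nat \<Rightarrow> real^'d \<Rightarrow> real" where "W i x = Kinv (\<sigma> i) (g i x)"
definition U :: "real^'d \<Rightarrow> real" where "U x = Max ((\<lambda>i. W i x) ` {..<n})"

lemma Kinv_\<sigma>: "i < n \<Longrightarrow> classK (Kinv (\<sigma> i))"
  using \<sigma>_Kinf Kinv_classKinf classKinf_classK by blast

lemma g_bounds:
  assumes "i < n"
  obtains \<psi>1 \<psi>2 where "classKinf \<psi>1" "classKinf \<psi>2"
    "\<And>x. \<psi>1 (norm (bproj blk i x)) \<le> g i x \<and> g i x \<le> \<psi>2 (norm (bproj blk i x))"
  using subISS[OF assms] unfolding sub_ISS_Lyap_def g_def by auto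

lemma g_nonneg: "i < n \<Longrightarrow> 0 \<le> g i x"
  and g_eq_0: "i < n \<Longrightarrow> bproj blk i x = 0 \<Longrightarrow> g i x = 0"
  and g_pos: "i < n \<Longrightarrow> bproj blk i x \<noteq> 0 \<Longrightarrow> 0 < g i x"
proof -
  assume "i < n"
  then obtain \<psi>1 \<psi>2 where \<psi>: "classKinf \<psi>1" "classKinf \<psi>2"
    "\<And>x. \<psi>1 (norm (bproj blk i x)) \<le> g i x \<and> g i x \<le> \<psi>2 (norm (bproj blk i x))"
    using g_bounds by blast
  note K = classKinf_classK[OF \<psi>(1)] classKinf_classK[OF \<psi>(2)]
  show "0 \<le> g i x" using \<psi>(3)[of x] classK_nonneg[OF K(1), of "norm (bproj blk i x)"] by simp
  show "bproj blk i x = 0 \<Longrightarrow> g i x = 0" using \<psi>(3)[of x] classK_zero[OF K(1)] classK_zero[OF K(2)] by simp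
  show "bproj blk i x \<noteq> 0 \<Longrightarrow> 0 < g i x" using \<psi>(3)[of x] classK_pos[OF K(1), of "norm (bproj blk i x)"] by simp
qed

lemma g_continuous: "i < n \<Longrightarrow> continuous_on UNIV (g i)"
proof -
  assume "i < n"
  then have "continuous_on (bspace blk i) (V i)" using subISS unfolding sub_ISS_Lyap_def by blast
  from continuous_on_compose2[OF this bproj_continuous[of UNIV]] show ?thesis
    by (simp add: g_def[abs_def] image_subset_iff)
qed

lemma g_locally_lipschitz:
  assumes i: "i < n" and x: "bproj blk i x \<noteq> 0"
  obtains r L where "0 < r" "L-lipschitz_on (ball x r) (g i)"
proof -
  let ?\<xi> = "bproj blk i x"
  have "locLip (bspace blk i - {0}) (V i)" using subISS[OF i] by (simp add: sub_ISS_Lyap_def)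
  then obtain \<delta> L where \<delta>: "0 < \<delta>" and L: "\<And>a b. a \<in> (bspace blk i - {0}) \<inter> ball ?\<xi> \<delta> \<Longrightarrow> b \<in> (bspace blk i - {0}) \<inter> ball ?\<xi> \<delta> \<Longrightarrow>
      dist (V i a) (V i b) \<le> L * dist a b"
    using x bproj_in_bspace[of blk i x] unfolding locLip_def by blast
  \<comment> \<open>The second bound keeps the projected points away from 0, where
    \<open>V i\<close> is not assumed Lipschitz.\<close>
  define r where "r = min \<delta> (norm ?\<xi>)"
  have inb: "bproj blk i y \<in> (bspace blk i - {0}) \<inter> ball ?\<xi> \<delta>" if "y \<in> ball x r" for y
  proof -
    have "dist ?\<xi> (bproj blk i y) < r" using that dist_bproj_le[of blk i x y] by simp
    then show ?thesis by (auto simp: r_def)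
  qed
  show ?thesis
  proof (rule that[of r "\<bar>L\<bar>"])
    show "0 < r" using \<delta> x by (simp add: r_def)
    show "\<bar>L\<bar>-lipschitz_on (ball x r) (g i)"
    proof (rule lipschitz_onI)
      fix a b assume ab: "a \<in> ball x r" "b \<in> ball x r"
      have "dist (g i a) (g i b) \<le> L * dist (bproj blk i a) (bproj blk i b)"
        unfolding g_def by (rule L[OF inb[OF ab(1)] inb[OF ab(2)]])
      also have "\<dots> \<le> \<bar>L\<bar> * dist a b" by (intro mult_mono dist_bproj_le) auto
      finally show "dist (g i a) (g i b) \<le> \<bar>L\<bar> * dist a b" .
    qed simp
  qed
qed

definition rhs :: "nat \<Rightarrow> real^'m \<Rightarrow> real^'d \<Rightarrow> real" where
  "rhs i u x = (if i \<in> Isum then (\<Sum>j<n. \<gamma> i j (g j x)) + gi i (norm u)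
           else max (Max ((\<lambda>j. \<gamma> i j (g j x)) ` {..<n})) (gi i (norm u)))"

lemma rhs_continuous:
  assumes i: "i < n"
  shows "continuous_on UNIV (rhs i u)"
proof -
  have gc: "continuous_on {0..} (\<gamma> i j)" if "j < n" for j
    by (rule gain_function_continuous[OF gains[OF i that]])
  have c: "continuous_on UNIV (\<lambda>x. \<gamma> i j (g j x))" if j: "j < n" for j
    by (rule continuous_on_compose2[OF gc[OF j] g_continuous[OF j]]) (auto simp: g_nonneg[OF j])
  have "continuous_on UNIV (\<lambda>x. Max ((\<lambda>j. \<gamma> i j (g j x)) ` {..<n}))"
    using c n_pos by (intro continuous_on_Max_image) auto
  then show ?thesis
    unfolding rhs_def[abs_def] using c
    by (cases "i \<in> Isum") (auto intro!: continuous_on_add continuous_on_max continuous_on_sum continuous_on_const)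
qed

text \<open>On the affine slice through \<open>y\<close> parallel to block \<open>i\<close>, the
  function \<open>g i\<close> is a translate of \<open>V i\<close>, so \<open>D\<close> is also a
  derivative of \<open>V i\<close> within the block space.\<close>

lemma g_derivative_decrease:
  assumes i: "i < n" and D: "(g i has_derivative D) (at y)" and less: "rhs i u y \<le> g i y"
  shows "D (bproj blk i (F y u)) \<le> - \<alpha>i i (norm (bproj blk i y))"
proof -
  have "(V i has_derivative D) (at (bproj blk i y) within bspace blk i)"
  proof (rule has_derivative_transform[of _ _ _ "\<lambda>\<zeta>. g i ((y - bproj blk i y) + \<zeta>)"])
    show "bproj blk i y \<in> bspace blk i" by simp
    show "V i \<zeta> = g i ((y - bproj blk i y) + \<zeta>)" if "\<zeta> \<in> bspace blk i" for \<zeta>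
      using that by (simp add: g_def bproj_add bproj_diff bproj_bspace)
    have 1: "((\<lambda>\<zeta>. (y - bproj blk i y) + \<zeta>) has_derivative (\<lambda>z. z)) (at (bproj blk i y) within bspace blk i)"
      by (auto intro!: derivative_eq_intros)
    have "(g i has_derivative D) (at ((y - bproj blk i y) + bproj blk i y))" using D by simp
    from has_derivative_compose[OF 1 this]
    show "((\<lambda>\<zeta>. g i ((y - bproj blk i y) + \<zeta>)) has_derivative D) (at (bproj blk i y) within bspace blk i)" .
  qed
  then show ?thesis using subISS[OF i] less unfolding sub_ISS_Lyap_def rhs_def g_def by blast
qed

text \<open>The strict inequality persists near \<open>x\<close>, so at nearby points
  \<open>y\<close> of differentiability the decrease holds in direction \<open>F y u\<close>.
  Freezing the direction at \<open>F x u\<close> costs at most \<open>L\<close> times the difference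
  of the two, which is small by continuity.\<close>

lemma g_dini_decrease:
  assumes i: "i < n" and x: "bproj blk i x \<noteq> 0" and less: "rhs i u x < g i x"
  shows "dini_decrease (g i) x (F x u) (\<alpha>i i (norm (bproj blk i x)))"
  unfolding dini_decrease_def
proof (intro allI impI)
  fix e :: real assume e: "0 < e"
  let ?w = "bproj blk i (F x u)" and ?a = "\<alpha>i i (norm (bproj blk i x))"
  obtain r L where r: "0 < r" and L: "L-lipschitz_on (ball x r) (g i)"
    using g_locally_lipschitz[OF i x] .
  have L0: "0 \<le> L" using L lipschitz_on_nonneg by blast
  have "continuous_on UNIV (\<lambda>y. g i y - rhs i u y)"
    by (intro continuous_on_diff g_continuous rhs_continuous i)
  then have "((\<lambda>y. g i y - rhs i u y) \<longlongrightarrow> g i x - rhs i u x) (nhds x)"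
    by (rule continuous_tendsto_nhds)
  then have E1: "\<forall>\<^sub>F y in nhds x. 0 < g i y - rhs i u y" using less by (intro order_tendstoD) auto
  have "continuous_on UNIV (\<lambda>y. F y u)"
    using continuous_on_compose2[OF F_cont continuous_on_Pair[OF continuous_on_id continuous_on_const[of _ u]]] by simp
  then have "continuous_on UNIV (\<lambda>y. L * norm (?w - bproj blk i (F y u)))"
    by (intro continuous_on_mult_left continuous_on_norm continuous_on_diff continuous_on_const
          continuous_on_compose2[OF bproj_continuous[of UNIV]]) auto
  then have "((\<lambda>y. L * norm (?w - bproj blk i (F y u))) \<longlongrightarrow> L * norm (?w - bproj blk i (F x u))) (nhds x)"
    by (rule continuous_tendsto_nhds)
  then have E2: "\<forall>\<^sub>F y in nhds x. L * norm (?w - bproj blk i (F y u)) < e / 2" using e by (intro order_tendstoD) auto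
  have "continuous_on {0..} (\<alpha>i i)" using subISS[OF i] by (simp add: sub_ISS_Lyap_def posdef_def)
  then have "continuous_on UNIV (\<lambda>y. \<alpha>i i (norm (bproj blk i y)))"
    by (rule continuous_on_compose2) (auto intro!: continuous_intros bproj_continuous)
  then have "((\<lambda>y. \<alpha>i i (norm (bproj blk i y))) \<longlongrightarrow> ?a) (nhds x)"
    by (rule continuous_tendsto_nhds)
  then have E3: "\<forall>\<^sub>F y in nhds x. ?a - e / 2 < \<alpha>i i (norm (bproj blk i y))" using e by (intro order_tendstoD) auto
  have "\<forall>\<^sub>F y in nhds x. 0 < g i y - rhs i u y \<and> L * norm (?w - bproj blk i (F y u)) < e / 2 \<and> ?a - e / 2 < \<alpha>i i (norm (bproj blk i y))"
    using E1 E2 E3 by eventually_elim auto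
  then obtain r1 where r1: "0 < r1" "\<And>y. dist y x < r1 \<Longrightarrow> 0 < g i y - rhs i u y \<and> L * norm (?w - bproj blk i (F y u)) < e / 2 \<and> ?a - e / 2 < \<alpha>i i (norm (bproj blk i y))"
    unfolding eventually_nhds_metric by blast
  define r2 where "r2 = min r r1"
  have "\<exists>d>0. \<forall>h. 0 \<le> h \<and> h < d \<longrightarrow> g i (x + h *\<^sub>R ?w) \<le> g i x - h * (?a - e)"
  proof (rule lipschitz_directional_decrease)
    show "0 < r2" using r r1 by (simp add: r2_def)
    show "L-lipschitz_on (ball x r2) (g i)" by (rule lipschitz_on_subset[OF L]) (auto simp: r2_def)
    fix y D assume y: "y \<in> ball x r2" and D: "(g i has_derivative D) (at y)"
    have y1: "dist y x < r1" and yr: "y \<in> ball x r" using y by (auto simp: r2_def dist_commute)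
    have "D (bproj blk i (F y u)) \<le> - \<alpha>i i (norm (bproj blk i y))"
      using r1(2)[OF y1] by (intro g_derivative_decrease[OF i D]) auto
    moreover have "D (?w - bproj blk i (F y u)) \<le> L * norm (?w - bproj blk i (F y u))"
      using lipschitz_derivative_bound[OF L open_ball yr D] abs_le_D1 by blast
    moreover have "D ?w = D (bproj blk i (F y u)) + D (?w - bproj blk i (F y u))"
      using has_derivative_linear[OF D] by (simp add: linear_diff)
    ultimately show "D ?w \<le> - (?a - e)" using r1(2)[OF y1] by linarith
  qed
  then obtain d where d: "0 < d" "\<And>h. 0 \<le> h \<Longrightarrow> h < d \<Longrightarrow> g i (x + h *\<^sub>R ?w) \<le> g i x - h * (?a - e)" by blast
  \<comment> \<open>Only block \<open>i\<close> of the velocity changes \<open>g i\<close>.\<close>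
  have "g i (x + h *\<^sub>R F x u) = g i (x + h *\<^sub>R ?w)" for h
    by (simp add: g_def bproj_add bproj_scaleR)
  then show "\<forall>\<^sub>F h in at_right 0. g i (x + h *\<^sub>R F x u) \<le> g i x - h * (?a - e)"
    using d by (auto simp: eventually_at_right_field intro!: exI[of _ d])
qed

lemma W_nonneg: "i < n \<Longrightarrow> 0 \<le> W i x"
  unfolding W_def by (intro Kinv_nonneg \<sigma>_Kinf g_nonneg)

lemma W_le_U: "i < n \<Longrightarrow> W i x \<le> U x"
  unfolding U_def by (intro Max_ge) auto

lemma U_attained: obtains i where "i < n" "U x = W i x"
proof -
  have "U x \<in> (\<lambda>i. W i x) ` {..<n}" unfolding U_def using n_pos by (intro Max_in) auto
  then show ?thesis using that by auto
qed

lemma W_continuous: "i < n \<Longrightarrow> continuous_on UNIV (W i)"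
  unfolding W_def[abs_def]
  by (rule continuous_on_compose2[OF classK_cont[OF Kinv_\<sigma>] g_continuous]) (auto simp: g_nonneg)

lemma U_continuous: "continuous_on UNIV U"
  unfolding U_def[abs_def] using W_continuous n_pos by (intro continuous_on_Max_image) auto

lemma U_proper: "\<exists>\<psi>1 \<psi>2. classKinf \<psi>1 \<and> classKinf \<psi>2 \<and> (\<forall>x. \<psi>1 (norm x) \<le> U x \<and> U x \<le> \<psi>2 (norm x))"
proof -
  have "\<exists>\<psi>1 \<psi>2. classKinf \<psi>1 \<and> classKinf \<psi>2 \<and> (\<forall>x. \<psi>1 (norm (bproj blk i x)) \<le> g i x \<and> g i x \<le> \<psi>2 (norm (bproj blk i x)))" if "i < n" for i
    by (rule g_bounds[OF that]) blast
  then obtain p1 p2 where p: "\<And>i. i < n \<Longrightarrow> classKinf (p1 i)" "\<And>i. i < n \<Longrightarrow> classKinf (p2 i)"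
    "\<And>i x. i < n \<Longrightarrow> p1 i (norm (bproj blk i x)) \<le> g i x" "\<And>i x. i < n \<Longrightarrow> g i x \<le> p2 i (norm (bproj blk i x))"
    by metis
  have n': "0 < 1 / real n" using n_pos by simp
  \<comment> \<open>Some block carries at least the share \<open>1 / n\<close> of the norm
    (\<open>exists_large_block\<close>). Which one depends on \<open>x\<close>, hence the common
    minorant over all \<open>i\<close>.\<close>
  have "\<And>i. i < n \<Longrightarrow> classKinf (\<lambda>r. Kinv (\<sigma> i) (p1 i ((1 / real n) * r)))"
    by (rule classKinf_compose[OF Kinv_classKinf[OF \<sigma>_Kinf] classKinf_compose[OF p(1) classKinf_cmult[OF n']]])
  note K1 = this
  have "\<exists>\<psi>. classKinf \<psi> \<and> (\<forall>i<n. \<forall>r\<ge>0. \<psi> r \<le> Kinv (\<sigma> i) (p1 i ((1 / real n) * r)))"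
    by (rule classKinf_finite_lower) (erule K1)
  then obtain \<psi>1 where
    \<psi>1': "classKinf \<psi>1 \<and> (\<forall>i<n. \<forall>r\<ge>0. \<psi>1 r \<le> Kinv (\<sigma> i) (p1 i ((1 / real n) * r)))" by (elim exE)
  then have \<psi>1: "classKinf \<psi>1" "\<And>i r. i < n \<Longrightarrow> 0 \<le> r \<Longrightarrow> \<psi>1 r \<le> Kinv (\<sigma> i) (p1 i ((1 / real n) * r))"
    by simp_all
  have "\<And>i. i < n \<Longrightarrow> classKinf (\<lambda>r. Kinv (\<sigma> i) (p2 i r))"
    by (rule classKinf_compose[OF Kinv_classKinf[OF \<sigma>_Kinf] p(2)])
  note K2 = this
  have "\<exists>\<psi>. classKinf \<psi> \<and> (\<forall>i<n. \<forall>r\<ge>0. Kinv (\<sigma> i) (p2 i r) \<le> \<psi> r)"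
    by (rule classKinf_finite_upper) (erule K2)
  then obtain \<psi>2 where
    \<psi>2': "classKinf \<psi>2 \<and> (\<forall>i<n. \<forall>r\<ge>0. Kinv (\<sigma> i) (p2 i r) \<le> \<psi>2 r)" by (elim exE)
  then have \<psi>2: "classKinf \<psi>2" "\<And>i r. i < n \<Longrightarrow> 0 \<le> r \<Longrightarrow> Kinv (\<sigma> i) (p2 i r) \<le> \<psi>2 r"
    by simp_all
  have "\<psi>1 (norm x) \<le> U x \<and> U x \<le> \<psi>2 (norm x)" for x
  proof
    obtain i where i: "i < n" "norm x / real n \<le> norm (bproj blk i x)" using exists_large_block[OF blk_range n_pos] by blast
    have "\<psi>1 (norm x) \<le> Kinv (\<sigma> i) (p1 i ((1 / real n) * norm x))" using \<psi>1(2)[OF i(1)] by simp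
    also have "\<dots> \<le> Kinv (\<sigma> i) (p1 i (norm (bproj blk i x)))"
      using i p(1)[OF i(1)] by (intro classK_le[OF Kinv_\<sigma>] classK_nonneg[of "p1 i"] classK_le[of "p1 i"] classKinf_classK) auto
    also have "\<dots> \<le> W i x" unfolding W_def
      using i p by (intro classK_le[OF Kinv_\<sigma>] classK_nonneg[of "p1 i"] classKinf_classK) auto
    also have "\<dots> \<le> U x" by (rule W_le_U[OF i(1)])
    finally show "\<psi>1 (norm x) \<le> U x" .
    obtain j where j: "j < n" "U x = W j x" by (rule U_attained)
    have "W j x \<le> Kinv (\<sigma> j) (p2 j (norm (bproj blk j x)))" unfolding W_def
      using j p by (intro classK_le[OF Kinv_\<sigma>] g_nonneg) auto
    also have "\<dots> \<le> Kinv (\<sigma> j) (p2 j (norm x))"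
      using j p(2)[OF j(1)] norm_bproj_le[of blk j x]
      by (intro classK_le[OF Kinv_\<sigma>] classK_nonneg[of "p2 j"] classK_le[of "p2 j"] classKinf_classK) auto
    also have "\<dots> \<le> \<psi>2 (norm x)" using \<psi>2(2)[OF j(1)] by simp
    finally show "U x \<le> \<psi>2 (norm x)" using j by simp
  qed
  then show ?thesis using \<psi>1 \<psi>2 by blast
qed

lemma U_pos: "x \<noteq> 0 \<Longrightarrow> 0 < U x"
proof -
  assume x: "x \<noteq> 0"
  obtain \<psi>1 where \<psi>1: "classKinf \<psi>1" "\<And>x. \<psi>1 (norm x) \<le> U x" using U_proper by blast
  show "0 < U x" using classK_pos[OF classKinf_classK[OF \<psi>1(1)], of "norm x"] \<psi>1(2)[of x] x by simp
qed

lemma W_pos_iff: "i < n \<Longrightarrow> 0 < W i x \<longleftrightarrow> bproj blk i x \<noteq> 0"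
  using g_pos[of i x] g_eq_0[of i x] classK_pos[OF Kinv_\<sigma>, of i "g i x"] classK_zero[OF Kinv_\<sigma>, of i]
  by (cases "bproj blk i x = 0") (auto simp: W_def)

lemma W_locally_lipschitz:
  assumes i: "i < n" and x: "bproj blk i x \<noteq> 0"
  obtains r L where "0 < r" "0 \<le> L" "\<And>a b. a \<in> ball x r \<Longrightarrow> b \<in> ball x r \<Longrightarrow> \<bar>W i a - W i b\<bar> \<le> L * dist a b"
proof -
  obtain r L where r: "0 < r" and L: "L-lipschitz_on (ball x r) (g i)" using g_locally_lipschitz[OF i x] .
  have "g i x \<in> {0<..}" using g_pos[OF i x] by simp
  then obtain \<delta> K where \<delta>: "0 < \<delta>" and K: "\<And>a b. a \<in> {0<..} \<inter> ball (g i x) \<delta> \<Longrightarrow> b \<in> {0<..} \<inter> ball (g i x) \<delta> \<Longrightarrow>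
      dist (Kinv (\<sigma> i) a) (Kinv (\<sigma> i) b) \<le> K * dist a b"
    using \<sigma>_lip[OF i] unfolding locLip_def by blast
  define \<rho> where "\<rho> = min \<delta> (g i x)"
  have "0 < \<rho>" using \<delta> g_pos[OF i x] by (simp add: \<rho>_def)
  moreover have "isCont (g i) x" using g_continuous[OF i] by (simp add: continuous_on_eq_continuous_at)
  ultimately obtain d where d: "0 < d" "\<And>y. dist y x < d \<Longrightarrow> dist (g i y) (g i x) < \<rho>"
    unfolding continuous_at_eps_delta by blast
  have L0: "0 \<le> L" using L lipschitz_on_nonneg by blast
  show ?thesis
  proof (rule that[of "min r d" "\<bar>K\<bar> * L"])
    fix a b assume ab: "a \<in> ball x (min r d)" "b \<in> ball x (min r d)"
    have in1: "g i y \<in> {0<..} \<inter> ball (g i x) \<delta>" if "y \<in> ball x (min r d)" for y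
    proof -
      have *: "dist (g i y) (g i x) < \<rho>" using that by (intro d) (auto simp: dist_commute)
      then have "\<bar>g i y - g i x\<bar> < g i x" by (simp add: \<rho>_def dist_real_def)
      then have "0 < g i y" by linarith
      then show ?thesis using * by (auto simp: \<rho>_def dist_commute)
    qed
    have "\<bar>W i a - W i b\<bar> \<le> K * dist (g i a) (g i b)"
      using K[OF in1[OF ab(1)] in1[OF ab(2)]] by (simp add: W_def dist_real_def)
    also have "\<dots> \<le> \<bar>K\<bar> * (L * dist a b)"
      using lipschitz_onD[OF L, of a b] ab by (intro mult_mono) auto
    finally show "\<bar>W i a - W i b\<bar> \<le> \<bar>K\<bar> * L * dist a b" by (simp add: mult.assoc)
  qed (use r d L0 in auto)
qed

text \<open>A component may fail to be Lipschitz where its block vanishes, but there it stays below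
  \<open>U \<xi> / 2\<close> and cannot attain the maximum. For the component \<open>i\<close>
  attaining the maximum at \<open>a\<close>, \<open>U a - U b \<le> W i a - W i b\<close>, and a
  one-sided estimate for all pairs is enough.\<close>

lemma U_locLip: "locLip (UNIV - {0}) U"
  unfolding locLip_def
proof
  fix \<xi> :: "real^'d" assume "\<xi> \<in> UNIV - {0}"
  then have U\<xi>: "0 < U \<xi>" using U_pos by simp
  define c where "c = U \<xi> / 2"
  have c: "0 < c" "c < U \<xi>" using U\<xi> by (auto simp: c_def)
  have "\<exists>r L. 0 < r \<and> 0 \<le> L \<and> (\<forall>a\<in>ball \<xi> r. c < W i a \<longrightarrow> (\<forall>b\<in>ball \<xi> r. W i a - W i b \<le> L * dist a b))" if i: "i < n" for i
  proof (cases "bproj blk i \<xi> = 0")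
    case True
    then have "W i \<xi> = 0" using W_pos_iff[OF i, of \<xi>] W_nonneg[OF i, of \<xi>] by auto
    moreover have "isCont (W i) \<xi>" using W_continuous[OF i] by (simp add: continuous_on_eq_continuous_at)
    ultimately obtain d where d: "0 < d" "\<And>y. dist y \<xi> < d \<Longrightarrow> dist (W i y) 0 < c"
      using c unfolding continuous_at_eps_delta by metis
    have "\<not> c < W i a" if "a \<in> ball \<xi> d" for a using d(2)[of a] that by (auto simp: dist_commute)
    then show ?thesis using d by (intro exI[of _ d] exI[of _ 0]) auto
  next
    case False
    obtain r L where "0 < r" "0 \<le> L" "\<And>a b. a \<in> ball \<xi> r \<Longrightarrow> b \<in> ball \<xi> r \<Longrightarrow> \<bar>W i a - W i b\<bar> \<le> L * dist a b"
      using W_locally_lipschitz[OF i False] by blast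
    then show ?thesis using abs_le_D1 by blast
  qed
  then obtain r L where rL: "\<And>i. i < n \<Longrightarrow> 0 < r i" "\<And>i. i < n \<Longrightarrow> 0 \<le> L i"
    "\<And>i a b. i < n \<Longrightarrow> a \<in> ball \<xi> (r i) \<Longrightarrow> c < W i a \<Longrightarrow> b \<in> ball \<xi> (r i) \<Longrightarrow> W i a - W i b \<le> L i * dist a b"
    by metis
  have "isCont U \<xi>" using U_continuous by (simp add: continuous_on_eq_continuous_at)
  then obtain d where d: "0 < d" "\<And>y. dist y \<xi> < d \<Longrightarrow> dist (U y) (U \<xi>) < U \<xi> - c"
    using c unfolding continuous_at_eps_delta by (metis diff_gt_0_iff_gt)
  define \<rho> where "\<rho> = min d (Min (r ` {..<n}))"
  define K where "K = (\<Sum>i<n. L i)"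
  have \<rho>: "0 < \<rho>" using rL(1) d n_pos by (auto simp: \<rho>_def Min_gr_iff lessThan_empty_iff)
  have \<rho>r: "\<rho> \<le> r i" if "i < n" for i
  proof -
    have "Min (r ` {..<n}) \<le> r i" using that by (intro Min_le) auto
    then show ?thesis by (simp add: \<rho>_def)
  qed
  have le: "U a - U b \<le> K * dist a b" if ab: "a \<in> ball \<xi> \<rho>" "b \<in> ball \<xi> \<rho>" for a b
  proof -
    obtain i where i: "i < n" "U a = W i a" by (rule U_attained)
    have "dist (U a) (U \<xi>) < U \<xi> - c" using ab by (intro d) (auto simp: \<rho>_def dist_commute)
    then have "c < W i a" using i(2) by (simp add: dist_real_def abs_less_iff)
    then have "W i a - W i b \<le> L i * dist a b" using ab \<rho>r[OF i(1)] by (intro rL(3)[OF i(1)]) auto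
    also have "\<dots> \<le> K * dist a b"
      unfolding K_def using i rL(2) by (intro mult_right_mono member_le_sum) auto
    finally show ?thesis using i(2) W_le_U[OF i(1), of b] by linarith
  qed
  have "\<forall>a\<in>(UNIV - {0}) \<inter> ball \<xi> \<rho>. \<forall>b\<in>(UNIV - {0}) \<inter> ball \<xi> \<rho>. dist (U a) (U b) \<le> K * dist a b"
    using le by (auto simp: dist_real_def abs_le_iff) (metis dist_commute minus_diff_eq)
  then show "\<exists>\<delta>>0. \<exists>L. \<forall>a\<in>(UNIV - {0}) \<inter> ball \<xi> \<delta>. \<forall>b\<in>(UNIV - {0}) \<inter> ball \<xi> \<delta>. dist (U a) (U b) \<le> L * dist a b"
    using \<rho> by blast
qed

end

text \<open>The common source of both conclusions: \<open>ISS_Lyap\<close> with the gradient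
  condition replaced by a Dini condition at every nonzero state, which makes sense without
  differentiability.\<close>

definition dini_Lyap :: "('a::real_normed_vector \<Rightarrow> 'b::real_normed_vector \<Rightarrow> 'a) \<Rightarrow> ('a \<Rightarrow> real) \<Rightarrow> bool" where
  "dini_Lyap F U \<longleftrightarrow> continuous_on UNIV U \<and>
     (\<exists>\<psi>1 \<psi>2. classKinf \<psi>1 \<and> classKinf \<psi>2 \<and> (\<forall>x. \<psi>1 (norm x) \<le> U x \<and> U x \<le> \<psi>2 (norm x))) \<and>
     locLip (UNIV - {0}) U \<and>
     (\<exists>\<gamma> \<alpha>. classK \<gamma> \<and> posdef \<alpha> \<and>
        (\<forall>x u. x \<noteq> 0 \<longrightarrow> \<gamma> (norm u) \<le> U x \<longrightarrow> dini_decrease U x (F x u) (\<alpha> (norm x))))"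

context network begin

text \<open>With \<open>D = id + \<alpha>\<close>, the path condition \<open>D w < \<sigma>\<^sub>i r\<close> for a sum row leaves the room
  \<open>\<sigma>\<^sub>i r - w > \<alpha> (D\<^sup>-\<^sup>1 (\<sigma>\<^sub>i r))\<close> for the input.\<close>

definition \<phi> :: "nat \<Rightarrow> real \<Rightarrow> real" where
  "\<phi> i r = (if i \<in> Isum then \<alpha> (Kinv (\<lambda>s. s + \<alpha> s) (\<sigma> i r)) else (1 / 2) * \<sigma> i r)"

lemma \<phi>_Kinf: "i < n \<Longrightarrow> classKinf (\<phi> i)"
proof -
  assume i: "i < n"
  have D: "classKinf (\<lambda>s. s + \<alpha> s)" by (intro classKinf_add classKinf_id classKinf_classK alpha)
  have "classKinf (\<lambda>r. \<alpha> (Kinv (\<lambda>s. s + \<alpha> s) (\<sigma> i r)))"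
    by (rule classKinf_compose[OF alpha classKinf_compose[OF Kinv_classKinf[OF D] \<sigma>_Kinf[OF i]]])
  moreover have "classKinf (\<lambda>r. (1 / 2) * \<sigma> i r)"
    by (rule classKinf_compose[OF classKinf_cmult \<sigma>_Kinf[OF i]]) simp
  ultimately show ?thesis unfolding \<phi>_def[abs_def] by (cases "i \<in> Isum") simp_all
qed

lemma g_le_\<sigma>: "j < n \<Longrightarrow> 0 \<le> r \<Longrightarrow> W j x \<le> r \<Longrightarrow> g j x \<le> \<sigma> j r"
  using Kinv_le_iff[OF \<sigma>_Kinf, of j r "g j x"] g_nonneg[of j x] by (simp add: W_def)

text \<open>With \<open>r = U x\<close>, the active block sits on the path,
  \<open>g i x = \<sigma> i r\<close>, and all other blocks are at most \<open>\<sigma> j r\<close>.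
  Monotone gains bring in the path inequality at \<open>r\<close>, and \<open>\<phi> i r\<close> is
  the slack that the input may use.\<close>

lemma rhs_less_active:
  assumes i: "i < n" and x: "x \<noteq> 0" and act: "W i x = U x" and u: "gi i (norm u) \<le> \<phi> i (U x)"
  shows "rhs i u x < g i x"
proof -
  define r where "r = U x"
  have r: "0 < r" using U_pos[OF x] by (simp add: r_def)
  have gi: "g i x = \<sigma> i r"
    using Kinv_Kinf[OF \<sigma>_Kinf[OF i] g_nonneg[OF i, of x]] act by (simp add: W_def r_def)
  have le: "\<gamma> i j (g j x) \<le> \<gamma> i j (\<sigma> j r)" if j: "j < n" for j
    using g_le_\<sigma>[OF j, of r x] W_le_U[OF j, of x] r by (intro gain_function_le[OF gains[OF i j]] g_nonneg j) (simp_all add: r_def)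
  have \<sigma>0: "0 < \<sigma> i r" using classK_pos[OF classKinf_classK[OF \<sigma>_Kinf[OF i]] r] .
  show ?thesis
  proof (cases "i \<in> Isum")
    case True
    define w where "w = (\<Sum>j<n. \<gamma> i j (\<sigma> j r))"
    let ?D = "\<lambda>s. s + \<alpha> s"
    have D: "classKinf ?D" by (intro classKinf_add classKinf_id classKinf_classK alpha)
    have w0: "0 \<le> w" unfolding w_def
      using r by (intro sum_nonneg gain_function_nonneg[OF gains[OF i]] classK_nonneg[OF classKinf_classK[OF \<sigma>_Kinf]]) auto
    have "w + \<alpha> w < \<sigma> i r" using \<sigma>_path[OF r i] True by (simp add: Dalpha_def gain_op_def w_def)
    then have "w < Kinv ?D (\<sigma> i r)" using less_Kinv_iff[OF D w0, of "\<sigma> i r"] \<sigma>0 by simp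
    moreover have "Kinv ?D (\<sigma> i r) + \<alpha> (Kinv ?D (\<sigma> i r)) = \<sigma> i r" using Kinv_Kinf[OF D, of "\<sigma> i r"] \<sigma>0 by simp
    ultimately have "w + \<phi> i r < \<sigma> i r" using True by (simp add: \<phi>_def)
    moreover have "(\<Sum>j<n. \<gamma> i j (g j x)) \<le> w" unfolding w_def by (intro sum_mono le) auto
    ultimately show ?thesis using u True unfolding rhs_def gi r_def[symmetric] by simp
  next
    case False
    have "Max ((\<lambda>j. \<gamma> i j (g j x)) ` {..<n}) \<le> Max ((\<lambda>j. \<gamma> i j (\<sigma> j r)) ` {..<n})"
      using n_pos le by (intro Max_image_mono) auto
    also have "\<dots> < \<sigma> i r" using \<sigma>_path[OF r i] False by (simp add: Dalpha_def gain_op_def)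
    finally have "Max ((\<lambda>j. \<gamma> i j (g j x)) ` {..<n}) < \<sigma> i r" .
    moreover have "gi i (norm u) < \<sigma> i r" using u \<sigma>0 False by (simp add: \<phi>_def r_def)
    ultimately show ?thesis using False unfolding rhs_def gi by simp
  qed
qed

text \<open>An active component falls at least at rate \<open>e * e\<close>: rate \<open>e\<close>
  of \<open>g i\<close> times slope \<open>e\<close> of the inverse path. An inactive one is
  strictly below \<open>U x\<close> and stays there for small \<open>h\<close> by
  continuity.\<close>

lemma U_dini_decrease:
  assumes x: "x \<noteq> 0" and e: "0 < e"
    and act: "\<And>i. i < n \<Longrightarrow> W i x = U x \<Longrightarrow> dini_decrease (g i) x w e"
    and slope: "\<And>i s t. i < n \<Longrightarrow> W i x = U x \<Longrightarrow> g i x / 2 \<le> s \<Longrightarrow> s \<le> t \<Longrightarrow> t \<le> g i x \<Longrightarrow> e * (t - s) \<le> Kinv (\<sigma> i) t - Kinv (\<sigma> i) s"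
  shows "dini_decrease U x w (e * e)"
  unfolding dini_decrease_def
proof (intro allI impI)
  fix \<epsilon> :: real assume \<epsilon>: "0 < \<epsilon>"
  \<comment> \<open>The first bound keeps \<open>e - e1\<close> positive, the second makes the loss
    \<open>e * e1\<close> at most \<open>\<epsilon>\<close>.\<close>
  define e1 where "e1 = min (e / 2) (\<epsilon> / e)"
  have e1: "0 < e1" "e1 < e" "e * e1 \<le> \<epsilon>" using e \<epsilon> by (auto simp: e1_def min_def field_simps)
  have ev: "\<forall>\<^sub>F h in at_right 0. W i (x + h *\<^sub>R w) \<le> U x - h * (e * e - \<epsilon>)" if i: "i < n" for i
  proof (cases "W i x = U x")
    case True
    have gp: "0 < g i x" using U_pos[OF x] True W_pos_iff[OF i, of x] g_pos[OF i, of x] by simp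
    have "\<forall>\<^sub>F h in at_right 0. g i (x + h *\<^sub>R w) \<le> g i x - h * (e - e1)"
      using act[OF i True] e1 by (simp add: dini_decrease_def)
    moreover have "((\<lambda>h. h * (e - e1)) \<longlongrightarrow> 0 * (e - e1)) (at_right 0)" by (intro tendsto_intros)
    then have "\<forall>\<^sub>F h in at_right 0. h * (e - e1) < g i x / 2" using gp by (intro order_tendstoD(2)) auto
    ultimately show ?thesis using eventually_at_right_less[of 0]
    proof eventually_elim
      case (elim h)
      let ?s = "g i x - h * (e - e1)"
      have s: "g i x / 2 \<le> ?s" "?s \<le> g i x" using elim e1 by auto
      have "W i (x + h *\<^sub>R w) \<le> Kinv (\<sigma> i) ?s"
        unfolding W_def by (intro classK_le[OF Kinv_\<sigma>[OF i]] g_nonneg[OF i] elim)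
      moreover have "e * (g i x - ?s) \<le> Kinv (\<sigma> i) (g i x) - Kinv (\<sigma> i) ?s"
        by (rule slope[OF i True s order_refl])
      moreover have "h * (e * e1) \<le> h * \<epsilon>" using elim e1 by (intro mult_left_mono) auto
      ultimately show ?case using True by (simp add: W_def algebra_simps)
    qed
  next
    case False
    then have less: "W i x < U x" using W_le_U[OF i, of x] by simp
    have "((\<lambda>h. x + h *\<^sub>R w) \<longlongrightarrow> x + 0 *\<^sub>R w) (at_right 0)" by (intro tendsto_intros)
    then have "((\<lambda>h. W i (x + h *\<^sub>R w)) \<longlongrightarrow> W i x) (at_right 0)"
      using continuous_on_tendsto_compose[OF W_continuous[OF i], of "\<lambda>h. x + h *\<^sub>R w" x "at_right 0"] by simp
    then have "((\<lambda>h. W i (x + h *\<^sub>R w) + h * (e * e - \<epsilon>)) \<longlongrightarrow> W i x + 0 * (e * e - \<epsilon>)) (at_right 0)"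
      by (intro tendsto_intros)
    then have "\<forall>\<^sub>F h in at_right 0. W i (x + h *\<^sub>R w) + h * (e * e - \<epsilon>) < U x"
      using less by (intro order_tendstoD(2)) auto
    then show ?thesis by eventually_elim linarith
  qed
  have "\<forall>\<^sub>F h in at_right 0. \<forall>i\<in>{..<n}. W i (x + h *\<^sub>R w) \<le> U x - h * (e * e - \<epsilon>)"
    using ev by (intro eventually_ball_finite) auto
  then show "\<forall>\<^sub>F h in at_right 0. U (x + h *\<^sub>R w) \<le> U x - h * (e * e - \<epsilon>)"
  proof eventually_elim
    case (elim h)
    obtain i where "i < n" "U (x + h *\<^sub>R w) = W i (x + h *\<^sub>R w)" by (rule U_attained)
    then show ?case using elim by simp
  qed
qed

text \<open>Over an annulus an active block cannot be small: \<open>g i x = \<sigma> i (U x)\<close>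
  lies between \<open>v1\<close> and \<open>v2\<close>, so the norm of the block ranges over a
  compact interval away from 0. There \<open>\<alpha>i i\<close> has a positive minimum and the
  inverse path a positive least slope.\<close>

lemma active_rate_bound:
  assumes i: "i < n" and ab: "0 < a" "a \<le> b"
  shows "\<exists>e>0. \<forall>x. norm x \<in> {a..b} \<longrightarrow> W i x = U x \<longrightarrow> e \<le> \<alpha>i i (norm (bproj blk i x)) \<and>
     (\<forall>s t. g i x / 2 \<le> s \<longrightarrow> s \<le> t \<longrightarrow> t \<le> g i x \<longrightarrow> e * (t - s) \<le> Kinv (\<sigma> i) t - Kinv (\<sigma> i) s)"
proof -
  obtain \<psi>1 \<psi>2 where \<psi>: "classKinf \<psi>1" "classKinf \<psi>2" "\<And>x. \<psi>1 (norm x) \<le> U x" "\<And>x. U x \<le> \<psi>2 (norm x)"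
    using U_proper by blast
  obtain p1 p2 where "classKinf p1" and p2: "classKinf p2"
    and gp2: "\<And>x. p1 (norm (bproj blk i x)) \<le> g i x \<and> g i x \<le> p2 (norm (bproj blk i x))"
    using g_bounds[OF i] by blast
  note K = classKinf_classK[OF \<psi>(1)] classKinf_classK[OF \<psi>(2)] classKinf_classK[OF \<sigma>_Kinf[OF i]] classKinf_classK[OF p2]
  define v1 where "v1 = \<sigma> i (\<psi>1 a)"
  define v2 where "v2 = \<sigma> i (\<psi>2 b)"
  define l where "l = Kinv p2 v1"
  have v1: "0 < v1" unfolding v1_def by (rule classK_pos[OF K(3) classK_pos[OF K(1) ab(1)]])
  have l: "0 < l" unfolding l_def using v1 classK_pos[OF classKinf_classK[OF Kinv_classKinf[OF p2]]] by simp
  have gv: "v1 \<le> g i x" "g i x \<le> v2" if x: "norm x \<in> {a..b}" "W i x = U x" for x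
  proof -
    have gi: "g i x = \<sigma> i (U x)"
      using Kinv_Kinf[OF \<sigma>_Kinf[OF i] g_nonneg[OF i, of x]] x by (simp add: W_def)
    have "\<psi>1 a \<le> U x" using classK_le[OF K(1), of a "norm x"] \<psi>(3)[of x] x ab by simp
    then show "v1 \<le> g i x" unfolding gi v1_def using ab by (intro classK_le[OF K(3)] classK_nonneg[OF K(1)]) auto
    have "U x \<le> \<psi>2 b" using classK_le[OF K(2), of "norm x" b] \<psi>(4)[of x] x ab by simp
    moreover have "0 \<le> U x" using W_nonneg[OF i, of x] x by simp
    ultimately show "g i x \<le> v2" unfolding gi v2_def by (intro classK_le[OF K(3)]) auto
  qed
  have nl: "norm (bproj blk i x) \<in> {l..max l b}" if x: "norm x \<in> {a..b}" "W i x = U x" for x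
  proof -
    have "v1 \<le> p2 (norm (bproj blk i x))" using gv(1)[OF x] gp2[of x] by linarith
    then have "l \<le> norm (bproj blk i x)" unfolding l_def using Kinv_le_iff[OF p2, of "norm (bproj blk i x)" v1] v1 by simp
    then show ?thesis using norm_bproj_le[of blk i x] x by auto
  qed
  have pd: "posdef (\<alpha>i i)" using subISS[OF i] unfolding sub_ISS_Lyap_def by blast
  have "continuous_on {l..max l b} (\<alpha>i i)"
    using pd l unfolding posdef_def by (auto intro: continuous_on_subset)
  moreover have "compact {l..max l b}" "{l..max l b} \<noteq> {}" by auto
  ultimately obtain m0 where m0: "m0 \<in> {l..max l b}" "\<And>s. s \<in> {l..max l b} \<Longrightarrow> \<alpha>i i m0 \<le> \<alpha>i i s"
    using continuous_attains_inf[of "{l..max l b}" "\<alpha>i i"] by blast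
  have "0 < m0" using m0(1) l by simp
  then have m0p: "0 < \<alpha>i i m0" using pd unfolding posdef_def by (metis less_eq_real_def order_less_irrefl)
  show ?thesis
  \<comment> \<open>For \<open>v1 > v2\<close> no state satisfies the premises, and any positive
    \<open>e\<close> will do.\<close>
  proof (cases "v1 \<le> v2")
    case False
    then have "\<not> (norm x \<in> {a..b} \<and> W i x = U x)" for x using gv[of x] by auto
    then show ?thesis using zero_less_one by blast
  next
    case True
    then have "0 < v1 / 2" "v1 / 2 \<le> v2" using v1 by auto
    then obtain c where c: "0 < c" "\<And>s t. v1 / 2 \<le> s \<Longrightarrow> s \<le> t \<Longrightarrow> t \<le> v2 \<Longrightarrow> c * (t - s) \<le> Kinv (\<sigma> i) t - Kinv (\<sigma> i) s"
      using \<sigma>_slope[OF i] unfolding slope_below_def by blast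
    define e where "e = min c (\<alpha>i i m0)"
    have "e \<le> \<alpha>i i (norm (bproj blk i x)) \<and> (\<forall>s t. g i x / 2 \<le> s \<longrightarrow> s \<le> t \<longrightarrow> t \<le> g i x \<longrightarrow> e * (t - s) \<le> Kinv (\<sigma> i) t - Kinv (\<sigma> i) s)"
      if x: "norm x \<in> {a..b}" "W i x = U x" for x
    proof (intro conjI allI impI)
      show "e \<le> \<alpha>i i (norm (bproj blk i x))" using m0(2)[OF nl[OF x]] by (simp add: e_def)
      fix s t assume st: "g i x / 2 \<le> s" "s \<le> t" "t \<le> g i x"
      have "e * (t - s) \<le> c * (t - s)" using st by (intro mult_right_mono) (auto simp: e_def)
      also have "\<dots> \<le> Kinv (\<sigma> i) t - Kinv (\<sigma> i) s" using st gv[OF x] by (intro c) auto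
      finally show "e * (t - s) \<le> Kinv (\<sigma> i) t - Kinv (\<sigma> i) s" .
    qed
    moreover have "0 < e" using c m0p by (simp add: e_def)
    ultimately show ?thesis by blast
  qed
qed

text \<open>The gain \<open>\<gamma>0\<close> dominates every inverse of \<open>\<phi> i\<close>
  applied to \<open>gi i\<close>, so above it the input fits into the slack of each active row.
  Rates on annuli are merged by \<open>posdef_minorant\<close> into one function of the
  norm.\<close>

lemma U_dini_Lyap: "dini_Lyap F U"
  unfolding dini_Lyap_def
proof (intro conjI U_continuous U_proper U_locLip)
  have "\<And>i. i < n \<Longrightarrow> classK (\<lambda>r. Kinv (\<phi> i) (gi i r))"
  proof -
    fix i assume i: "i < n"
    have "classK (gi i)" using subISS[OF i] unfolding sub_ISS_Lyap_def by blast
    then show "classK (\<lambda>r. Kinv (\<phi> i) (gi i r))"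
      by (rule classK_compose[OF classKinf_classK[OF Kinv_classKinf[OF \<phi>_Kinf[OF i]]]])
  qed
  note K1 = this
  have "\<exists>\<psi>. classK \<psi> \<and> (\<forall>i<n. \<forall>r\<ge>0. Kinv (\<phi> i) (gi i r) \<le> \<psi> r)"
    by (rule classK_finite_upper) (erule K1)
  then obtain \<gamma>0 where
    \<gamma>0': "classK \<gamma>0 \<and> (\<forall>i<n. \<forall>r\<ge>0. Kinv (\<phi> i) (gi i r) \<le> \<gamma>0 r)" by (elim exE)
  then have \<gamma>0: "classK \<gamma>0" "\<And>i r. i < n \<Longrightarrow> 0 \<le> r \<Longrightarrow> Kinv (\<phi> i) (gi i r) \<le> \<gamma>0 r"
    by simp_all
  have active: "dini_decrease (g i) x (F x u) (\<alpha>i i (norm (bproj blk i x)))"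
    if i: "i < n" "W i x = U x" and x: "x \<noteq> 0" and u: "\<gamma>0 (norm u) \<le> U x" for i x u
  proof (rule g_dini_decrease[OF i(1)])
    show "bproj blk i x \<noteq> 0" using W_pos_iff[OF i(1), of x] U_pos[OF x] i(2) by simp
    have "classK (gi i)" using subISS[OF i(1)] unfolding sub_ISS_Lyap_def by blast
    then have "0 \<le> gi i (norm u)" by (rule classK_nonneg) simp
    moreover have "Kinv (\<phi> i) (gi i (norm u)) \<le> U x" using \<gamma>0(2)[OF i(1), of "norm u"] u by simp
    ultimately have "gi i (norm u) \<le> \<phi> i (U x)"
      using Kinv_le_iff[OF \<phi>_Kinf[OF i(1)], of "U x" "gi i (norm u)"] U_pos[OF x] by simp
    then show "rhs i u x < g i x" by (rule rhs_less_active[OF i(1) x i(2)])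
  qed
  define P where "P = (\<lambda>\<rho> e. \<forall>x u. norm x = \<rho> \<longrightarrow> x \<noteq> 0 \<longrightarrow> \<gamma>0 (norm u) \<le> U x \<longrightarrow> dini_decrease U x (F x u) e)"
  have mono: "P \<rho> e'" if "P \<rho> e" "0 < e'" "e' \<le> e" for \<rho> e e'
    using that dini_decrease_mono unfolding P_def by blast
  have loc: "\<exists>e>0. \<forall>\<rho>\<in>{a..b}. P \<rho> e" if ab: "0 < a" "a \<le> b" for a b
  proof -
    obtain e where e: "\<And>i. i < n \<Longrightarrow> 0 < e i"
      "\<And>i x. i < n \<Longrightarrow> norm x \<in> {a..b} \<Longrightarrow> W i x = U x \<Longrightarrow> e i \<le> \<alpha>i i (norm (bproj blk i x))"
      "\<And>i x s t. i < n \<Longrightarrow> norm x \<in> {a..b} \<Longrightarrow> W i x = U x \<Longrightarrow> g i x / 2 \<le> s \<Longrightarrow> s \<le> t \<Longrightarrow> t \<le> g i x \<Longrightarrow> e i * (t - s) \<le> Kinv (\<sigma> i) t - Kinv (\<sigma> i) s"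
      using active_rate_bound[OF _ ab] by metis
    define e0 where "e0 = Min (e ` {..<n})"
    have e0: "0 < e0" "\<And>i. i < n \<Longrightarrow> e0 \<le> e i" using e(1) n_pos by (auto simp: e0_def Min_gr_iff lessThan_empty_iff)
    have "P \<rho> (e0 * e0)" if \<rho>: "\<rho> \<in> {a..b}" for \<rho>
      unfolding P_def
    proof (intro allI impI)
      fix x :: "real^'d" and u :: "real^'m" assume x: "norm x = \<rho>" "x \<noteq> 0" and u: "\<gamma>0 (norm u) \<le> U x"
      show "dini_decrease U x (F x u) (e0 * e0)"
      proof (rule U_dini_decrease[OF x(2) e0(1)])
        fix i assume i: "i < n" "W i x = U x"
        have "e0 \<le> \<alpha>i i (norm (bproj blk i x))" using e(2)[OF i(1) _ i(2)] e0(2)[OF i(1)] x \<rho> by fastforce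
        then show "dini_decrease (g i) x (F x u) e0"
          using dini_decrease_mono[OF active[OF i x(2) u]] by blast
        fix s t assume st: "g i x / 2 \<le> s" "s \<le> t" "t \<le> g i x"
        have "e0 * (t - s) \<le> e i * (t - s)" using e0(2)[OF i(1)] st by (intro mult_right_mono) auto
        also have "\<dots> \<le> Kinv (\<sigma> i) t - Kinv (\<sigma> i) s" using x \<rho> by (intro e(3)[OF i(1) _ i(2) st]) auto
        finally show "e0 * (t - s) \<le> Kinv (\<sigma> i) t - Kinv (\<sigma> i) s" .
      qed
    qed
    then show ?thesis using e0 by (intro exI[of _ "e0 * e0"]) auto
  qed
  obtain q where q: "posdef q" "\<And>\<rho>. 0 < \<rho> \<Longrightarrow> P \<rho> (q \<rho>)"
    by (rule posdef_minorant[of P], erule mono, assumption, assumption, erule loc, assumption, blast)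
  show "\<exists>\<gamma> \<alpha>. classK \<gamma> \<and> posdef \<alpha> \<and>
        (\<forall>x u. x \<noteq> 0 \<longrightarrow> \<gamma> (norm u) \<le> U x \<longrightarrow> dini_decrease U x (F x u) (\<alpha> (norm x)))"
    using \<gamma>0(1) q unfolding P_def by (intro exI[of _ \<gamma>0] exI[of _ q]) auto
qed

end

lemma dini_Lyap_imp_ISS_Lyap:
  fixes F :: "real^'d::finite \<Rightarrow> real^'m::finite \<Rightarrow> real^'d"
  assumes "dini_Lyap F U"
  shows "ISS_Lyap F U"
proof -
  obtain \<psi>1 \<psi>2 where \<psi>: "classKinf \<psi>1" "classKinf \<psi>2" "\<And>x. \<psi>1 (norm x) \<le> U x \<and> U x \<le> \<psi>2 (norm x)"
    using assms unfolding dini_Lyap_def by blast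
  obtain \<gamma> \<alpha> where \<gamma>: "classK \<gamma>" "posdef \<alpha>"
    "\<And>x u. x \<noteq> 0 \<Longrightarrow> \<gamma> (norm u) \<le> U x \<Longrightarrow> dini_decrease U x (F x u) (\<alpha> (norm x))"
    using assms unfolding dini_Lyap_def by blast
  have "D (F x u) \<le> - \<alpha> (norm x)" if D: "(U has_derivative D) (at x)" and u: "\<gamma> (norm u) \<le> U x" for x u D
  proof (cases "x = 0")
    case False
    then show ?thesis using dini_decrease_derivative[OF D \<gamma>(3)[OF False u]] by blast
  next
    case True
    \<comment> \<open>At the origin \<open>U\<close> has its minimum, so a derivative there
      vanishes, which is the bound required since \<open>\<alpha> 0 = 0\<close>.\<close>
    have "U 0 = 0" using \<psi>(3)[of 0] classK_zero[OF classKinf_classK[OF \<psi>(1)]] classK_zero[OF classKinf_classK[OF \<psi>(2)]] by simp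
    moreover have "0 \<le> U y" for y using \<psi>(3)[of y] classK_nonneg[OF classKinf_classK[OF \<psi>(1)], of "norm y"] by simp
    ultimately have "\<forall>y\<in>ball 0 1. U 0 \<le> U y" by simp
    then have "D = (\<lambda>h. 0)"
      using differential_zero_maxmin[of 0 "ball 0 1" U D] D True by simp
    moreover have "\<alpha> 0 = 0" using \<gamma>(2) by (simp add: posdef_def)
    ultimately show ?thesis using True by simp
  qed
  then show ?thesis using assms \<gamma>(1,2) unfolding ISS_Lyap_def dini_Lyap_def by blast
qed

section \<open>From Dini decrease to input-to-state stability\<close>

lemma classKL_exp:
  assumes A: "classKinf A" and B: "classKinf B"
  shows "classKL (\<lambda>r t. A (B r * exp (- t)))"
  unfolding classKL_def
proof (intro conjI allI impI)
  note K = classKinf_classK[OF A] classKinf_classK[OF B]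
  have B0: "0 \<le> B r" if "0 \<le> r" for r by (rule classK_nonneg[OF K(2) that])
  have "continuous_on ({0..} \<times> {0..}) (\<lambda>p::real \<times> real. B (fst p))"
    by (rule continuous_on_compose2[OF classK_cont[OF K(2)] continuous_on_fst[OF continuous_on_id]]) auto
  then have "continuous_on ({0..} \<times> {0..}) (\<lambda>p. B (fst p) * exp (- snd p))"
    by (intro continuous_on_mult continuous_on_exp continuous_on_minus continuous_on_snd[OF continuous_on_id])
  then have "continuous_on ({0..} \<times> {0..}) (\<lambda>p. A (B (fst p) * exp (- snd p)))"
    by (rule continuous_on_compose2[OF classK_cont[OF K(1)]]) (auto simp: B0)
  then show "continuous_on ({0..} \<times> {0..}) (\<lambda>(r, t). A (B r * exp (- t)))" by (simp add: case_prod_unfold)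
  show "classK (\<lambda>r. A (B r * exp (- t)))" for t
  proof -
    have "classKinf (\<lambda>r. A (exp (- t) * B r))"
      by (rule classKinf_compose[OF A classKinf_compose[OF classKinf_cmult B]]) simp
    then show ?thesis using classKinf_classK by (simp add: mult.commute)
  qed
  fix r :: real assume r: "0 \<le> r"
  show "A (B r * exp (- t2)) \<le> A (B r * exp (- t1))" if "0 \<le> t1" "t1 \<le> t2" for t1 t2
    using that B0[OF r] by (intro classK_le[OF K(1)] mult_left_mono) auto
  have "((\<lambda>t. B r * exp (- t)) \<longlongrightarrow> B r * 0) at_top"
    by (intro tendsto_mult tendsto_const filterlim_compose[OF exp_at_bot] filterlim_uminus_at_bot_at_top)
  then have "((\<lambda>t. A (B r * exp (- t))) \<longlongrightarrow> A 0) at_top"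
    using B0[OF r] by (intro continuous_on_tendsto_compose[OF classK_cont[OF K(1)]]) auto
  then show "((\<lambda>t. A (B r * exp (- t))) \<longlongrightarrow> 0) at_top" by (simp add: classK_zero[OF K(1)])
qed

text \<open>Along solutions of \<open>v' = - \<kappa> v\<close> the function \<open>G\<close> decreases at unit speed; since
  \<open>\<kappa> v \<le> v\<close>, \<open>exp \<circ> G\<close> extends to a function of class \<open>K\<^sub>\<infinity>\<close>.\<close>

lemma rate_to_Kinf:
  fixes \<kappa> :: "real \<Rightarrow> real"
  assumes cont: "continuous_on {0<..} \<kappa>" and pos: "\<And>s. 0 < s \<Longrightarrow> 0 < \<kappa> s" and le: "\<And>s. 0 < s \<Longrightarrow> \<kappa> s \<le> s"
  obtains G where "\<And>s. 0 < s \<Longrightarrow> (G has_real_derivative 1 / \<kappa> s) (at s)"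
    "classKinf (\<lambda>s. if s \<le> 0 then 0 else exp (G s))"
proof -
  define G where "G = (\<lambda>s. LBINT y=ereal 1..ereal s. 1 / \<kappa> y)"
  have deriv: "(G has_real_derivative 1 / \<kappa> s) (at s)" if s: "0 < s" for s
  proof -
    \<comment> \<open>The interval must contain both the base point 1 of the integral and
      \<open>s\<close> in its interior, and stay within the positive axis.\<close>
    define a b where "a = min 1 s / 2" and "b = max 1 s + 1"
    have ab: "0 < a" "a < s" "s < b" "a \<le> 1" "1 \<le> b" using s by (auto simp: a_def b_def min_def)
    have nz: "\<kappa> y \<noteq> 0" if "y \<in> {a..b}" for y using pos[of y] that ab by auto
    have "continuous_on {a..b} \<kappa>" using ab by (intro continuous_on_subset[OF cont]) auto
    then have "continuous_on {a..b} (\<lambda>y. 1 / \<kappa> y)"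
      using nz by (intro continuous_on_divide continuous_on_const) auto
    then have "(G has_vector_derivative 1 / \<kappa> s) (at s within {a..b})"
      unfolding G_def using ab by (intro interval_integral_FTC2) auto
    then have "(G has_vector_derivative 1 / \<kappa> s) (at s within {a<..<b})"
      by (rule has_vector_derivative_within_subset) auto
    then have "(G has_vector_derivative 1 / \<kappa> s) (at s)"
      using ab at_within_open[of s "{a<..<b}"] by simp
    then show ?thesis by (simp add: has_real_derivative_iff_has_vector_derivative)
  qed
  have G1: "G 1 = 0" by (simp add: G_def)
  have mono: "G s - ln s \<le> G t - ln t" if st: "0 < s" "s \<le> t" for s t
  proof (rule DERIV_nonneg_imp_nondecreasing[OF st(2)])
    fix x assume x: "s \<le> x" "x \<le> t"
    then have xp: "0 < x" using st by simp
    have "((\<lambda>x. G x - ln x) has_real_derivative 1 / \<kappa> x - 1 / x) (at x)"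
      using xp deriv[OF xp] by (auto intro!: derivative_eq_intros simp: inverse_eq_divide)
    \<comment> \<open>Here \<open>\<kappa> s \<le> s\<close> enters: \<open>G\<close> grows at least
      as fast as \<open>ln\<close>, so it tends to minus infinity at 0 and to infinity at
      infinity.\<close>
    moreover have "0 \<le> 1 / \<kappa> x - 1 / x" using pos[OF xp] le[OF xp] xp by (simp add: frac_le)
    ultimately show "\<exists>y. ((\<lambda>x. G x - ln x) has_real_derivative y) (at x) \<and> 0 \<le> y" by blast
  qed
  have less: "G s < G t" if st: "0 < s" "s < t" for s t
  proof -
    have "ln s < ln t" using st by simp
    then show ?thesis using mono[of s t] st by linarith
  qed
  define H where "H = (\<lambda>s. if s \<le> 0 then 0 else exp (G s))"
  have H_le: "H s \<le> s" if "0 \<le> s" "s \<le> 1" for s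
  proof (cases "s = 0")
    case False
    then have "0 < s" using that by simp
    then have "G s \<le> ln s" using mono[of s 1] that G1 by simp
    then have "exp (G s) \<le> s" using \<open>0 < s\<close> by (metis exp_le_cancel_iff exp_ln)
    then show ?thesis using \<open>0 < s\<close> by (simp add: H_def)
  qed (simp add: H_def)
  have "classK H"
    unfolding classK_def
  proof (intro conjI)
    show "H 0 = 0" by (simp add: H_def)
    show "strict_mono_on {0..} H" using less by (intro strict_mono_onI) (auto simp: H_def)
    show "continuous_on {0..} H"
      unfolding continuous_on_eq_continuous_within
    proof
      fix x :: real assume x: "x \<in> {0..}"
      show "continuous (at x within {0..}) H"
      proof (cases "x = 0")
        case True
        show ?thesis unfolding continuous_within_eps_delta
        proof (intro allI impI)
          fix e :: real assume e: "0 < e"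
          have "dist (H y) (H x) < e" if "y \<in> {0..}" "dist y x < min 1 e" for y
          proof -
            have y: "0 \<le> y" "y < 1" "y < e" using that True by (auto simp: dist_real_def)
            moreover have "0 \<le> H y" by (simp add: H_def)
            moreover have "H x = 0" using True by (simp add: H_def)
            ultimately show ?thesis using H_le[of y] by (simp add: dist_real_def)
          qed
          then show "\<exists>d>0. \<forall>y\<in>{0..}. dist y x < d \<longrightarrow> dist (H y) (H x) < e"
            using e by (intro exI[of _ "min 1 e"]) auto
        qed
      next
        case False
        then have xp: "0 < x" using x by simp
        have "isCont (\<lambda>s. exp (G s)) x" using DERIV_isCont[OF deriv[OF xp]] by (intro continuous_intros)
        moreover have "\<forall>\<^sub>F s in nhds x. exp (G s) = H s"
          using eventually_nhds_in_open[of "{0<..}" x] xp by (auto elim!: eventually_mono simp: H_def)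
        ultimately have "isCont H x" by (simp add: isCont_cong)
        then show ?thesis by (rule continuous_at_imp_continuous_within)
      qed
    qed
  qed
  moreover have "filterlim H at_top at_top"
  proof (rule filterlim_at_top_mono[OF filterlim_ident])
    show "\<forall>\<^sub>F s in at_top. s \<le> H s"
      using eventually_ge_at_top[of 1]
    proof eventually_elim
      case (elim s)
      then have "ln s \<le> G s" using mono[of 1 s] G1 by simp
      then have "s \<le> exp (G s)" using elim by (metis exp_le_cancel_iff exp_ln less_le_trans zero_less_one)
      then show ?case using elim by (simp add: H_def)
    qed
  qed
  ultimately have "classKinf H" by (simp add: classKinf_def)
  then show ?thesis using that[of G] deriv by (simp add: H_def)
qed

section \<open>Inputs and Caratheodory solutions\<close>

lemma linf_AE:
  assumes "admissible_input u"
  shows "0 \<le> linf u" "AE t in lborel. 0 \<le> t \<longrightarrow> norm (u t) \<le> linf u"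
proof -
  let ?S = "{c. 0 \<le> c \<and> (AE t in lborel. 0 \<le> t \<longrightarrow> norm (u t) \<le> c)}"
  obtain c where c: "AE t in lborel. 0 \<le> t \<longrightarrow> norm (u t) \<le> c" using assms by (auto simp: admissible_input_def)
  then have "AE t in lborel. 0 \<le> t \<longrightarrow> norm (u t) \<le> max 0 c" by (rule eventually_mono) auto
  then have ne: "?S \<noteq> {}" by (auto intro!: exI[of _ "max 0 c"])
  show "0 \<le> linf u" unfolding linf_def by (rule cInf_greatest[OF ne]) auto
  \<comment> \<open>Each bound slightly above the infimum holds almost everywhere; countably many of
    them hold off a single null set, so the infimum is attained.\<close>
  have "AE t in lborel. \<forall>k::nat. 0 \<le> t \<longrightarrow> norm (u t) \<le> linf u + 1 / Suc k"
    unfolding AE_all_countable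
  proof
    fix k :: nat
    have "Inf ?S < linf u + 1 / Suc k" by (simp add: linf_def)
    then obtain d where "d \<in> ?S" "d < linf u + 1 / Suc k" using cInf_lessD[OF ne] by blast
    then show "AE t in lborel. 0 \<le> t \<longrightarrow> norm (u t) \<le> linf u + 1 / Suc k"
      by (auto elim!: eventually_mono)
  qed
  then show "AE t in lborel. 0 \<le> t \<longrightarrow> norm (u t) \<le> linf u"
  proof (rule eventually_mono, intro impI)
    fix t :: real assume *: "\<forall>k::nat. 0 \<le> t \<longrightarrow> norm (u t) \<le> linf u + 1 / Suc k" "0 \<le> t"
    have "(\<lambda>k. linf u + 1 / real (Suc k)) \<longlonglongrightarrow> linf u + 0"
      by (intro tendsto_add tendsto_const LIMSEQ_Suc[OF lim_1_over_n])
    then show "norm (u t) \<le> linf u" using * by (intro LIMSEQ_le_const) auto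
  qed
qed

lemma has_integral_bound_AE:
  fixes f :: "real \<Rightarrow> 'x::euclidean_space"
  assumes f: "(f has_integral I) {a..b}" and "a \<le> b" and B: "0 \<le> B"
    and ae: "AE t in lborel. a \<le> t \<longrightarrow> t \<le> b \<longrightarrow> norm (f t) \<le> B"
  shows "norm I \<le> B * (b - a)"
proof -
  let ?g = "\<lambda>t. if norm (f t) \<le> B then f t else 0"
  have ae': "AE t in lborel. t \<in> {a..b} \<longrightarrow> f t = ?g t" using ae by (rule eventually_mono) auto
  have "(?g has_integral I) {a..b}" using f unfolding has_integral_AE[OF ae'] .
  then show ?thesis
    using has_integral_bound[of B ?g I a b] B \<open>a \<le> b\<close> by auto
qed

lemma solution_increment:
  assumes sol: "is_solution F u x T" and st: "0 \<le> s" "s \<le> t" "t \<le> T"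
  shows "((\<lambda>r. F (x r) (u r)) has_integral (x t - x s)) {s..t}"
proof -
  let ?f = "\<lambda>r. F (x r) (u r)"
  have 1: "(?f has_integral (x t - x 0)) {0..t}" and 2: "(?f has_integral (x s - x 0)) {0..s}"
    using sol st unfolding is_solution_def by auto
  have "?f integrable_on {0..t}" using 1 by (rule has_integral_integrable)
  then have "?f integrable_on {s..t}" by (rule integrable_subinterval_real) (use st in auto)
  then obtain I where I: "(?f has_integral I) {s..t}" by blast
  have "(?f has_integral ((x s - x 0) + I)) {0..t}" by (rule has_integral_combine[OF st(1,2) 2 I])
  then have "(x s - x 0) + I = x t - x 0" using 1 has_integral_unique by blast
  then have "I = x t - x s" by (simp add: algebra_simps)
  then show ?thesis using I by simp
qed

lemma solution_lipschitz:
  fixes F :: "'x::euclidean_space \<Rightarrow> 'm::euclidean_space \<Rightarrow> 'x"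
  assumes Fc: "continuous_on UNIV (case_prod F)" and sol: "is_solution F u x T"
    and c: "AE t in lborel. 0 \<le> t \<longrightarrow> norm (u t) \<le> c"
  shows "\<exists>K. K-lipschitz_on {0..T} x"
proof -
  have xc: "continuous_on {0..T} x" using sol by (simp add: is_solution_def)
  have "compact ((x ` {0..T}) \<times> cball (0::'m) c)"
    by (intro compact_Times compact_continuous_image[OF xc] compact_Icc compact_cball)
  then have "compact (case_prod F ` ((x ` {0..T}) \<times> cball (0::'m) c))"
    by (intro compact_continuous_image continuous_on_subset[OF Fc]) auto
  then obtain K where K: "0 < K" "\<And>y. y \<in> case_prod F ` ((x ` {0..T}) \<times> cball (0::'m) c) \<Longrightarrow> norm y \<le> K"
    using compact_imp_bounded bounded_pos by metis
  have "K-lipschitz_on {0..T} x"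
  proof (rule lipschitz_on_leI)
    fix s t assume st: "s \<in> {0..T}" "t \<in> {0..T}" "s \<le> t"
    have "norm (x t - x s) \<le> K * (t - s)"
    proof (rule has_integral_bound_AE[OF solution_increment[OF sol] st(3)])
      show "AE r in lborel. s \<le> r \<longrightarrow> r \<le> t \<longrightarrow> norm (F (x r) (u r)) \<le> K"
        using c
      proof (eventually_elim, intro impI)
        fix r assume "0 \<le> r \<longrightarrow> norm (u r) \<le> c" "s \<le> r" "r \<le> t"
        then have "F (x r) (u r) \<in> case_prod F ` ((x ` {0..T}) \<times> cball (0::'m) c)"
          using st by (intro image_eqI[of _ _ "(x r, u r)"]) auto
        then show "norm (F (x r) (u r)) \<le> K" by (rule K(2))
      qed
    qed (use st K in auto)
    then show "dist (x s) (x t) \<le> K * dist s t" using st by (simp add: dist_norm norm_minus_commute)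
  qed (use K in auto)
  then show ?thesis by blast
qed

text \<open>Lebesgue differentiation of the right-hand side, extended by 0 outside
  \<open>[0, T]\<close>. It gives right-hand averages, which is the side on which the Dini condition
  looks.\<close>

lemma solution_right_derivative_AE:
  fixes F :: "'x::euclidean_space \<Rightarrow> 'm::euclidean_space \<Rightarrow> 'x"
  assumes sol: "is_solution F u x T" and T: "0 \<le> T"
  shows "AE t in lborel. 0 < t \<longrightarrow> t < T \<longrightarrow> (\<forall>e>0. \<forall>\<^sub>F h in at_right 0. norm (x (t + h) - x t - h *\<^sub>R F (x t) (u t)) \<le> e * h)"
proof -
  let ?f = "\<lambda>r. F (x r) (u r)"
  let ?g = "\<lambda>r. if r \<in> {0..T} then ?f r else 0"
  have "(?f has_integral (x T - x 0)) {0..T}" using sol T unfolding is_solution_def by auto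
  then have "?f integrable_on {0..T}" by (rule has_integral_integrable)
  then have "?g integrable_on UNIV" by (simp only: integrable_restrict_UNIV)
  then have gi: "?g integrable_on cbox a b" for a b by (rule integrable_on_subcbox) simp
  obtain N where N: "negligible N" "\<And>t e. \<lbrakk>t \<notin> N; 0 < e\<rbrakk> \<Longrightarrow> \<exists>d>0. \<forall>h. 0 < h \<and> h < d \<longrightarrow>
      norm (integral (cbox t (t + h *\<^sub>R One)) ?g /\<^sub>R h ^ DIM(real) - ?g t) < e"
    by (rule integrable_ccontinuous_explicit[OF gi]) (rule that)
  show ?thesis
    using negligible_AE_lborel[OF N(1)]
  proof (eventually_elim, intro impI allI)
    fix t e :: real assume t: "t \<notin> N" "0 < t" "t < T" and e: "0 < e"
    obtain d where d: "0 < d" "\<And>h. 0 < h \<Longrightarrow> h < d \<Longrightarrow> norm (integral {t..t+h} ?g /\<^sub>R h - ?g t) < e"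
      using N(2)[OF t(1) e] by auto
    have "norm (x (t + h) - x t - h *\<^sub>R ?f t) \<le> e * h" if h: "0 < h" "h < min d (T - t)" for h
    proof -
      have "(?f has_integral (x (t + h) - x t)) {t..t+h}"
        using t h by (intro solution_increment[OF sol]) auto
      then have "(?g has_integral (x (t + h) - x t)) {t..t+h}"
        by (rule has_integral_eq[rotated]) (use t h in auto)
      then have "integral {t..t+h} ?g = x (t + h) - x t" by (rule integral_unique)
      moreover have "?g t = ?f t" using t by simp
      ultimately have "norm ((x (t + h) - x t) /\<^sub>R h - ?f t) < e" using d(2)[of h] h by simp
      moreover have "x (t + h) - x t - h *\<^sub>R ?f t = h *\<^sub>R ((x (t + h) - x t) /\<^sub>R h - ?f t)"
        using h by (simp add: scaleR_diff_right)
      ultimately show ?thesis using h by (simp add: mult.commute)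
    qed
    then show "\<forall>\<^sub>F h in at_right 0. norm (x (t + h) - x t - h *\<^sub>R ?f t) \<le> e * h"
      unfolding eventually_at_right_field using d t by (intro exI[of _ "min d (T - t)"]) auto
  qed
qed

text \<open>The solution deviates from the straight line in direction \<open>w\<close> by a small
  multiple of \<open>h\<close>, and the local Lipschitz bound turns this into an equally small error
  in \<open>U\<close>.\<close>

lemma dini_decrease_along_solution:
  fixes F :: "'x::euclidean_space \<Rightarrow> 'm::euclidean_space \<Rightarrow> 'x"
  assumes lip: "locLip (UNIV - {0}) U" and x0: "x t \<noteq> 0"
    and dini: "dini_decrease U (x t) w a"
    and der: "\<And>e. 0 < e \<Longrightarrow> \<forall>\<^sub>F h in at_right 0. norm (x (t + h) - x t - h *\<^sub>R w) \<le> e * h"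
    and e: "0 < e"
  shows "\<forall>\<^sub>F h in at_right 0. U (x (t + h)) \<le> U (x t) - h * (a - e)"
proof -
  obtain \<delta> L where \<delta>: "0 < \<delta>" and L: "\<And>p q. p \<in> (UNIV - {0}) \<inter> ball (x t) \<delta> \<Longrightarrow> q \<in> (UNIV - {0}) \<inter> ball (x t) \<delta> \<Longrightarrow>
      dist (U p) (U q) \<le> L * dist p q"
    using lip x0 unfolding locLip_def by blast
  \<comment> \<open>Both points to be compared must avoid the origin, near which no Lipschitz bound
    is at hand.\<close>
  define r where "r = min \<delta> (norm (x t))"
  have r: "0 < r" using \<delta> x0 by (simp add: r_def)
  have inr: "p \<in> (UNIV - {0}) \<inter> ball (x t) \<delta>" if "norm (p - x t) < r" for p
    using that by (auto simp: r_def dist_norm norm_minus_commute)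
  define \<epsilon> where "\<epsilon> = e / (2 * (\<bar>L\<bar> + 1))"
  have \<epsilon>: "0 < \<epsilon>" using e by (simp add: \<epsilon>_def)
  have L\<epsilon>: "\<bar>L\<bar> * \<epsilon> \<le> e / 2"
  proof -
    have "\<bar>L\<bar> * \<epsilon> \<le> (\<bar>L\<bar> + 1) * \<epsilon>" using \<epsilon> by (intro mult_right_mono) auto
    also have "\<dots> = e / 2" by (simp add: \<epsilon>_def field_simps)
    finally show ?thesis .
  qed
  have "((\<lambda>h. h * (\<epsilon> + norm w)) \<longlongrightarrow> 0 * (\<epsilon> + norm w)) (at_right 0)" by (intro tendsto_intros)
  then have E1: "\<forall>\<^sub>F h in at_right 0. h * (\<epsilon> + norm w) < r" using r by (intro order_tendstoD(2)) auto
  have E2: "\<forall>\<^sub>F h in at_right 0. U (x t + h *\<^sub>R w) \<le> U (x t) - h * (a - e / 2)"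
    using dini e by (simp add: dini_decrease_def)
  show ?thesis
    using E1 E2 der[OF \<epsilon>] eventually_at_right_less[of 0]
  proof eventually_elim
    case (elim h)
    have n1: "norm ((x t + h *\<^sub>R w) - x t) < r"
    proof -
      have "h * norm w \<le> h * (\<epsilon> + norm w)" using elim \<epsilon> by (intro mult_left_mono) auto
      then have "h * norm w < r" using elim(1) by linarith
      then show ?thesis using elim(4) by simp
    qed
    have n2: "norm (x (t + h) - x t) < r"
    proof -
      have "norm (x (t + h) - x t) \<le> norm (x (t + h) - x t - h *\<^sub>R w) + norm (h *\<^sub>R w)"
        using norm_triangle_ineq[of "x (t + h) - x t - h *\<^sub>R w" "h *\<^sub>R w"] by simp
      also have "\<dots> \<le> \<epsilon> * h + h * norm w" using elim by simp
      also have "\<dots> = h * (\<epsilon> + norm w)" by (simp add: algebra_simps)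
      finally show ?thesis using elim by linarith
    qed
    have "U (x (t + h)) - U (x t + h *\<^sub>R w) \<le> L * norm (x (t + h) - (x t + h *\<^sub>R w))"
      using L[OF inr[OF n2] inr[OF n1]] by (simp add: dist_norm)
    also have "\<dots> \<le> \<bar>L\<bar> * (\<epsilon> * h)" using elim by (intro mult_mono) (auto simp: algebra_simps)
    also have "\<dots> \<le> (e / 2) * h" using L\<epsilon> elim by (simp add: mult.assoc[symmetric] mult_right_mono)
    finally show ?case using elim by (simp add: algebra_simps)
  qed
qed

text \<open>The decay rate depends on the value of \<open>U\<close>, so that
  \<open>v t = U (x t)\<close> obeys the scalar inequality \<open>v' \<le> - \<kappa> v\<close>. The
  primitive \<open>G\<close> of \<open>1 / \<kappa>\<close> converts it into decrease at unit speed,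
  without a comparison theorem for differential equations.\<close>

locale dini_system =
  fixes F :: "'x::euclidean_space \<Rightarrow> 'm::euclidean_space \<Rightarrow> 'x" and U :: "'x \<Rightarrow> real"
    and \<psi>1 \<psi>2 \<gamma> \<kappa> G :: "real \<Rightarrow> real"
  assumes F_cont: "continuous_on UNIV (case_prod F)" and U_cont: "continuous_on UNIV U"
    and \<psi>: "classKinf \<psi>1" "classKinf \<psi>2" "\<And>x. \<psi>1 (norm x) \<le> U x" "\<And>x. U x \<le> \<psi>2 (norm x)"
    and U_lip: "locLip (UNIV - {0}) U"
    and \<gamma>: "classK \<gamma>" and dini: "\<And>x u. x \<noteq> 0 \<Longrightarrow> \<gamma> (norm u) \<le> U x \<Longrightarrow> dini_decrease U x (F x u) (\<kappa> (U x))"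
    and \<kappa>: "continuous_on {0<..} \<kappa>" "\<And>s. 0 < s \<Longrightarrow> 0 < \<kappa> s"
    and G: "\<And>s. 0 < s \<Longrightarrow> (G has_real_derivative 1 / \<kappa> s) (at s)"
      "classKinf (\<lambda>s. if s \<le> 0 then 0 else exp (G s))"
begin

lemma U_pos: "x \<noteq> 0 \<Longrightarrow> 0 < U x"
  using classK_pos[OF classKinf_classK[OF \<psi>(1)], of "norm x"] \<psi>(3)[of x] by simp

lemma U_0: "U 0 = 0"
  using \<psi>(3)[of 0] \<psi>(4)[of 0] classK_zero[OF classKinf_classK[OF \<psi>(1)]] classK_zero[OF classKinf_classK[OF \<psi>(2)]] by simp

lemma G_less: "0 < s \<Longrightarrow> s < t \<Longrightarrow> G s < G t"
  using classK_less[OF classKinf_classK[OF G(2)], of s t] by simp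

lemma G_le: "0 < s \<Longrightarrow> s \<le> t \<Longrightarrow> G s \<le> G t"
  using G_less[of s t] by (cases "s = t") auto

lemma G_lipschitz:
  assumes ab: "0 < a" "a \<le> b"
  shows "\<exists>L. L-lipschitz_on {a..b} G"
proof -
  have "continuous_on {a..b} \<kappa>" using ab by (intro continuous_on_subset[OF \<kappa>(1)]) auto
  moreover have "compact {a..b}" "{a..b} \<noteq> {}" using ab by auto
  ultimately obtain m where m: "m \<in> {a..b}" "\<And>s. s \<in> {a..b} \<Longrightarrow> \<kappa> m \<le> \<kappa> s"
    using continuous_attains_inf[of "{a..b}" \<kappa>] by blast
  have \<kappa>m: "0 < \<kappa> m" using m ab by (intro \<kappa>(2)) auto
  have "(1 / \<kappa> m)-lipschitz_on {a..b} G"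
  proof (rule bounded_derivative_imp_lipschitz[where f'="\<lambda>s h. 1 / \<kappa> s * h"])
    fix s assume s: "s \<in> {a..b}"
    then have sp: "0 < s" using ab by simp
    show "(G has_derivative (\<lambda>h. 1 / \<kappa> s * h)) (at s within {a..b})"
      using G(1)[OF sp] unfolding has_field_derivative_def by (rule has_derivative_at_withinI)
    show "onorm (\<lambda>h. 1 / \<kappa> s * h) \<le> 1 / \<kappa> m"
    proof (rule onorm_le)
      fix h :: real
      have "1 / \<kappa> s \<le> 1 / \<kappa> m" using m(2)[OF s] \<kappa>m by (intro divide_left_mono) (auto intro!: mult_pos_pos \<kappa>(2)[OF sp])
      then have "(1 / \<kappa> s) * \<bar>h\<bar> \<le> (1 / \<kappa> m) * \<bar>h\<bar>" by (intro mult_right_mono) auto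
      then show "norm (1 / \<kappa> s * h) \<le> 1 / \<kappa> m * norm h" using \<kappa>(2)[OF sp] by (simp add: abs_mult)
    qed
  qed (use \<kappa>m in auto)
  then show ?thesis by blast
qed

text \<open>On a time interval on which the state avoids 0, the composition of \<open>G\<close>,
  \<open>U\<close> and the solution is Lipschitz, each factor being so on a compact set. Its
  derivative, where it exists, is at most \<open>- 1\<close> almost everywhere by the Dini
  estimate.\<close>

lemma G_decrease:
  assumes sol: "is_solution F u x T" and c: "AE t in lborel. 0 \<le> t \<longrightarrow> norm (u t) \<le> c"
    and st: "0 \<le> s" "s \<le> t" "t \<le> T"
    and big: "\<And>r. r \<in> {s..t} \<Longrightarrow> x r \<noteq> 0 \<and> \<gamma> c \<le> U (x r)"
  shows "G (U (x t)) \<le> G (U (x s)) - (t - s)"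
proof -
  define v where "v = (\<lambda>r. U (x r))"
  have xc: "continuous_on {s..t} x"
    using sol st unfolding is_solution_def by (auto elim!: continuous_on_subset)
  obtain K where "K-lipschitz_on {0..T} x" using solution_lipschitz[OF F_cont sol c] by blast
  then have xl: "K-lipschitz_on {s..t} x" by (rule lipschitz_on_subset) (use st in auto)
  have "compact (x ` {s..t})" by (intro compact_continuous_image xc compact_Icc)
  moreover have "locLip (x ` {s..t}) U" by (rule locLip_subset[OF U_lip]) (use big in auto)
  ultimately obtain L where "L-lipschitz_on (x ` {s..t}) U" using locLip_compact_lipschitz by blast
  from lipschitz_on_compose2[OF xl this] have vl: "(L * K)-lipschitz_on {s..t} v" by (simp add: v_def)
  have vc: "continuous_on {s..t} v" using vl by (rule lipschitz_on_continuous_on)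
  have vpos: "0 < v r" if "r \<in> {s..t}" for r using big[OF that] U_pos by (simp add: v_def)
  have ne: "compact {s..t}" "{s..t} \<noteq> {}" using st by auto
  obtain m1 where m1: "m1 \<in> {s..t}" "\<And>r. r \<in> {s..t} \<Longrightarrow> v m1 \<le> v r" using continuous_attains_inf[OF ne vc] by blast
  obtain m2 where m2: "m2 \<in> {s..t}" "\<And>r. r \<in> {s..t} \<Longrightarrow> v r \<le> v m2" using continuous_attains_sup[OF ne vc] by blast
  obtain LG where "LG-lipschitz_on {v m1..v m2} G" using G_lipschitz[of "v m1" "v m2"] vpos[OF m1(1)] m2(2)[OF m1(1)] by blast
  then have "LG-lipschitz_on (v ` {s..t}) G" by (rule lipschitz_on_subset) (use m1 m2 in auto)
  from lipschitz_on_compose2[OF vl this] have Gv: "(LG * (L * K))-lipschitz_on {s..t} (\<lambda>r. G (v r))" .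
  have T0: "0 \<le> T" using st by simp
  have "AE r in lborel. s < r \<longrightarrow> r < t \<longrightarrow> (\<forall>d. ((\<lambda>r. G (v r)) has_real_derivative d) (at r) \<longrightarrow> d \<le> - 1)"
    using solution_right_derivative_AE[OF sol T0] c
  proof (eventually_elim, intro impI allI)
    fix r d assume rd: "0 < r \<longrightarrow> r < T \<longrightarrow> (\<forall>e>0. \<forall>\<^sub>F h in at_right 0. norm (x (r + h) - x r - h *\<^sub>R F (x r) (u r)) \<le> e * h)"
      and ur: "0 \<le> r \<longrightarrow> norm (u r) \<le> c" and r: "s < r" "r < t" and d: "((\<lambda>r. G (v r)) has_real_derivative d) (at r)"
    have rin: "r \<in> {s..t}" using r by simp
    define k where "k = \<kappa> (v r)"
    have k: "0 < k" using \<kappa>(2)[OF vpos[OF rin]] by (simp add: k_def)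
    have der: "\<forall>\<^sub>F h in at_right 0. norm (x (r + h) - x r - h *\<^sub>R F (x r) (u r)) \<le> e * h" if "0 < e" for e
      using rd r st that by auto
    have "\<gamma> (norm (u r)) \<le> \<gamma> c" using ur r st by (intro classK_le[OF \<gamma>]) auto
    then have dd: "dini_decrease U (x r) (F (x r) (u r)) k"
      unfolding k_def v_def using big[OF rin] by (intro dini) auto
    show "d \<le> - 1"
    proof (rule field_le_epsilon)
      fix \<epsilon> :: real assume \<epsilon>: "0 < \<epsilon>"
      \<comment> \<open>The slope of \<open>G\<close> at \<open>v r\<close> is \<open>1 / k\<close>,
        so an error \<open>e\<close> in the decay of \<open>v\<close> becomes
        \<open>\<epsilon>\<close> in the decay of \<open>G\<close>.\<close>
      define e where "e = \<epsilon> * k"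
      have e: "0 < e" using \<epsilon> k by (simp add: e_def)
      have ev: "\<forall>\<^sub>F h in at_right 0. v (r + h) \<le> v r - h * (k - e)"
        unfolding v_def using big[OF rin] by (intro dini_decrease_along_solution[OF U_lip _ dd der e]) auto
      have "((\<lambda>h. v r - h * (k - e)) has_real_derivative - (k - e)) (at 0)"
        by (auto intro!: derivative_eq_intros)
      moreover have "(G has_real_derivative 1 / k) (at (v r - 0 * (k - e)))"
        unfolding k_def using G(1)[OF vpos[OF rin]] by simp
      ultimately have "((\<lambda>h. G (v r - h * (k - e))) has_real_derivative (1 / k) * - (k - e)) (at 0)"
        by (rule DERIV_chain2[rotated])
      then have "((\<lambda>h. (G (v r - h * (k - e)) - G (v r)) / h) \<longlongrightarrow> (1 / k) * - (k - e)) (at 0)"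
        by (simp add: has_field_derivative_iff)
      then have lim2: "((\<lambda>h. (G (v r - h * (k - e)) - G (v r)) / h) \<longlongrightarrow> (1 / k) * - (k - e)) (at_right 0)"
        by (rule tendsto_within_subset) auto
      have "((\<lambda>h. (G (v (r + h)) - G (v r)) / h) \<longlongrightarrow> d) (at 0)"
        using d by (simp add: DERIV_def)
      then have lim1: "((\<lambda>h. (G (v (r + h)) - G (v r)) / h) \<longlongrightarrow> d) (at_right 0)"
        by (rule tendsto_within_subset) auto
      have "\<forall>\<^sub>F h in at_right 0. h < t - r" using r by (auto simp: eventually_at_right_field intro!: exI[of _ "t - r"])
      then have "\<forall>\<^sub>F h in at_right 0. (G (v (r + h)) - G (v r)) / h \<le> (G (v r - h * (k - e)) - G (v r)) / h"
        using ev eventually_at_right_less[of 0]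
      proof eventually_elim
        case (elim h)
        have "0 < v (r + h)" using elim r by (intro vpos) auto
        then have "G (v (r + h)) \<le> G (v r - h * (k - e))" using elim by (intro G_le) auto
        then show ?case using elim by (intro divide_right_mono) auto
      qed
      then have "d \<le> (1 / k) * - (k - e)" by (rule tendsto_le[OF trivial_limit_at_right_real lim2 lim1])
      also have "\<dots> = - 1 + \<epsilon>" using k by (simp add: e_def field_simps)
      finally show "d \<le> - 1 + \<epsilon>" .
    qed
  qed
  from lipschitz_real_increment_le[OF Gv st(2) this] show ?thesis by (simp add: v_def)
qed

definition H :: "real \<Rightarrow> real" where "H = (\<lambda>s. if s \<le> 0 then 0 else exp (G s))"

lemma H_Kinf: "classKinf H" unfolding H_def by (rule G(2))

text \<open>If \<open>v\<close> exceeds \<open>\<gamma> c\<close> up to time \<open>t\<close>, the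
  unit-speed decrease acts on the whole interval and gives the exponential bound. Otherwise
  \<open>v\<close> has a last time at or below that level; from then on it can only fall, so it
  cannot have climbed above the level at time \<open>t\<close>.\<close>

lemma U_estimate:
  assumes sol: "is_solution F u x T" and c: "AE t in lborel. 0 \<le> t \<longrightarrow> norm (u t) \<le> c" "0 \<le> c"
    and t: "0 \<le> t" "t \<le> T"
  shows "U (x t) \<le> \<gamma> c \<or> U (x t) \<le> Kinv H (H (U (x 0)) * exp (- t))"
proof (rule disjCI)
  assume "\<not> U (x t) \<le> Kinv H (H (U (x 0)) * exp (- t))"
  show "U (x t) \<le> \<gamma> c"
  proof (rule ccontr)
    assume gt: "\<not> U (x t) \<le> \<gamma> c"
    define v where "v = (\<lambda>r. U (x r))"
    have \<gamma>c: "0 \<le> \<gamma> c" by (rule classK_nonneg[OF \<gamma> c(2)])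
    have xc: "continuous_on {0..t} x"
      using sol t unfolding is_solution_def by (auto elim!: continuous_on_subset)
    have vc: "continuous_on {0..t} v" unfolding v_def
      by (rule continuous_on_compose2[OF U_cont xc]) auto
    have nz: "x r \<noteq> 0" if "\<gamma> c < v r" for r using that \<gamma>c U_0 by (auto simp: v_def)
    have dec: "G (v t) \<le> G (v s) - (t - s)" if s: "0 \<le> s" "s \<le> t" "\<And>r. r \<in> {s..t} \<Longrightarrow> \<gamma> c < v r" for s
      unfolding v_def using s nz t by (intro G_decrease[OF sol c(1)]) (auto simp: v_def less_imp_le)
    define S where "S = {r \<in> {0..t}. v r \<le> \<gamma> c}"
    show False
    proof (cases "S = {}")
      case True
      then have all: "\<gamma> c < v r" if "r \<in> {0..t}" for r using that by (auto simp: S_def)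
      have p: "0 < v t" "0 < v 0" using all[of t] all[of 0] \<gamma>c t by auto
      have "G (v t) \<le> G (v 0) - t" using dec[of 0] all t by simp
      then have "exp (G (v t)) \<le> exp (G (v 0) - t)" by simp
      then have "H (v t) \<le> H (v 0) * exp (- t)" using p by (simp add: H_def exp_diff exp_minus divide_inverse)
      moreover have "v t = Kinv H (H (v t))" using Kinv_cancel[OF H_Kinf, of "v t"] p by simp
      ultimately have "v t \<le> Kinv H (H (v 0) * exp (- t))"
        using classK_le[OF classKinf_classK[OF Kinv_classKinf[OF H_Kinf]], of "H (v t)" "H (v 0) * exp (- t)"]
          classK_nonneg[OF classKinf_classK[OF H_Kinf], of "v t"] p by simp
      then show False using \<open>\<not> U (x t) \<le> Kinv H (H (U (x 0)) * exp (- t))\<close> by (simp add: v_def)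
    next
      case False
      have "closed S"
        unfolding S_def using continuous_closed_preimage[OF vc closed_real_atLeastAtMost closed_atMost[of "\<gamma> c"]]
        by (simp add: vimage_def Int_def)
      moreover have bdd: "bdd_above S" by (rule bdd_aboveI[of _ t]) (auto simp: S_def)
      ultimately have "Sup S \<in> S" using closed_contains_Sup[OF False] by blast
      then have s: "0 \<le> Sup S" "Sup S \<le> t" "v (Sup S) \<le> \<gamma> c" by (auto simp: S_def)
      have st: "Sup S < t" using s gt by (cases "Sup S = t") (auto simp: v_def)
      have after: "\<gamma> c < v r" if "Sup S < r" "r \<le> t" for r
      proof (rule ccontr)
        assume "\<not> \<gamma> c < v r"
        then have "r \<in> S" using that s by (auto simp: S_def)
        then show False using cSup_upper[OF _ bdd] that by fastforce
      qed
      \<comment> \<open>Claimed only after \<open>Sup S\<close>, where the decrease is available;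
        the value at \<open>Sup S\<close> itself is reached as a limit from the right.\<close>
      have le: "v t \<le> v r" if r: "Sup S < r" "r \<le> t" for r
      proof (rule ccontr)
        assume "\<not> v t \<le> v r"
        moreover have "0 < v r" using after[OF r] \<gamma>c by simp
        ultimately have "G (v r) < G (v t)" by (intro G_less) auto
        moreover have "G (v t) \<le> G (v r) - (t - r)" using r s after by (intro dec) auto
        ultimately show False using r by simp
      qed
      have "(v \<longlongrightarrow> v (Sup S)) (at (Sup S) within {0..t})" using vc s by (auto simp: continuous_on_def)
      then have "(v \<longlongrightarrow> v (Sup S)) (at (Sup S) within {Sup S..t})"
        by (rule tendsto_within_subset) (use s in auto)
      moreover have "at (Sup S) within {Sup S..t} = at_right (Sup S)"
        using st by (rule at_within_Icc_at_right)
      ultimately have lim: "(v \<longlongrightarrow> v (Sup S)) (at_right (Sup S))" by simp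
      have "\<forall>\<^sub>F r in at_right (Sup S). v t \<le> v r"
        using st le by (auto simp: eventually_at_right_field intro!: exI[of _ t])
      then have "v t \<le> v (Sup S)" by (rule tendsto_lowerbound[OF lim]) simp
      then show False using s gt by (simp add: v_def)
    qed
  qed
qed

text \<open>\<open>H = exp \<circ> G\<close> decays like \<open>exp (- t)\<close> along solutions.
  Undoing \<open>H\<close> and sandwiching \<open>U\<close> between \<open>\<psi>1\<close> and
  \<open>\<psi>2\<close> of the norm gives \<open>\<beta>\<close>; the other alternative of
  \<open>U_estimate\<close> gives \<open>\<gamma>'\<close>.\<close>

lemma solution_estimate:
  "\<exists>\<beta> \<gamma>'. classKL \<beta> \<and> classK \<gamma>' \<and> (\<forall>u x T c. 0 \<le> c \<longrightarrow> (AE t in lborel. 0 \<le> t \<longrightarrow> norm (u t) \<le> c) \<longrightarrow> is_solution F u x T \<longrightarrow>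
           (\<forall>t\<in>{0..T}. norm (x t) \<le> \<beta> (norm (x 0)) t + \<gamma>' c))"
proof -
  define \<beta> where "\<beta> = (\<lambda>r t. Kinv \<psi>1 (Kinv H (H (\<psi>2 r) * exp (- t))))"
  define \<gamma>' where "\<gamma>' = (\<lambda>c. Kinv \<psi>1 (\<gamma> c))"
  note KH = classKinf_classK[OF H_Kinf] and KHi = classKinf_classK[OF Kinv_classKinf[OF H_Kinf]]
    and Kp = classKinf_classK[OF Kinv_classKinf[OF \<psi>(1)]] and Kp2 = classKinf_classK[OF \<psi>(2)]
  have "classKL \<beta>" unfolding \<beta>_def
    by (rule classKL_exp[OF classKinf_compose[OF Kinv_classKinf[OF \<psi>(1)] Kinv_classKinf[OF H_Kinf]] classKinf_compose[OF H_Kinf \<psi>(2)]])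
  moreover have "classK \<gamma>'" unfolding \<gamma>'_def by (rule classK_compose[OF Kp \<gamma>])
  moreover have "norm (x t) \<le> \<beta> (norm (x 0)) t + \<gamma>' c"
    if c: "0 \<le> c" "AE t in lborel. 0 \<le> t \<longrightarrow> norm (u t) \<le> c" and sol: "is_solution F u x T" and t: "t \<in> {0..T}" for u x T c t
  proof -
    have U0: "0 \<le> U y" for y using U_pos[of y] U_0 by (cases "y = 0") auto
    have h0: "0 \<le> H (\<psi>2 (norm (x 0))) * exp (- t)"
      by (intro mult_nonneg_nonneg classK_nonneg[OF KH] classK_nonneg[OF Kp2]) auto
    have b0: "0 \<le> \<beta> (norm (x 0)) t" unfolding \<beta>_def by (intro classK_nonneg[OF Kp] classK_nonneg[OF KHi] h0)
    have g0: "0 \<le> \<gamma>' c" unfolding \<gamma>'_def by (intro classK_nonneg[OF Kp] classK_nonneg[OF \<gamma>] c)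
    have nx: "norm (x t) \<le> Kinv \<psi>1 (U (x t))"
    proof -
      have "norm (x t) = Kinv \<psi>1 (\<psi>1 (norm (x t)))" using Kinv_cancel[OF \<psi>(1)] by simp
      also have "\<dots> \<le> Kinv \<psi>1 (U (x t))"
        by (intro classK_le[OF Kp] classK_nonneg[OF classKinf_classK[OF \<psi>(1)]] \<psi>(3)) auto
      finally show ?thesis .
    qed
    from U_estimate[OF sol c(2,1), of t] t consider "U (x t) \<le> \<gamma> c" | "U (x t) \<le> Kinv H (H (U (x 0)) * exp (- t))" by auto
    then show ?thesis
    proof cases
      case 1
      then have "Kinv \<psi>1 (U (x t)) \<le> \<gamma>' c" unfolding \<gamma>'_def by (intro classK_le[OF Kp] U0)
      then show ?thesis using nx b0 by linarith
    next
      case 2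
      have "H (U (x 0)) * exp (- t) \<le> H (\<psi>2 (norm (x 0))) * exp (- t)"
        by (intro mult_right_mono classK_le[OF KH] U0 \<psi>(4)) auto
      then have "Kinv H (H (U (x 0)) * exp (- t)) \<le> Kinv H (H (\<psi>2 (norm (x 0))) * exp (- t))"
        by (intro classK_le[OF KHi] mult_nonneg_nonneg classK_nonneg[OF KH] U0) auto
      then have "Kinv \<psi>1 (U (x t)) \<le> \<beta> (norm (x 0)) t"
        unfolding \<beta>_def using 2 by (intro classK_le[OF Kp] U0) auto
      then show ?thesis using nx g0 by linarith
    qed
  qed
  ultimately show ?thesis by blast
qed

end

text \<open>For \<open>a \<le> U x \<le> b\<close> the norm lies in a compact interval away from 0,
  on which \<open>\<alpha>\<close> has a positive minimum. Hence a rate in the norm can be replaced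
  by a rate \<open>\<kappa>\<close> in the value of \<open>U\<close>, with
  \<open>\<kappa> v \<le> v\<close>.\<close>

lemma dini_Lyap_solution_estimate:
  fixes F :: "'x::euclidean_space \<Rightarrow> 'm::euclidean_space \<Rightarrow> 'x"
  assumes Fc: "continuous_on UNIV (case_prod F)" and "dini_Lyap F U"
  shows "\<exists>\<beta> \<gamma>. classKL \<beta> \<and> classK \<gamma> \<and> (\<forall>u x T c. 0 \<le> c \<longrightarrow> (AE t in lborel. 0 \<le> t \<longrightarrow> norm (u t) \<le> c) \<longrightarrow> is_solution F u x T \<longrightarrow>
           (\<forall>t\<in>{0..T}. norm (x t) \<le> \<beta> (norm (x 0)) t + \<gamma> c))"
proof -
  obtain \<psi>1 \<psi>2 where \<psi>: "classKinf \<psi>1" "classKinf \<psi>2" "\<And>x. \<psi>1 (norm x) \<le> U x" "\<And>x. U x \<le> \<psi>2 (norm x)"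
    using assms unfolding dini_Lyap_def by blast
  obtain \<gamma> \<alpha> where \<gamma>: "classK \<gamma>" "posdef \<alpha>"
    "\<And>x u. x \<noteq> 0 \<Longrightarrow> \<gamma> (norm u) \<le> U x \<Longrightarrow> dini_decrease U x (F x u) (\<alpha> (norm x))"
    using assms unfolding dini_Lyap_def by blast
  note K = classKinf_classK[OF \<psi>(1)] classKinf_classK[OF \<psi>(2)]
  define P where "P = (\<lambda>v e. \<forall>x. U x = v \<longrightarrow> e \<le> \<alpha> (norm x))"
  have mono: "P v e'" if "P v e" "0 < e'" "e' \<le> e" for v e e'
    using that unfolding P_def by fastforce
  have loc: "\<exists>e>0. \<forall>v\<in>{a..b}. P v e" if ab: "0 < a" "a \<le> b" for a b
  proof -
    define l where "l = Kinv \<psi>2 a"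
    define h where "h = max l (Kinv \<psi>1 b)"
    have l: "0 < l" unfolding l_def using ab by (intro classK_pos[OF classKinf_classK[OF Kinv_classKinf[OF \<psi>(2)]]])
    have "continuous_on {l..h} \<alpha>" using \<gamma>(2) l unfolding posdef_def by (auto intro: continuous_on_subset)
    moreover have "compact {l..h}" "{l..h} \<noteq> {}" by (auto simp: h_def)
    ultimately obtain m where m: "m \<in> {l..h}" "\<And>s. s \<in> {l..h} \<Longrightarrow> \<alpha> m \<le> \<alpha> s"
      using continuous_attains_inf[of "{l..h}" \<alpha>] by blast
    have "0 < m" using m l by simp
    then have "0 < \<alpha> m" using \<gamma>(2) unfolding posdef_def by (metis less_eq_real_def order_less_irrefl)
    moreover have "P v (\<alpha> m)" if v: "v \<in> {a..b}" for v
      unfolding P_def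
    proof (intro allI impI)
      fix x assume x: "U x = v"
      have "a \<le> \<psi>2 (norm x)" using \<psi>(4)[of x] x v by auto
      then have "l \<le> norm x" unfolding l_def using Kinv_le_iff[OF \<psi>(2), of "norm x" a] ab by simp
      moreover have "norm x \<le> Kinv \<psi>1 b"
      proof (rule ccontr)
        assume "\<not> norm x \<le> Kinv \<psi>1 b"
        then have "b < \<psi>1 (norm x)" using Kinv_less_iff[OF \<psi>(1), of "norm x" b] ab by simp
        then show False using \<psi>(3)[of x] x v by simp
      qed
      ultimately show "\<alpha> m \<le> \<alpha> (norm x)" by (intro m(2)) (auto simp: h_def)
    qed
    ultimately show ?thesis by blast
  qed
  obtain \<kappa> where \<kappa>: "posdef \<kappa>" "\<And>v. 0 < v \<Longrightarrow> P v (\<kappa> v)" "\<And>v. 0 \<le> v \<Longrightarrow> \<kappa> v \<le> v"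
    by (rule posdef_minorant[of P], erule mono, assumption, assumption, erule loc, assumption, blast)
  have \<kappa>c: "continuous_on {0<..} \<kappa>" using \<kappa>(1) unfolding posdef_def by (auto intro: continuous_on_subset)
  have \<kappa>p: "0 < \<kappa> s" if "0 < s" for s using \<kappa>(1) that unfolding posdef_def by (metis less_eq_real_def order_less_irrefl)
  obtain G where G: "\<And>s. 0 < s \<Longrightarrow> (G has_real_derivative 1 / \<kappa> s) (at s)"
    "classKinf (\<lambda>s. if s \<le> 0 then 0 else exp (G s))"
    using rate_to_Kinf[OF \<kappa>c \<kappa>p] \<kappa>(3) by (metis less_imp_le)
  interpret dini_system F U \<psi>1 \<psi>2 \<gamma> \<kappa> G
  proof
    show "continuous_on UNIV (case_prod F)" by (rule Fc)
    show "continuous_on UNIV U" "locLip (UNIV - {0}) U" using assms by (auto simp: dini_Lyap_def)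
    fix x :: 'x and u :: 'm assume xu: "x \<noteq> 0" "\<gamma> (norm u) \<le> U x"
    have "0 < U x" using classK_pos[OF K(1), of "norm x"] \<psi>(3)[of x] xu(1) by simp
    then have "\<kappa> (U x) \<le> \<alpha> (norm x)" using \<kappa>(2)[of "U x"] by (simp add: P_def)
    then show "dini_decrease U x (F x u) (\<kappa> (U x))" by (rule dini_decrease_mono[OF \<gamma>(3)[OF xu]])
  qed (use \<psi> \<gamma> \<kappa>c \<kappa>p G in auto)
  show ?thesis by (rule solution_estimate)
qed

section \<open>Global existence of solutions\<close>

lemma measurable_bounded_integrable_on:
  fixes f :: "real \<Rightarrow> 'x::euclidean_space"
  assumes [measurable]: "f \<in> borel_measurable borel" and B: "\<And>s. norm (f s) \<le> B"
  shows "f integrable_on {a..b}"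
proof -
  have "integrable lborel (\<lambda>s. indicator {a..b} s *\<^sub>R f s)"
  proof (rule Bochner_Integration.integrable_bound)
    show "integrable lborel (\<lambda>s. indicator {a..b} s * B :: real)"
      by (intro integrable_mult_left integrable_real_indicator) (use emeasure_bounded_finite[of "{a..b}"] in auto)
    have "0 \<le> B" using B[of 0] norm_ge_zero order_trans by blast
    then show "AE s in lborel. norm (indicator {a..b} s *\<^sub>R f s) \<le> norm (indicator {a..b} s * B)"
      using B by (intro AE_I2) (auto simp: indicator_def)
  qed auto
  then have "set_integrable lborel {a..b} f" by (simp add: set_integrable_def)
  then show ?thesis by (rule set_borel_integral_eq_integral(1))
qed

text \<open>Picard iteration converges at once on \<open>[0, \<infinity>)\<close> in the norm weighted by \<open>exp (- 2 L t)\<close>.\<close>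

lemma bounded_lipschitz_global_solution:
  fixes f :: "real \<Rightarrow> 'x::euclidean_space \<Rightarrow> 'x"
  assumes meas: "\<And>y. continuous_on UNIV y \<Longrightarrow> (\<lambda>s. f s (y s)) \<in> borel_measurable borel"
    and bound: "\<And>s y. norm (f s y) \<le> K"
    and lip: "\<And>s y z. norm (f s y - f s z) \<le> L * norm (y - z)" and L: "0 < L"
  shows "\<exists>x. continuous_on UNIV x \<and> x 0 = x0 \<and> (\<forall>t\<ge>0. ((\<lambda>s. f s (x s)) has_integral (x t - x0)) {0..t})"
proof -
  define l where "l = 2 * L"
  have l: "0 < l" using L by (simp add: l_def)
  have K0: "0 \<le> K" using bound[of 0 0] norm_ge_zero order_trans by blast
  \<comment> \<open>The unknown \<open>y\<close> is the solution divided by the weight, and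
    \<open>Y\<close> restores the weight. The sup norm of bounded continuous functions thus plays
    the role of the weighted norm.\<close>
  define Y where "Y = (\<lambda>(y :: real \<Rightarrow>\<^sub>C 'x) s. exp (l * s) *\<^sub>R y s)"
  have yc: "continuous_on UNIV (apply_bcontfun y)" for y :: "real \<Rightarrow>\<^sub>C 'x"
    using apply_bcontfun[of y] by (simp add: bcontfun_def)
  have Yc: "continuous_on UNIV (Y y)" for y unfolding Y_def by (intro continuous_intros yc)
  have int: "(\<lambda>s. f s (Y y s)) integrable_on {a..b}" for y a b
    by (rule measurable_bounded_integrable_on[OF meas[OF Yc] bound])
  define J where "J = (\<lambda>y t. integral {0..t} (\<lambda>s. f s (Y y s)))"
  have Jlip: "norm (J y t - J y s) \<le> K * (t - s)" if st: "0 \<le> s" "s \<le> t" for y s t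
  proof -
    have "J y t - J y s = integral {s..t} (\<lambda>s. f s (Y y s))"
      unfolding J_def using Henstock_Kurzweil_Integration.integral_combine[OF st int] by (simp add: algebra_simps)
    moreover have "norm (integral {s..t} (\<lambda>s. f s (Y y s))) \<le> K * (t - s)"
      using has_integral_bound[OF K0, of "\<lambda>s. f s (Y y s)" _ s t] integrable_integral[OF int, of y s t] bound st by auto
    ultimately show ?thesis by simp
  qed
  have Jc: "continuous_on UNIV (\<lambda>t. J y (max 0 t))" for y
  proof (rule lipschitz_on_continuous_on[of K], rule lipschitz_on_leI)
    fix s t :: real assume "s \<le> t"
    then have "norm (J y (max 0 t) - J y (max 0 s)) \<le> K * (max 0 t - max 0 s)" by (intro Jlip) auto
    also have "\<dots> \<le> K * (t - s)" using \<open>s \<le> t\<close> K0 by (intro mult_left_mono) auto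
    finally show "dist (J y (max 0 s)) (J y (max 0 t)) \<le> K * dist s t"
      using \<open>s \<le> t\<close> by (simp add: dist_norm norm_minus_commute)
  qed (rule K0)
  \<comment> \<open>The Banach space consists of functions on the whole line, so negative times
    repeat the value at 0.\<close>
  define \<Phi> where "\<Phi> = (\<lambda>y t. exp (- (l * max 0 t)) *\<^sub>R (x0 + J y (max 0 t)))"
  have "\<Phi> y \<in> bcontfun" for y
    unfolding bcontfun_def
  proof (intro CollectI conjI)
    show "continuous_on UNIV (\<Phi> y)" unfolding \<Phi>_def
      by (intro continuous_on_scaleR continuous_on_exp continuous_on_minus continuous_on_mult_left
            continuous_on_max continuous_on_const continuous_on_id continuous_on_add Jc)
    show "bounded (range (\<Phi> y))"
    proof (rule boundedI)
      fix z assume "z \<in> range (\<Phi> y)"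
      then obtain t' where z: "z = \<Phi> y t'" by auto
      define t where "t = max 0 t'"
      have t: "0 \<le> t" by (simp add: t_def)
      have J0: "J y 0 = 0" by (simp add: J_def)
      have "norm (x0 + J y t) \<le> norm x0 + K * t"
        using norm_triangle_ineq[of x0 "J y t"] Jlip[of 0 t y] t J0 by simp
      then have "norm z \<le> exp (- (l * t)) * (norm x0 + K * t)" by (simp add: z \<Phi>_def t_def)
      also have "\<dots> = exp (- (l * t)) * norm x0 + (K / l) * ((l * t) * exp (- (l * t)))"
        using l by (simp add: field_simps)
      also have "\<dots> \<le> 1 * norm x0 + (K / l) * 1"
      proof (intro add_mono mult_right_mono mult_left_mono)
        show "exp (- (l * t)) \<le> 1" using l t by simp
        have "l * t \<le> exp (l * t)" using exp_ge_add_one_self[of "l * t"] by linarith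
        then have "(l * t) * exp (- (l * t)) \<le> exp (l * t) * exp (- (l * t))" by (intro mult_right_mono) auto
        then show "(l * t) * exp (- (l * t)) \<le> 1" by (simp add: exp_minus)
      qed (use K0 l in auto)
      finally show "norm z \<le> norm x0 + K / l" by simp
    qed
  qed
  then have "\<exists>h. apply_bcontfun h = \<Phi> y" for y using bcontfunE by metis
  then obtain \<Psi> where \<Psi>: "\<And>y. apply_bcontfun (\<Psi> y) = \<Phi> y" by metis
  have "dist (\<Psi> y) (\<Psi> z) \<le> (1 / 2) * dist y z" for y z
  proof (rule dist_bound)
    fix t' :: real
    define t where "t = max 0 t'"
    have t: "0 \<le> t" by (simp add: t_def)
    define d where "d = dist y z"
    \<comment> \<open>Integrating the weight divides by \<open>l = 2 * L\<close>; against the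
      Lipschitz constant \<open>L\<close> this leaves the contraction factor 1/2.\<close>
    have "((\<lambda>s. (L * d) * exp (l * s)) has_integral ((L * d / l) * exp (l * t) - (L * d / l) * exp (l * 0))) {0..t}"
      using l t by (intro fundamental_theorem_of_calculus)
        (auto intro!: derivative_eq_intros simp flip: has_real_derivative_iff_has_vector_derivative)
    then have e: "((\<lambda>s. (L * d) * exp (l * s)) has_integral ((d / 2) * (exp (l * t) - 1))) {0..t}"
      using L by (simp add: l_def algebra_simps)
    have "J y t - J z t = integral {0..t} (\<lambda>s. f s (Y y s) - f s (Y z s))"
      unfolding J_def by (rule Henstock_Kurzweil_Integration.integral_diff[OF int int, symmetric])
    moreover have "norm (integral {0..t} (\<lambda>s. f s (Y y s) - f s (Y z s))) \<le> integral {0..t} (\<lambda>s. (L * d) * exp (l * s))"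
    proof (rule integral_norm_bound_integral)
      show "(\<lambda>s. f s (Y y s) - f s (Y z s)) integrable_on {0..t}" by (intro Henstock_Kurzweil_Integration.integrable_diff int)
      show "(\<lambda>s. (L * d) * exp (l * s)) integrable_on {0..t}" using e by (rule has_integral_integrable)
      fix s assume "s \<in> {0..t}"
      have "norm (f s (Y y s) - f s (Y z s)) \<le> L * norm (Y y s - Y z s)" by (rule lip)
      also have "norm (Y y s - Y z s) = exp (l * s) * dist (y s) (z s)"
        by (simp add: Y_def dist_norm flip: scaleR_diff_right)
      also have "L * (exp (l * s) * dist (y s) (z s)) \<le> L * (exp (l * s) * d)"
        using L dist_bounded[of y s z] by (intro mult_left_mono) (auto simp: d_def)
      finally show "norm (f s (Y y s) - f s (Y z s)) \<le> (L * d) * exp (l * s)" by (simp add: mult_ac)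
    qed
    ultimately have "norm (J y t - J z t) \<le> (d / 2) * (exp (l * t) - 1)" by (simp only: integral_unique[OF e])
    then have "exp (- (l * t)) * norm (J y t - J z t) \<le> exp (- (l * t)) * ((d / 2) * (exp (l * t) - 1))"
      by (intro mult_left_mono) auto
    also have "\<dots> = (d / 2) * (1 - exp (- (l * t)))" by (simp add: exp_minus field_simps)
    also have "\<dots> \<le> (d / 2) * 1" by (intro mult_left_mono) (auto simp: d_def)
    finally have "exp (- (l * t)) * norm (J y t - J z t) \<le> d / 2" by simp
    moreover have "dist (\<Phi> y t') (\<Phi> z t') = exp (- (l * t)) * norm (J y t - J z t)"
      by (simp add: \<Phi>_def t_def dist_norm flip: scaleR_diff_right)
    ultimately show "dist (\<Psi> y t') (\<Psi> z t') \<le> (1 / 2) * dist y z" by (simp add: \<Psi> d_def)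
  qed
  then obtain y where y: "\<Psi> y = y" using banach_fix_type[of "1/2" \<Psi>] by auto
  have yt: "y t = exp (- (l * t)) *\<^sub>R (x0 + J y t)" if "0 \<le> t" for t
    using \<Psi>[of y] that unfolding y by (simp add: \<Phi>_def)
  define x where "x = (\<lambda>t. x0 + J y (max 0 t))"
  have xY: "Y y t = x t" if "0 \<le> t" for t
    using that by (simp add: Y_def yt x_def exp_minus)
  have "((\<lambda>s. f s (x s)) has_integral (x t - x0)) {0..t}" if t: "0 \<le> t" for t
  proof -
    have "((\<lambda>s. f s (Y y s)) has_integral J y t) {0..t}" unfolding J_def by (rule integrable_integral[OF int])
    then have "((\<lambda>s. f s (x s)) has_integral J y t) {0..t}" by (rule has_integral_eq[rotated]) (simp add: xY)
    then show ?thesis using t by (simp add: x_def)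
  qed
  moreover have "continuous_on UNIV x" unfolding x_def by (intro continuous_on_add continuous_on_const Jc)
  moreover have "x 0 = x0" by (simp add: x_def J_def)
  ultimately show ?thesis by blast
qed

text \<open>Solutions of the vector field truncated outside a ball of radius larger than the a priori
  bound never leave that ball.\<close>

lemma global_existence:
  fixes F :: "'x::euclidean_space \<Rightarrow> 'm::euclidean_space \<Rightarrow> 'x"
  assumes Fc: "continuous_on UNIV (case_prod F)"
    and lip: "\<And>r \<xi>. \<exists>\<delta>>0. \<exists>L. \<forall>x\<in>ball \<xi> \<delta>. \<forall>y\<in>ball \<xi> \<delta>. \<forall>u. norm u \<le> r \<longrightarrow> norm (F x u - F y u) \<le> L * norm (x - y)"
    and \<beta>: "classKL \<beta>" and c: "0 \<le> c" "AE t in lborel. 0 \<le> t \<longrightarrow> norm (u t) \<le> c"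
    and um: "u \<in> borel_measurable lborel"
    and est: "\<And>x T t. is_solution F u x T \<Longrightarrow> t \<in> {0..T} \<Longrightarrow> norm (x t) \<le> \<beta> (norm (x 0)) t + b"
  shows "\<exists>x. x 0 = x0 \<and> (\<forall>T\<ge>0. is_solution F u x T)"
proof -
  have [measurable]: "u \<in> borel_measurable borel" using um by simp
  define R where "R = \<beta> (norm x0) 0 + b"
  \<comment> \<open>The a priori bound is \<open>R\<close>, as \<open>\<beta>\<close> is largest at
    time 0. The margin 1 means that a solution would have to break this bound before the truncation
    acts.\<close>
  define S where "S = cball (0::'x) (R + 1)"
  \<comment> \<open>The estimate for the constant solution on the degenerate interval puts the
    initial state within the bound \<open>R\<close>.\<close>
  have triv: "is_solution F u (\<lambda>_. x0) 0" by (simp add: is_solution_def has_integral_refl)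
  have x0R: "norm x0 \<le> R" using est[OF triv, of 0] by (simp add: R_def)
  have R0: "0 \<le> R" using x0R norm_ge_zero order_trans by blast
  have S: "compact S" "convex S" "closed S" "S \<noteq> {}" using R0 by (auto simp: S_def)
  have "compact (case_prod F ` (S \<times> cball (0::'m) c))"
    by (intro compact_continuous_image continuous_on_subset[OF Fc] compact_Times S compact_cball) auto
  then obtain K where K: "0 < K" "\<And>y. y \<in> case_prod F ` (S \<times> cball 0 c) \<Longrightarrow> norm y \<le> K"
    using compact_imp_bounded bounded_pos by metis
  have KF: "norm (F x v) \<le> K" if "x \<in> S" "norm v \<le> c" for x v
    using that by (intro K(2) image_eqI[of _ _ "(x, v)"]) auto
  obtain L0 where L0: "0 \<le> L0" "\<And>v. v \<in> cball (0::'m) c \<Longrightarrow> L0-lipschitz_on S (\<lambda>x. F x v)"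
  proof -
    have "\<exists>L\<ge>0. \<forall>v\<in>cball (0::'m) c. L-lipschitz_on S (\<lambda>x. F x v)"
    proof (rule uniform_lipschitz_on_compact[OF S(1), where K="2 * K"])
      fix \<xi> assume "\<xi> \<in> S"
      obtain \<delta> L where "0 < \<delta>" "\<forall>x\<in>ball \<xi> \<delta>. \<forall>y\<in>ball \<xi> \<delta>. \<forall>u. norm u \<le> c \<longrightarrow> norm (F x u - F y u) \<le> L * norm (x - y)"
        using lip[of \<xi> c] by blast
      then show "\<exists>\<delta>>0. \<exists>L. \<forall>a\<in>S \<inter> ball \<xi> \<delta>. \<forall>b\<in>S \<inter> ball \<xi> \<delta>. \<forall>v\<in>cball (0::'m) c. dist (F a v) (F b v) \<le> L * dist a b"
        by (intro exI[of _ \<delta>] conjI exI[of _ L]) (auto simp: dist_norm)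
    next
      fix v x y assume "v \<in> cball (0::'m) c" "x \<in> S" "y \<in> S"
      then have "norm (F x v) \<le> K" "norm (F y v) \<le> K" by (auto intro: KF)
      then show "dist (F x v) (F y v) \<le> 2 * K"
        using norm_triangle_ineq4[of "F x v" "F y v"] by (simp add: dist_norm)
    qed
    then show ?thesis using that by blast
  qed
  define P where "P = closest_point S"
  have PS: "P y \<in> S" for y unfolding P_def using S by (intro closest_point_in_set)
  have Pl: "dist (P y) (P z) \<le> dist y z" for y z unfolding P_def using S by (intro closest_point_lipschitz)
  have Pc: "continuous_on UNIV P"
    by (rule lipschitz_on_continuous_on[of 1]) (auto intro!: lipschitz_onI Pl)
  \<comment> \<open>Modified on a null set of nonnegative times (and possibly at negative times),
    the input is bounded everywhere, so the truncated field is uniformly bounded and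
    Lipschitz.\<close>
  define w where "w = (\<lambda>s. if norm (u s) \<le> c then u s else 0)"
  have wm [measurable]: "w \<in> borel_measurable borel" unfolding w_def by measurable
  have wc: "norm (w s) \<le> c" for s using c by (simp add: w_def)
  define f where "f = (\<lambda>s y. F (P y) (w s))"
  have "\<exists>x. continuous_on UNIV x \<and> x 0 = x0 \<and> (\<forall>t\<ge>0. ((\<lambda>s. f s (x s)) has_integral (x t - x0)) {0..t})"
  proof (rule bounded_lipschitz_global_solution)
    fix y :: "real \<Rightarrow> 'x" assume "continuous_on UNIV y"
    from continuous_on_compose2[OF Pc this] have Pm: "(\<lambda>s. P (y s)) \<in> borel_measurable borel"
      by (intro borel_measurable_continuous_onI) simp
    show "(\<lambda>s. f s (y s)) \<in> borel_measurable borel"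
      unfolding f_def using Fc by (intro borel_measurable_continuous_Pair[OF Pm wm]) (simp add: case_prod_unfold)
  next
    show "norm (f s y) \<le> K" for s y unfolding f_def by (intro KF PS wc)
    show "norm (f s y - f s z) \<le> (L0 + 1) * norm (y - z)" for s y z
    proof -
      have "dist (f s y) (f s z) \<le> L0 * dist (P y) (P z)"
        unfolding f_def using wc[of s] by (intro lipschitz_onD[OF L0(2)] PS) simp
      also have "\<dots> \<le> (L0 + 1) * dist y z" using L0(1) by (intro mult_mono Pl) auto
      finally show ?thesis by (simp add: dist_norm)
    qed
    show "0 < L0 + 1" using L0(1) by simp
  qed
  then obtain x where xc: "continuous_on UNIV x" and x0: "x 0 = x0"
    and xi: "\<And>t. 0 \<le> t \<Longrightarrow> ((\<lambda>s. f s (x s)) has_integral (x t - x0)) {0..t}" by blast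
  have sol: "is_solution F u x T" if T: "0 \<le> T" and inS: "\<And>s. s \<in> {0..T} \<Longrightarrow> norm (x s) \<le> R + 1" for T
    unfolding is_solution_def
  proof (intro conjI ballI)
    show "continuous_on {0..T} x" using xc by (rule continuous_on_subset) simp
    fix t assume t: "t \<in> {0..T}"
    have ae: "AE s in lborel. s \<in> {0..t} \<longrightarrow> f s (x s) = F (x s) (u s)"
      using c(2)
    proof (eventually_elim, intro impI)
      fix s assume us: "0 \<le> s \<longrightarrow> norm (u s) \<le> c" and s: "s \<in> {0..t}"
      have "x s \<in> S" using inS[of s] s t by (simp add: S_def)
      then have "P (x s) = x s" by (simp add: P_def closest_point_self)
      moreover have "w s = u s" using us s by (simp add: w_def)
      ultimately show "f s (x s) = F (x s) (u s)" by (simp add: f_def)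
    qed
    show "((\<lambda>s. F (x s) (u s)) has_integral (x t - x 0)) {0..t}"
      using xi[of t] t unfolding x0 has_integral_AE[OF ae] by simp
  qed
  have inS: "norm (x t) \<le> R + 1" if t: "0 \<le> t" for t
  proof (rule ccontr)
    assume "\<not> norm (x t) \<le> R + 1"
    \<comment> \<open>Up to the first time at which the norm reaches \<open>R + 1\<close> the
      truncation is inactive. There the a priori estimate applies to the original system and bounds
      the norm by \<open>R\<close>, a contradiction.\<close>
    define A where "A = {s \<in> {0..t}. R + 1 \<le> norm (x s)}"
    have tA: "t \<in> A" using t \<open>\<not> norm (x t) \<le> R + 1\<close> by (simp add: A_def)
    have nc: "continuous_on {0..t} (\<lambda>s. norm (x s))"
      by (intro continuous_on_norm continuous_on_subset[OF xc]) simp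
    have "closed A"
      unfolding A_def using continuous_closed_preimage[OF nc closed_real_atLeastAtMost closed_atLeast[of "R + 1"]]
      by (simp add: vimage_def Int_def)
    moreover have bdd: "bdd_below A" by (rule bdd_belowI[of _ 0]) (auto simp: A_def)
    ultimately have IA: "Inf A \<in> A" using closed_contains_Inf[of A] tA by blast
    then have I: "0 \<le> Inf A" "R + 1 \<le> norm (x (Inf A))" by (auto simp: A_def)
    have before: "norm (x s) \<le> R + 1" if s: "0 \<le> s" "s < Inf A" for s
    proof (rule ccontr)
      assume "\<not> norm (x s) \<le> R + 1"
      then have "s \<in> A" using s IA by (auto simp: A_def)
      then show False using cInf_lower[OF _ bdd] s by fastforce
    qed
    have Ipos: "0 < Inf A"
    proof (rule ccontr)
      assume "\<not> 0 < Inf A"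
      then have "Inf A = 0" using I by simp
      then show False using I x0 x0R by simp
    qed
    have "norm (x (Inf A)) \<le> R + 1"
    proof -
      have "((\<lambda>s. norm (x s)) \<longlongrightarrow> norm (x (Inf A))) (at (Inf A))"
        using xc by (intro tendsto_norm) (simp add: continuous_on_def)
      then have lim: "((\<lambda>s. norm (x s)) \<longlongrightarrow> norm (x (Inf A))) (at_left (Inf A))"
        by (rule tendsto_within_subset) auto
      have "\<forall>\<^sub>F s in at_left (Inf A). norm (x s) \<le> R + 1"
        using before Ipos by (auto simp: eventually_at_left_field intro!: exI[of _ 0])
      then show ?thesis by (rule tendsto_upperbound[OF lim]) simp
    qed
    then have "norm (x s) \<le> R + 1" if "s \<in> {0..Inf A}" for s
      using before[of s] that by (cases "s = Inf A") auto
    then have "is_solution F u x (Inf A)" by (rule sol[OF I(1)])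
    then have "norm (x (Inf A)) \<le> \<beta> (norm (x 0)) (Inf A) + b" by (rule est) (use I in simp)
    also have "\<dots> \<le> R" using \<beta> I(1) unfolding R_def x0 classKL_def by simp
    finally show False using I by simp
  qed
  then show ?thesis using x0 sol by (intro exI[of _ x]) simp
qed

lemma dini_Lyap_imp_ISS:
  fixes F :: "'x::euclidean_space \<Rightarrow> 'm::euclidean_space \<Rightarrow> 'x"
  assumes Fc: "continuous_on UNIV (case_prod F)"
    and lip: "\<And>r \<xi>. \<exists>\<delta>>0. \<exists>L. \<forall>x\<in>ball \<xi> \<delta>. \<forall>y\<in>ball \<xi> \<delta>. \<forall>u. norm u \<le> r \<longrightarrow> norm (F x u - F y u) \<le> L * norm (x - y)"
    and "dini_Lyap F U"
  shows "ISS F"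
proof -
  obtain \<beta> \<gamma> where KL: "classKL \<beta>" "classK \<gamma>" and est: "\<And>u x T c t. 0 \<le> c \<Longrightarrow> (AE t in lborel. 0 \<le> t \<longrightarrow> norm (u t) \<le> c) \<Longrightarrow> is_solution F u x T \<Longrightarrow>
           t \<in> {0..T} \<Longrightarrow> norm (x t) \<le> \<beta> (norm (x 0)) t + \<gamma> c"
    using dini_Lyap_solution_estimate[OF Fc assms(3)] by blast
  have "\<exists>x. x 0 = x0 \<and> (\<forall>T\<ge>0. is_solution F u x T)" if u: "admissible_input u" for x0 u
  proof (rule global_existence[OF Fc lip KL(1) linf_AE[OF u]])
    show "u \<in> borel_measurable lborel" using u by (simp add: admissible_input_def)
    show "norm (x t) \<le> \<beta> (norm (x 0)) t + \<gamma> (linf u)" if "is_solution F u x T" "t \<in> {0..T}" for x T t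
      by (rule est[OF linf_AE[OF u] that])
  qed
  moreover have "norm (x t) \<le> \<beta> (norm (x 0)) t + \<gamma> (linf u)"
    if "admissible_input u" "is_solution F u x T" "t \<in> {0..T}" for u x T t
    by (rule est[OF linf_AE[OF that(1)] that(2,3)])
  ultimately show ?thesis unfolding ISS_def using KL by blast
qed

text \<open>The state splits into its blocks, and each block of an input with
  \<open>norm u \<le> r\<close> also has norm at most \<open>r\<close>, so the blockwise constants
  add up.\<close>

lemma sys_regular_locally_lipschitz:
  fixes F :: "real^'d::finite \<Rightarrow> real^'m::finite \<Rightarrow> real^'d"
  assumes reg: "sys_regular n blk blkU F" and blk: "\<forall>k. blk k < n"
  shows "\<exists>\<delta>>0. \<exists>L. \<forall>x\<in>ball \<xi> \<delta>. \<forall>y\<in>ball \<xi> \<delta>. \<forall>u. norm u \<le> r \<longrightarrow> norm (F x u - F y u) \<le> L * norm (x - y)"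
proof -
  have "\<forall>i. \<exists>\<delta> L. i < n \<longrightarrow> 0 < \<delta> \<and> (\<forall>x\<in>ball \<xi> \<delta>. \<forall>y\<in>ball \<xi> \<delta>. \<forall>u. norm (bproj blkU i u) \<le> r \<longrightarrow>
      norm (bproj blk i (F x u) - bproj blk i (F y u)) \<le> L * norm (x - y))"
    using reg unfolding sys_regular_def by meson
  then obtain \<delta> L where \<delta>: "\<And>i. i < n \<Longrightarrow> 0 < \<delta> i"
    and L: "\<And>i x y u. i < n \<Longrightarrow> x \<in> ball \<xi> (\<delta> i) \<Longrightarrow> y \<in> ball \<xi> (\<delta> i) \<Longrightarrow> norm (bproj blkU i u) \<le> r \<Longrightarrow>
      norm (bproj blk i (F x u) - bproj blk i (F y u)) \<le> L i * norm (x - y)"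
    by metis
  define d where "d = Min (insert 1 (\<delta> ` {..<n}))"
  have d: "0 < d" "\<And>i. i < n \<Longrightarrow> d \<le> \<delta> i" using \<delta> by (auto simp: d_def)
  have "norm (F x u - F y u) \<le> (\<Sum>i<n. L i) * norm (x - y)"
    if xy: "x \<in> ball \<xi> d" "y \<in> ball \<xi> d" and u: "norm u \<le> r" for x y u
  proof -
    have "norm (F x u - F y u) = norm (\<Sum>i<n. bproj blk i (F x u - F y u))" using sum_bproj[OF blk] by simp
    also have "\<dots> \<le> (\<Sum>i<n. norm (bproj blk i (F x u - F y u)))" by (rule norm_sum)
    also have "\<dots> \<le> (\<Sum>i<n. L i * norm (x - y))"
    proof (rule sum_mono)
      fix i assume "i \<in> {..<n}"
      then have i: "i < n" by simp
      have "norm (bproj blkU i u) \<le> r" using norm_bproj_le[of blkU i u] u by linarith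
      then show "norm (bproj blk i (F x u - F y u)) \<le> L i * norm (x - y)"
        unfolding bproj_diff using xy d(2)[OF i] by (intro L[OF i]) auto
    qed
    finally show ?thesis by (simp add: sum_distrib_right)
  qed
  then show ?thesis using d(1) by blast
qed

theorem theorem5:
  fixes n :: nat
    and blk :: "'d::finite \<Rightarrow> nat" and blkU :: "'m::finite \<Rightarrow> nat"
    and F :: "real^'d \<Rightarrow> real^'m \<Rightarrow> real^'d"
    and Isum :: "nat set"
    and V :: "nat \<Rightarrow> real^'d \<Rightarrow> real"
    and \<gamma> :: "nat \<Rightarrow> nat \<Rightarrow> real \<Rightarrow> real"
    and gi :: "nat \<Rightarrow> real \<Rightarrow> real" and \<alpha>i :: "nat \<Rightarrow> real \<Rightarrow> real"
    and \<alpha> :: "real \<Rightarrow> real"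
  assumes n_pos: "0 < n"
    and blk_range: "\<forall>k. blk k < n" and blk_nonempty: "\<forall>i<n. \<exists>k. blk k = i"
    and blkU_range: "\<forall>j. blkU j < n"
    and Isum_sub: "Isum \<subseteq> {..<n}"
    and regular: "sys_regular n blk blkU F"
    and gains: "\<forall>i<n. \<forall>j<n. classKinf (\<gamma> i j) \<or> zero_gain (\<gamma> i j)"
    and gains_diag: "\<forall>i<n. zero_gain (\<gamma> i i)"
    and subISS: "\<forall>i<n. sub_ISS_Lyap n blk Isum F V \<gamma> gi \<alpha>i i"
    and irred: "gain_irreducible n \<gamma>"
    and alpha: "classKinf \<alpha>"
    and small_gain: "\<forall>s. (\<forall>i<n. 0 \<le> s i) \<and> (\<exists>i<n. s i \<noteq> 0) \<longrightarrow>
                       (\<exists>i<n. gain_op n Isum \<gamma> (Dalpha Isum \<alpha> s) i < s i)"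
  shows "ISS F \<and>
    (\<forall>\<sigma>. Omega_path n (\<lambda>s. Dalpha Isum \<alpha> (gain_op n Isum \<gamma> s)) \<sigma> \<longrightarrow>
       ISS_Lyap F (\<lambda>x. Max ((\<lambda>i. Kinv (\<sigma> i) (V i (bproj blk i x))) ` {..<n})))"
proof -
  have F_cont: "continuous_on UNIV (case_prod F)" using regular by (simp add: sys_regular_def)
  \<comment> \<open>Stated for any path with these four properties: it serves the constructed path
    for stability and the given Omega-path for the Lyapunov claim.\<close>
  have core: "dini_Lyap F (\<lambda>x. Max ((\<lambda>i. Kinv (\<sigma> i) (V i (bproj blk i x))) ` {..<n}))"
    if \<sigma>: "\<And>i. i < n \<Longrightarrow> classKinf (\<sigma> i)" "\<And>i. i < n \<Longrightarrow> locLip {0<..} (Kinv (\<sigma> i))"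
      "\<And>i. i < n \<Longrightarrow> slope_below (Kinv (\<sigma> i))"
      "\<And>r i. 0 < r \<Longrightarrow> i < n \<Longrightarrow> Dalpha Isum \<alpha> (gain_op n Isum \<gamma> (\<lambda>j. \<sigma> j r)) i < \<sigma> i r" for \<sigma>
  proof -
    interpret network n blk F Isum V \<gamma> gi \<alpha>i \<alpha> \<sigma>
      using n_pos blk_range F_cont gains subISS alpha \<sigma> by unfold_locales auto
    have "U = (\<lambda>x. Max ((\<lambda>i. Kinv (\<sigma> i) (V i (bproj blk i x))) ` {..<n}))"
      by (simp add: U_def W_def g_def fun_eq_iff)
    then show ?thesis using U_dini_Lyap by simp
  qed
  have "ISS F"
  proof -
    interpret mixed_gains n Isum \<gamma> \<alpha>
      using n_pos gains irred alpha small_gain by unfold_locales auto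
    \<comment> \<open>One coordinate from each nonempty block embeds the subsystem indices into
      \<open>'d\<close>, as the application of Brouwer's theorem requires.\<close>
    obtain k where k: "\<And>i. i < n \<Longrightarrow> blk (k i) = i" using blk_nonempty by metis
    have "inj_on k {..<n}" by (rule inj_onI) (metis k lessThan_iff)
    then obtain \<sigma> where \<sigma>: "\<And>i. i < n \<Longrightarrow> classKinf (\<sigma> i) \<and> bilip_path (\<sigma> i)"
      "\<And>r i. 0 < r \<Longrightarrow> i < n \<Longrightarrow> Dalpha Isum \<alpha> (gain_op n Isum \<gamma> (\<lambda>j. \<sigma> j r)) i < \<sigma> i r"
      using exists_bilipschitz_path by blast
    have "dini_Lyap F (\<lambda>x. Max ((\<lambda>i. Kinv (\<sigma> i) (V i (bproj blk i x))) ` {..<n}))"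
      using \<sigma> Kinv_bilip by (intro core) blast+
    then show ?thesis
      by (rule dini_Lyap_imp_ISS[OF F_cont sys_regular_locally_lipschitz[OF regular blk_range]])
  qed
  moreover have "ISS_Lyap F (\<lambda>x. Max ((\<lambda>i. Kinv (\<sigma> i) (V i (bproj blk i x))) ` {..<n}))"
    if \<sigma>: "Omega_path n (\<lambda>s. Dalpha Isum \<alpha> (gain_op n Isum \<gamma> s)) \<sigma>" for \<sigma>
  proof (rule dini_Lyap_imp_ISS_Lyap, rule core)
    show "classKinf (\<sigma> i)" and lip: "locLip {0<..} (Kinv (\<sigma> i))" if "i < n" for i
      using \<sigma> that by (auto simp: Omega_path_def)
    show "slope_below (Kinv (\<sigma> i))" if i: "i < n" for i
    proof (rule slope_below_from_derivative_bound[OF lip[OF i]])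
      fix P :: "real set" assume "compact P" "P \<subseteq> {0<..}"
      then obtain c C where "0 < c"
        "\<forall>i<n. \<forall>r\<in>P. \<forall>d. (Kinv (\<sigma> i) has_real_derivative d) (at r) \<longrightarrow> c \<le> d \<and> d \<le> C"
        using \<sigma> unfolding Omega_path_def by meson
      then show "\<exists>c>0. \<forall>r\<in>P. \<forall>d. (Kinv (\<sigma> i) has_real_derivative d) (at r) \<longrightarrow> c \<le> d"
        using i by blast
    qed
    show "Dalpha Isum \<alpha> (gain_op n Isum \<gamma> (\<lambda>j. \<sigma> j r)) i < \<sigma> i r" if "0 < r" "i < n" for r i
      using \<sigma> that by (simp add: Omega_path_def)
  qed
  ultimately show ?thesis by blast
qed

end
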